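(* Let $f\in C(I,I)$ with $h(f)=0$. The following are equivalent: (1) $f$ is Li-Yorke chaotic; (2) $f$ has a scrambled pair; (3) there exist $\delta>0$ and a Cantor set $K\subset I$ that is $\delta$-scrambled; (4) $f$ has an $f$-nonseparable pair.
   Context: $I=[0,1]$, $C(I,I)$ continuous self-maps of $I$, $h(f)$ topological entropy, $\omega_f(x)$ the $\omega$-limit set of $x$. A pair $\langle x,y\rangle$ is proximal if $\liminf_n|f^n(x)-f^n(y)|=0$, asymptotic if $\lim_n|f^n(x)-f^n(y)|=0$, scrambled if proximal but not asymptotic, and $\delta$-scrambled if $\liminf_n|f^n(x)-f^n(y)|=0$ and $\limsup_n|f^n(x)-f^n(y)|\ge\delta$. A set $C$ is scrambled ($\delta$-scrambled) if every pair of distinct points of $C$ is scrambled ($\delta$-scrambled); $f$ is Li-Yorke chaotic if it has an uncountable scrambled set. Periodic portion: for $h(f)=0$ and $\omega_f(x)$ infinite, $J_k^i=[\min\omega_{f^{2^k}}(f^i(x)),\max\omega_{f^{2^k}}(f^i(x))]$ for $k\ge1$, $0\le i<2^k$; for fixed $k$ these are pairwise disjoint closed intervals and $J_{k+1}^i\cup J_{k+1}^{2^k+i}\subset J_k^i$. A nested sequence is a choice of $i_k$ with $J_1^{i_1}\supset J_2^{i_2}\supset\cdots$. A pair $\langle u,v\rangle$, $u\ne v$, is $f$-nonseparable if for some $x$ with $\omega_f(x)$ infinite there is a nested sequence of the periodic portion of $\omega_f(x)$ with $\bigcap_kJ_k^{i_k}=[u,v]$ or $[v,u]$. *)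

theory Defs
  imports "HOL-Analysis.Analysis" "HOL-Library.Liminf_Limsup"
begin

definition unitI :: "real set" where "unitI = {0..1}"

definition self_map_I :: "(real \<Rightarrow> real) \<Rightarrow> bool" where
  "self_map_I f \<longleftrightarrow> continuous_on unitI f \<and> f ` unitI \<subseteq> unitI"

definition separated_set :: "(real \<Rightarrow> real) \<Rightarrow> nat \<Rightarrow> real \<Rightarrow> real set \<Rightarrow> bool" where
  "separated_set f n \<epsilon> E \<longleftrightarrow> E \<subseteq> unitI \<and>
     (\<forall>x\<in>E. \<forall>y\<in>E. x \<noteq> y \<longrightarrow> (\<exists>k<n. \<bar>(f^^k) x - (f^^k) y\<bar> > \<epsilon>))"

definition max_separated :: "(real \<Rightarrow> real) \<Rightarrow> nat \<Rightarrow> real \<Rightarrow> nat" where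
  "max_separated f n \<epsilon> = Sup {card E | E. finite E \<and> separated_set f n \<epsilon> E}"

definition topological_entropy :: "(real \<Rightarrow> real) \<Rightarrow> ereal" where
  "topological_entropy f =
     (SUP \<epsilon>\<in>{0<..}. limsup (\<lambda>n. ereal (ln (real (max_separated f n \<epsilon>)) / real n)))"

definition omega_limit :: "(real \<Rightarrow> real) \<Rightarrow> real \<Rightarrow> real set" where
  "omega_limit f x = (\<Inter>N. closure {(f^^n) x | n. n \<ge> N})"

definition proximal :: "(real \<Rightarrow> real) \<Rightarrow> real \<Rightarrow> real \<Rightarrow> bool" where
  "proximal f x y \<longleftrightarrow> liminf (\<lambda>n. ereal \<bar>(f^^n) x - (f^^n) y\<bar>) = 0"

definition asymptotic :: "(real \<Rightarrow> real) \<Rightarrow> real \<Rightarrow> real \<Rightarrow> bool" where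
  "asymptotic f x y \<longleftrightarrow> (\<lambda>n. \<bar>(f^^n) x - (f^^n) y\<bar>) \<longlonglongrightarrow> 0"

definition scrambled_pair :: "(real \<Rightarrow> real) \<Rightarrow> real \<Rightarrow> real \<Rightarrow> bool" where
  "scrambled_pair f x y \<longleftrightarrow> proximal f x y \<and> \<not> asymptotic f x y"

definition delta_scrambled_pair :: "(real \<Rightarrow> real) \<Rightarrow> real \<Rightarrow> real \<Rightarrow> real \<Rightarrow> bool" where
  "delta_scrambled_pair f \<delta> x y \<longleftrightarrow>
     liminf (\<lambda>n. ereal \<bar>(f^^n) x - (f^^n) y\<bar>) = 0 \<and>
     limsup (\<lambda>n. ereal \<bar>(f^^n) x - (f^^n) y\<bar>) \<ge> ereal \<delta>"

definition scrambled_set :: "(real \<Rightarrow> real) \<Rightarrow> real set \<Rightarrow> bool" where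
  "scrambled_set f C \<longleftrightarrow> (\<forall>x\<in>C. \<forall>y\<in>C. x \<noteq> y \<longrightarrow> scrambled_pair f x y)"

definition delta_scrambled_set :: "(real \<Rightarrow> real) \<Rightarrow> real \<Rightarrow> real set \<Rightarrow> bool" where
  "delta_scrambled_set f \<delta> C \<longleftrightarrow> (\<forall>x\<in>C. \<forall>y\<in>C. x \<noteq> y \<longrightarrow> delta_scrambled_pair f \<delta> x y)"

definition li_yorke_chaotic :: "(real \<Rightarrow> real) \<Rightarrow> bool" where
  "li_yorke_chaotic f \<longleftrightarrow> (\<exists>C\<subseteq>unitI. uncountable C \<and> scrambled_set f C)"

definition cantor_set :: "real set \<Rightarrow> bool" where
  "cantor_set K \<longleftrightarrow> K \<noteq> {} \<and> compact K \<and> (\<forall>x\<in>K. x islimpt K) \<and>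
     (\<forall>C\<subseteq>K. connected C \<longrightarrow> (\<exists>a. C \<subseteq> {a}))"

definition periodic_portion :: "(real \<Rightarrow> real) \<Rightarrow> real \<Rightarrow> nat \<Rightarrow> nat \<Rightarrow> real set" where
  "periodic_portion f x k i =
     {Inf (omega_limit (f^^(2^k)) ((f^^i) x)) .. Sup (omega_limit (f^^(2^k)) ((f^^i) x))}"

definition nested_sequence :: "(real \<Rightarrow> real) \<Rightarrow> real \<Rightarrow> (nat \<Rightarrow> nat) \<Rightarrow> bool" where
  "nested_sequence f x ik \<longleftrightarrow>
     (\<forall>k\<ge>1. ik k < 2^k) \<and>
     (\<forall>k\<ge>1. periodic_portion f x (Suc k) (ik (Suc k)) \<subseteq> periodic_portion f x k (ik k))"

definition nonseparable_pair :: "(real \<Rightarrow> real) \<Rightarrow> real \<Rightarrow> real \<Rightarrow> bool" where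
  "nonseparable_pair f u v \<longleftrightarrow> u \<noteq> v \<and>
     (\<exists>x\<in>unitI. infinite (omega_limit f x) \<and>
        (\<exists>ik. nested_sequence f x ik \<and>
           (\<Inter>k\<in>{1..}. periodic_portion f x k (ik k)) = {min u v .. max u v}))"

end

theory Submission
  imports Defs
begin

text \<open>
  Zero entropy excludes, for every iterate, two disjoint compact sets each of whose images covers
  both. This forces every orbit with infinite \<open>\<omega>\<close>-limit set to alternate eventually around a
  fixed point; applied to the iterates \<open>f ^^ (2 ^ k)\<close>, this gives the disjoint periodic portions
  and excludes periodic points from infinite \<open>\<omega>\<close>-limit sets.

  For a scrambled pair both \<open>\<omega>\<close>-limit sets are infinite. By proximality the portions of the two
  orbits meet for every residue, and along residues for which the orbits stay apart infinitely
  often the two nested sequences cannot both shrink to points: one yields a nonseparable pair.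

  Conversely, let \<open>{u..v}\<close> be the intersection of a nested sequence. The hulls of the tails of the
  orbit along its residues contain a part near \<open>u\<close> and a part near \<open>v\<close> that both cover,
  after a common time, a deeper hull; between two such choices the orbit can be routed through
  arbitrarily short intervals. Coding binary sequences by these choices gives a tree of intervals.
  Its branches are disjoint intervals, so only countably many are nondegenerate, and
  diagonalizing against these leaves a Cantor set of points.
\<close>

subsection \<open>Zero entropy and horseshoes\<close>

text \<open>The unwanted orbit patterns are refuted by exhibiting a horseshoe of some iterate. Since
  iterates and left-right symmetry enter everywhere, the argument is run for maps of the whole line
  with bounded range, a class closed under both; \<open>clamped\<close> brings the given map into
  it.

  The obstacle in the converse is simultaneity: the part near \<open>u\<close> and the part near
  \<open>v\<close> must cover the same hull at the same time. Coverings come from odd multiples of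
  \<open>2 ^ p\<close>, which exchange the two halves of a residue class modulo
  \<open>2 ^ p\<close>. A half that splits off to the left of the nested sequence serves the left
  part, one on the right the right part. If all late halves split off on the same side, the other
  part has none, and a return of the orbit to its endpoint must replace it. As this is a return of
  the orbit itself, hulls of orbit tails are used instead of hulls of limit sets. The scrambling
  constant is a third of \<open>v - u\<close>, the width left between the two parts.\<close>

lemma itinerary_exists:
  assumes "A \<union> B \<subseteq> g ` A" "A \<union> B \<subseteq> g ` B" "A \<noteq> {}"
  shows "\<exists>x\<in>A \<union> B. \<forall>k<length w. (g ^^ k) x \<in> (if w ! k then A else B)"
proof (induction w)
  case Nil
  then show ?case using assms(3) by auto
next
  case (Cons b w)
  then obtain x where x: "x \<in> A \<union> B" "\<forall>k<length w. (g ^^ k) x \<in> (if w ! k then A else B)"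
    by blast
  obtain x' where x': "x' \<in> (if b then A else B)" "g x' = x"
  proof -
    have "x \<in> g ` (if b then A else B)" using assms x(1) by (cases b) auto
    then show ?thesis using that by blast
  qed
  have "(g ^^ k) x' \<in> (if (b # w) ! k then A else B)" if "k < length (b # w)" for k
  proof (cases k)
    case 0
    then show ?thesis using x'(1) by simp
  next
    case (Suc j)
    then show ?thesis using x x' that
      by (simp add: funpow_Suc_right del: funpow.simps)
  qed
  moreover have "x' \<in> A \<union> B" using x'(1) by (auto split: if_splits)
  ultimately show ?case by blast
qed

lemma funpow_unitI:
  assumes "self_map_I f" "x \<in> unitI"
  shows "(f ^^ n) x \<in> unitI"
  using assms by (induction n) (auto simp: self_map_I_def)

lemma continuous_on_funpow_unitI:
  assumes "self_map_I f"
  shows "continuous_on unitI (f ^^ n)"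
proof (induction n)
  case 0
  then show ?case by (simp add: id_def)
next
  case (Suc n)
  have "continuous_on unitI (f \<circ> (f ^^ n))"
    by (rule continuous_on_compose[OF Suc])
      (use assms funpow_unitI[OF assms] in \<open>auto simp: self_map_I_def intro: continuous_on_subset\<close>)
  then show ?case by (simp add: o_def)
qed

text \<open>\<open>max_separated\<close> is a \<open>Sup\<close> of naturals, which dominates its
  members only for a bounded set. By uniform continuity of the first \<open>n\<close> iterates,
  points closer than some \<open>d\<close> are never separated, so \<open>floor (x / d)\<close> is
  injective on a separated set.\<close>

lemma separated_set_card_bdd_above:
  assumes f: "self_map_I f" and e: "\<epsilon> > 0"
  shows "bdd_above {card E | E. finite E \<and> separated_set f n \<epsilon> E}"
proof -
  have "\<exists>d>0. \<forall>k<n. \<forall>x\<in>unitI. \<forall>y\<in>unitI. \<bar>x - y\<bar> < d \<longrightarrow> \<bar>(f ^^ k) x - (f ^^ k) y\<bar> < \<epsilon>"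
  proof (induction n)
    case 0
    then show ?case by (intro exI[of _ 1]) simp
  next
    case (Suc n)
    then obtain d where d: "d > 0" "\<forall>k<n. \<forall>x\<in>unitI. \<forall>y\<in>unitI. \<bar>x - y\<bar> < d \<longrightarrow> \<bar>(f ^^ k) x - (f ^^ k) y\<bar> < \<epsilon>"
      by blast
    have "uniformly_continuous_on unitI (f ^^ n)"
      by (rule compact_uniformly_continuous[OF continuous_on_funpow_unitI[OF f]]) (simp add: unitI_def)
    then obtain d' where d': "d' > 0"
      "\<And>x y. x \<in> unitI \<Longrightarrow> y \<in> unitI \<Longrightarrow> dist y x < d' \<Longrightarrow> dist ((f ^^ n) y) ((f ^^ n) x) < \<epsilon>"
      by (rule uniformly_continuous_onE[OF _ e]) blast
    show ?case
    proof (intro exI[of _ "min d d'"] conjI allI impI ballI)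
      show "min d d' > 0" using d d' by simp
      fix k x y assume "k < Suc n" "x \<in> unitI" "y \<in> unitI" "\<bar>x - y\<bar> < min d d'"
      then show "\<bar>(f ^^ k) x - (f ^^ k) y\<bar> < \<epsilon>"
        using d(2) d'(2)[of y x] unfolding dist_real_def by (cases "k = n") auto
    qed
  qed
  then obtain d where d: "d > 0"
    "\<And>k x y. k < n \<Longrightarrow> x \<in> unitI \<Longrightarrow> y \<in> unitI \<Longrightarrow> \<bar>x - y\<bar> < d \<Longrightarrow> \<bar>(f ^^ k) x - (f ^^ k) y\<bar> < \<epsilon>"
    by blast
  have "card E \<le> card {0..\<lfloor>1 / d\<rfloor>}" if "finite E" and E: "separated_set f n \<epsilon> E" for E
  proof (rule card_inj_on_le)
    show "inj_on (\<lambda>x. \<lfloor>x / d\<rfloor>) E"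
    proof (rule inj_onI, rule ccontr)
      fix x y assume xy: "x \<in> E" "y \<in> E" "\<lfloor>x / d\<rfloor> = \<lfloor>y / d\<rfloor>" "x \<noteq> y"
      then obtain k where "k < n" "\<bar>(f ^^ k) x - (f ^^ k) y\<bar> > \<epsilon>"
        using E unfolding separated_set_def by blast
      moreover have "\<bar>x / d - y / d\<bar> < 1" using xy(3) by linarith
      then have "\<bar>x - y\<bar> < d" using d(1) by (simp add: diff_divide_distrib[symmetric] abs_divide)
      ultimately show False
        using d(2)[of k x y] xy E unfolding separated_set_def by fastforce
    qed
    show "(\<lambda>x. \<lfloor>x / d\<rfloor>) ` E \<subseteq> {0..\<lfloor>1 / d\<rfloor>}"
    proof clarify
      fix x assume "x \<in> E"
      then have "0 \<le> x" "x \<le> 1" using E unfolding separated_set_def unitI_def by auto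
      then have "0 \<le> x / d" "x / d \<le> 1 / d" using d(1) by (simp_all add: divide_right_mono)
      then show "\<lfloor>x / d\<rfloor> \<in> {0..\<lfloor>1 / d\<rfloor>}" by (simp add: floor_mono)
    qed
  qed simp
  then show ?thesis by (auto intro!: bdd_aboveI)
qed

text \<open>The \<open>2 ^ m\<close> itineraries of length \<open>m\<close> through \<open>A\<close>
  and \<open>B\<close> are realized by points that are separated within \<open>n * m\<close> steps,
  so the growth rate is at least \<open>ln 2 / n\<close>.\<close>

lemma zero_entropy_no_horseshoe:
  assumes f: "self_map_I f" and h: "topological_entropy f = 0"
    and n: "n \<ge> 1" and A: "compact A" "A \<noteq> {}" and B: "compact B" and AB: "A \<inter> B = {}"
    and I: "A \<union> B \<subseteq> unitI" and cov: "A \<union> B \<subseteq> (f ^^ n) ` A" "A \<union> B \<subseteq> (f ^^ n) ` B"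
  shows False
proof -
  define g where "g = f ^^ n"
  have "B \<noteq> {}" using cov A by auto
  then obtain d where d: "d > 0" "\<And>a b. a \<in> A \<Longrightarrow> b \<in> B \<Longrightarrow> d \<le> dist a b"
    using separate_compact_closed[OF A(1) compact_imp_closed[OF B] AB] by blast
  \<comment> \<open>Half the distance of \<open>A\<close> and \<open>B\<close>, because
    \<open>separated_set\<close> asks for a strict inequality.\<close>
  define \<epsilon> where "\<epsilon> = d / 2"
  have \<epsilon>: "\<epsilon> > 0" "\<And>a b. a \<in> A \<Longrightarrow> b \<in> B \<Longrightarrow> \<bar>a - b\<bar> > \<epsilon>"
    using d unfolding \<epsilon>_def dist_real_def by force+
  have big: "2 ^ m \<le> max_separated f (n * m) \<epsilon>" for m
  proof -
    obtain P where P: "\<And>w. P w \<in> A \<union> B"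
      "\<And>w k. k < length w \<Longrightarrow> (g ^^ k) (P w) \<in> (if w ! k then A else B)"
      using itinerary_exists[OF cov(1,2) A(2)] unfolding g_def by metis
    define L where "L = {w :: bool list. set w \<subseteq> UNIV \<and> length w = m}"
    have sep: "\<exists>k<n * m. \<bar>(f ^^ k) (P v) - (f ^^ k) (P w)\<bar> > \<epsilon>"
      if vw: "v \<in> L" "w \<in> L" "v \<noteq> w" for v w
    proof -
      obtain k where k: "k < m" "v ! k \<noteq> w ! k"
        using vw unfolding L_def by (auto simp: list_eq_iff_nth_eq)
      have "\<bar>(g ^^ k) (P v) - (g ^^ k) (P w)\<bar> > \<epsilon>"
        using P(2)[of k v] P(2)[of k w] k vw \<epsilon>(2)[of "(g ^^ k) (P v)" "(g ^^ k) (P w)"]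
          \<epsilon>(2)[of "(g ^^ k) (P w)" "(g ^^ k) (P v)"]
        unfolding L_def by (auto split: if_splits simp: abs_minus_commute)
      moreover have "n * k < n * m" using k n by simp
      ultimately show ?thesis unfolding g_def by (metis funpow_mult)
    qed
    have "inj_on P L"
    proof (rule inj_onI, rule ccontr)
      fix v w assume "v \<in> L" "w \<in> L" "P v = P w" "v \<noteq> w"
      then show False using sep[of v w] \<epsilon>(1) by auto
    qed
    then have "card (P ` L) = 2 ^ m"
      unfolding L_def by (simp add: card_image card_lists_length_eq[of UNIV, simplified])
    moreover have "separated_set f (n * m) \<epsilon> (P ` L)"
      unfolding separated_set_def using P(1) I sep by blast
    moreover have "finite (P ` L)"
      unfolding L_def by (intro finite_imageI finite_lists_length_eq) simp
    ultimately have "2 ^ m \<in> {card E | E. finite E \<and> separated_set f (n * m) \<epsilon> E}" by (metis (mono_tags, lifting) mem_Collect_eq)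
    then show ?thesis unfolding max_separated_def
      by (rule cSup_upper) (rule separated_set_card_bdd_above[OF f \<epsilon>(1)])
  qed
  let ?u = "\<lambda>k. ereal (ln (real (max_separated f k \<epsilon>)) / real k)"
  have "ereal (ln 2 / n) \<le> ?u (n * m)" if m: "m \<ge> 1" for m
  proof -
    have "real m * ln 2 = ln (2 ^ m)" by (simp add: ln_realpow)
    also have "\<dots> \<le> ln (real (max_separated f (n * m) \<epsilon>))"
    proof (rule ln_mono)
      show "2 ^ m \<le> real (max_separated f (n * m) \<epsilon>)"
        using big[of m] of_nat_le_iff[of "2 ^ m", where ?'a = real] by simp
    qed simp
    finally have "(real m * ln 2) / real (n * m) \<le> ln (real (max_separated f (n * m) \<epsilon>)) / real (n * m)"
      by (rule divide_right_mono) simp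
    then show ?thesis using m n by (simp add: field_simps)
  qed
  then have "ereal (ln 2 / n) \<le> ?u (n * Suc m)" for m
    using le_add1[of 1 m] unfolding plus_1_eq_Suc by blast
  then have "ereal (ln 2 / n) \<le> liminf (\<lambda>m. ?u (n * Suc m))"
    by (intro Liminf_bounded always_eventually allI)
  also have "\<dots> \<le> limsup (\<lambda>m. ?u (n * Suc m))" by (rule Liminf_le_Limsup) simp
  also have "\<dots> \<le> limsup ?u"
  proof -
    have "strict_mono (\<lambda>m. n * Suc m)" using n by (intro strict_monoI mult_strict_left_mono) auto
    from limsup_subseq_mono[OF this, of ?u] show ?thesis by (simp add: o_def)
  qed
  also have "\<dots> \<le> topological_entropy f"
    unfolding topological_entropy_def by (rule SUP_upper) (use \<epsilon> in simp)
  finally have "ereal (ln 2 / n) \<le> ereal 0" using h by (simp add: zero_ereal_def)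
  then show False using n by (simp add: divide_le_0_iff)
qed

text \<open>Domain the whole line, so that no invariance conditions have to be carried along; the
  quantifier over \<open>n\<close> makes the property pass to iterates.\<close>

definition horseshoe_free :: "(real \<Rightarrow> real) \<Rightarrow> bool" where
  "horseshoe_free f \<longleftrightarrow> continuous_on UNIV f \<and> bounded (range f) \<and>
     (\<forall>n\<ge>1. \<forall>A B. compact A \<longrightarrow> compact B \<longrightarrow> A \<noteq> {} \<longrightarrow> A \<inter> B = {} \<longrightarrow>
        A \<union> B \<subseteq> (f ^^ n) ` A \<longrightarrow> A \<union> B \<subseteq> (f ^^ n) ` B \<longrightarrow> False)"

text \<open>The conjugate of \<open>f\<close> by negation. It turns each one-sided lemma into its
  mirror image.\<close>

definition reflect :: "(real \<Rightarrow> real) \<Rightarrow> real \<Rightarrow> real" where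
  "reflect f t = - f (- t)"

lemma continuous_on_funpow:
  fixes f :: "'a::topological_space \<Rightarrow> 'a"
  assumes "continuous_on UNIV f"
  shows "continuous_on UNIV (f ^^ n)"
proof (induction n)
  case 0
  then show ?case by (simp add: id_def)
next
  case (Suc n)
  show ?case
    using continuous_on_compose[OF Suc continuous_on_subset[OF assms]] by (simp add: o_def)
qed

lemma horseshoe_freeD:
  assumes "horseshoe_free f"
  shows "continuous_on UNIV f" "bounded (range f)" "continuous_on S (f ^^ n)"
proof -
  show f: "continuous_on UNIV f" "bounded (range f)"
    using assms unfolding horseshoe_free_def by simp_all
  show "continuous_on S (f ^^ n)"
    by (rule continuous_on_subset[OF continuous_on_funpow[OF f(1)]]) simp
qed

lemma horseshoe_free_no_horseshoe:
  assumes "horseshoe_free f" "n \<ge> 1" "compact A" "compact B" "A \<noteq> {}" "A \<inter> B = {}"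
    "A \<union> B \<subseteq> (f ^^ n) ` A" "A \<union> B \<subseteq> (f ^^ n) ` B"
  shows False
  using assms unfolding horseshoe_free_def by meson

lemma horseshoe_freeI:
  assumes "continuous_on UNIV f" "bounded (range f)"
    "\<And>n A B. n \<ge> 1 \<Longrightarrow> compact A \<Longrightarrow> compact B \<Longrightarrow> A \<noteq> {} \<Longrightarrow> A \<inter> B = {} \<Longrightarrow>
        A \<union> B \<subseteq> (f ^^ n) ` A \<Longrightarrow> A \<union> B \<subseteq> (f ^^ n) ` B \<Longrightarrow> False"
  shows "horseshoe_free f"
  unfolding horseshoe_free_def using assms by (intro conjI allI impI) assumption+

lemma horseshoe_free_funpow:
  assumes f: "horseshoe_free f" and n: "n \<ge> 1"
  shows "horseshoe_free (f ^^ n)"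
proof -
  have "range (f ^^ n) \<subseteq> range f" using n by (cases n) auto
  then have "bounded (range (f ^^ n))" by (rule bounded_subset[OF horseshoe_freeD(2)[OF f]])
  moreover have False
    if "m \<ge> 1" "compact A" "compact B" "A \<noteq> {}" "A \<inter> B = {}"
      "A \<union> B \<subseteq> ((f ^^ n) ^^ m) ` A" "A \<union> B \<subseteq> ((f ^^ n) ^^ m) ` B" for m A B
    by (rule horseshoe_free_no_horseshoe[OF f, of "n * m" A B])
      (use that n in \<open>simp_all add: funpow_mult\<close>)
  ultimately show ?thesis
    by (rule horseshoe_freeI[OF horseshoe_freeD(3)[OF f]])
qed

lemma reflect_funpow: "(reflect f ^^ n) t = - (f ^^ n) (- t)"
  by (induction n arbitrary: t) (simp_all add: reflect_def)

lemma horseshoe_free_reflect: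
  assumes f: "horseshoe_free f"
  shows "horseshoe_free (reflect f)"
proof -
  have "continuous_on UNIV (reflect f)"
    unfolding reflect_def
    by (intro continuous_intros continuous_on_compose2[OF horseshoe_freeD(1)[OF f]]) auto
  moreover have "range (reflect f) \<subseteq> uminus ` range f" unfolding reflect_def by auto
  then have "bounded (range (reflect f))"
    by (rule bounded_subset[rotated]) (simp add: bounded_uminus horseshoe_freeD(2)[OF f])
  moreover have False
    if "n \<ge> 1" "compact A" "compact B" "A \<noteq> {}" "A \<inter> B = {}"
      and c: "A \<union> B \<subseteq> (reflect f ^^ n) ` A" "A \<union> B \<subseteq> (reflect f ^^ n) ` B" for n A B
  proof -
    have im: "(reflect f ^^ n) ` S = uminus ` (f ^^ n) ` uminus ` S" for S
      unfolding image_image reflect_funpow ..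
    have m: "S \<subseteq> uminus ` T \<Longrightarrow> uminus ` S \<subseteq> T" for S T :: "real set" by auto
    have "uminus ` A \<union> uminus ` B \<subseteq> (f ^^ n) ` uminus ` A" "uminus ` A \<union> uminus ` B \<subseteq> (f ^^ n) ` uminus ` B"
      using c unfolding im image_Un[symmetric] by (auto dest: m)
    moreover have "uminus ` A \<inter> uminus ` B = {}" using that by auto
    moreover have "compact (uminus ` A)" "compact (uminus ` B)" "uminus ` A \<noteq> {}"
      using that by (auto intro: compact_negations)
    ultimately show False
      using horseshoe_free_no_horseshoe[OF f that(1), of "uminus ` A" "uminus ` B"] by simp
  qed
  ultimately show ?thesis by (rule horseshoe_freeI)
qed

section \<open>Orbit patterns that force a horseshoe\<close>

lemma connected_image_covers:
  fixes g :: "real \<Rightarrow> real"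
  assumes "continuous_on UNIV g" "connected S" "p \<in> S" "q \<in> S" "g p \<le> lo" "hi \<le> g q"
  shows "{lo..hi} \<subseteq> g ` S"
proof -
  have "connected (g ` S)"
    by (rule connected_continuous_image) (use assms continuous_on_subset in auto)
  then have "{g p..g q} \<subseteq> g ` S" by (rule connected_contains_Icc) (use assms in auto)
  then show ?thesis using assms by fastforce
qed

lemma fixpoint_between:
  fixes f :: "real \<Rightarrow> real"
  assumes "continuous_on UNIV f" "p \<in> {a..b}" "q \<in> {a..b}" "f p \<le> p" "q \<le> f q"
  shows "\<exists>t\<in>{a..b}. f t = t"
proof -
  have "{0..0} \<subseteq> (\<lambda>t. f t - t) ` {a..b}"
    by (rule connected_image_covers[of _ _ p q]) (use assms in \<open>auto intro!: continuous_intros\<close>)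
  then show ?thesis by force
qed

text \<open>Two compact sets meeting in a single point that is not fixed become disjoint after
  replacing each set by its points that stay in it for one step.\<close>

lemma no_touching_horseshoe:
  assumes f: "horseshoe_free f" and n: "n \<ge> 1" and A: "compact A" "A \<noteq> {}" and B: "compact B"
    and q: "A \<inter> B \<subseteq> {q}" "(f ^^ n) q \<noteq> q"
    and cov: "A \<union> B \<subseteq> (f ^^ n) ` A" "A \<union> B \<subseteq> (f ^^ n) ` B"
  shows False
proof -
  define g where "g = f ^^ n"
  have g: "continuous_on S g" for S unfolding g_def by (rule horseshoe_freeD(3)[OF f])
  define C where "C S = {t \<in> S. g t \<in> S}" for S
  have C_compact: "compact (C S)" if "compact S" for S
  proof -
    have "closed (S \<inter> g -` S)"
      using that by (intro continuous_closed_preimage g) (auto intro: compact_imp_closed)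
    then have "compact (S \<inter> (S \<inter> g -` S))" by (rule compact_Int_closed[OF that])
    moreover have "S \<inter> (S \<inter> g -` S) = C S" unfolding C_def by blast
    ultimately show ?thesis by simp
  qed
  have two: "(f ^^ (n * 2)) t = g (g t)" for t
    unfolding g_def mult_2_right by (simp add: funpow_add)
  have covC: "A \<union> B \<subseteq> (f ^^ (n * 2)) ` C S" if S: "A \<union> B \<subseteq> g ` S" "S \<subseteq> A \<union> B" for S
  proof
    fix y assume "y \<in> A \<union> B"
    then obtain s where s: "s \<in> S" "y = g s" using S by blast
    then obtain t where "t \<in> S" "s = g t" using S by blast
    then show "y \<in> (f ^^ (n * 2)) ` C S" unfolding C_def using s by (intro image_eqI[of _ _ t]) (auto simp: two)
  qed
  have "C A \<union> C B \<subseteq> (f ^^ (n * 2)) ` C A" "C A \<union> C B \<subseteq> (f ^^ (n * 2)) ` C B"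
    using covC[of A] covC[of B] cov unfolding g_def[symmetric] C_def by auto
  moreover have "C A \<inter> C B = {}" using q unfolding g_def[symmetric] C_def by blast
  moreover have "C A \<noteq> {}" using covC[of A] cov(1) A(2) unfolding g_def[symmetric] by auto
  moreover have "n * 2 \<ge> 1" using n by simp
  ultimately show False
    using horseshoe_free_no_horseshoe[OF f _ C_compact[OF A(1)] C_compact[OF B], of "n * 2"] by simp
qed

text \<open>Both \<open>{z..b}\<close> and \<open>{b..c}\<close> map over \<open>{z..c}\<close>.
  They meet only in \<open>b\<close>, which is not fixed because \<open>f b\<close> is at least
  \<open>c\<close>, so the touching version of the horseshoe argument applies.\<close>

lemma no_turbulence:
  assumes f: "horseshoe_free f" and "f z \<le> z" "z < b" "b < c" "c \<le> f b" "f c \<le> z"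
  shows False
proof (rule no_touching_horseshoe[OF f, of 1 "{z..b}" "{b..c}" b])
  have "{z..c} \<subseteq> f ` {z..b}" "{z..c} \<subseteq> f ` {b..c}"
    by (rule connected_image_covers[OF horseshoe_freeD(1)[OF f], of _ z b]; use assms in simp)
      (rule connected_image_covers[OF horseshoe_freeD(1)[OF f], of _ c b]; use assms in simp)
  then show "{z..b} \<union> {b..c} \<subseteq> (f ^^ 1) ` {z..b}" "{z..b} \<union> {b..c} \<subseteq> (f ^^ 1) ` {b..c}"
    using assms by (auto simp: ivl_disj_un_two_touch)
qed (use assms in auto)

text \<open>The orbit point \<open>c\<close> just before the first crossing of \<open>z\<close> lies
  above \<open>y\<close>, by \<open>up\<close>. The point just before the orbit first reaches height
  \<open>c\<close> lies between \<open>z\<close> and \<open>c\<close> and jumps to \<open>c\<close>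
  or higher. These two points and \<open>z\<close> form the configuration of
  \<open>no_turbulence\<close>.\<close>

lemma no_escape_across_fixpoint:
  assumes f: "horseshoe_free f" and z: "f z = z" "z < y" and k: "(f ^^ k) y \<le> z"
    and up: "\<And>i. z < (f ^^ i) y \<Longrightarrow> (f ^^ i) y \<le> y \<Longrightarrow> z < (f ^^ Suc i) y"
  shows False
proof -
  define i where "i = (LEAST i. (f ^^ i) y \<le> z)"
  have i: "(f ^^ i) y \<le> z" "\<And>j. j < i \<Longrightarrow> z < (f ^^ j) y"
    unfolding i_def using LeastI[of "\<lambda>i. (f ^^ i) y \<le> z", OF k] not_less_Least by (auto simp: not_le[symmetric])
  obtain i' where i': "i = Suc i'" using i z by (cases i) auto
  define c where "c = (f ^^ i') y"
  have c: "z < c" "f c \<le> z" using i i' unfolding c_def by auto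
  then have cy: "y < c" using up[of i'] c unfolding c_def by fastforce
  define m where "m = (LEAST m. c \<le> (f ^^ m) y)"
  have ci: "c \<le> (f ^^ i') y" unfolding c_def by simp
  have m: "c \<le> (f ^^ m) y" "m \<le> i'" "\<And>j. j < m \<Longrightarrow> (f ^^ j) y < c"
    unfolding m_def using LeastI[of "\<lambda>m. c \<le> (f ^^ m) y", OF ci] Least_le[of "\<lambda>m. c \<le> (f ^^ m) y", OF ci]
      not_less_Least by (auto simp: not_le[symmetric])
  obtain m' where m': "m = Suc m'" using m cy by (cases m) auto
  show False
  proof (rule no_turbulence[OF f, of z "(f ^^ m') y" c])
    show "z < (f ^^ m') y" using i(2)[of m'] m(2) m' i' by simp
  qed (use m m' c z in auto)
qed

text \<open>Let \<open>z\<close> be the largest fixed point between the falling point and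
  \<open>y\<close>. A point of \<open>{z<..y}\<close> that maps to \<open>z\<close> or below would
  force another fixed point between itself and \<open>y\<close>, which rises. So the orbit of
  \<open>y\<close> cannot get past \<open>z\<close> without contradicting
  \<open>no_escape_across_fixpoint\<close>.\<close>

lemma no_up_then_down:
  assumes f: "horseshoe_free f" and "y < f y" "(f ^^ k) y < y" "f ((f ^^ k) y) < (f ^^ k) y"
  shows False
proof -
  define d where "d = (f ^^ k) y"
  define F where "F = {d..y} \<inter> {t. f t = t}"
  have cont: "continuous_on UNIV f" by (rule horseshoe_freeD[OF f])
  have "closed {t. f t = t}" by (rule closed_Collect_eq) (use cont in \<open>auto intro: continuous_intros\<close>)
  then have F: "compact F" unfolding F_def by (intro compact_Int_closed) auto
  have "F \<noteq> {}"
    using fixpoint_between[OF cont, of d d y y] assms unfolding F_def d_def by auto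
  then obtain z where z: "z \<in> F" "\<And>t. t \<in> F \<Longrightarrow> t \<le> z"
    using compact_attains_sup[OF F] by blast
  have zy: "f z = z" "d \<le> z" "z < y" using z(1) assms unfolding F_def d_def by (auto simp: less_le)
  have up: "z < f t" if "z < t" "t \<le> y" for t
  proof (rule ccontr)
    assume "\<not> z < f t"
    then have "f t \<le> t" using that by simp
    then have "\<exists>s\<in>{t..y}. f s = s"
      by (rule fixpoint_between[OF cont, of t t y y, rotated 2]) (use that assms in auto)
    then obtain s where "s \<in> {t..y}" "f s = s" by blast
    then show False using z(2)[of s] zy that unfolding F_def by auto
  qed
  show False
    by (rule no_escape_across_fixpoint[OF f zy(1,3), of k]) (use up zy d_def in auto)
qed

lemma no_down_then_up:
  assumes f: "horseshoe_free f" and "f y < y" "y < (f ^^ k) y" "(f ^^ k) y < f ((f ^^ k) y)"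
  shows False
  by (rule no_up_then_down[OF horseshoe_free_reflect[OF f], of "- y" k])
    (use assms in \<open>auto simp: reflect_funpow, auto simp: reflect_def\<close>)

subsection \<open>Alternating orbits\<close>

lemma omega_limit_iff:
  "w \<in> omega_limit f x \<longleftrightarrow> (\<forall>e>0. \<forall>N. \<exists>n\<ge>N. \<bar>(f ^^ n) x - w\<bar> < e)"
  unfolding omega_limit_def closure_approachable dist_real_def INT_iff by blast

text \<open>A repetition confines the orbit to finitely many points; such a set is closed and would
  contain the limit set.\<close>

lemma infinite_omega_inj:
  assumes "infinite (omega_limit f x)"
  shows "inj (\<lambda>n. (f ^^ n) x)"
proof (rule ccontr)
  assume "\<not> ?thesis"
  then obtain m n where mn: "m < n" "(f ^^ m) x = (f ^^ n) x"
    unfolding inj_def by (metis linorder_neqE_nat)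
  let ?S = "(\<lambda>j. (f ^^ j) x) ` {..<n}"
  have "(f ^^ k) x \<in> ?S" for k
  proof (induction k)
    case 0
    then show ?case using mn by (auto intro!: image_eqI[of _ _ 0])
  next
    case (Suc k)
    then obtain j where j: "j < n" "(f ^^ k) x = (f ^^ j) x" by auto
    then have S: "(f ^^ Suc k) x = (f ^^ Suc j) x" by simp
    show ?case
    proof (cases "Suc j = n")
      case True
      then have "(f ^^ Suc k) x = (f ^^ m) x" using S mn by simp
      then show ?thesis using mn(1) by blast
    next
      case False
      then show ?thesis using S j(1) by (intro image_eqI[of _ _ "Suc j"]) auto
    qed
  qed
  then have "{(f ^^ k) x | k. k \<ge> 0} \<subseteq> ?S" by auto
  then have "closure {(f ^^ k) x | k. k \<ge> 0} \<subseteq> ?S"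
    by (rule closure_minimal) (simp add: finite_imp_closed)
  then have "omega_limit f x \<subseteq> ?S" unfolding omega_limit_def by blast
  then show False using assms finite_subset by blast
qed

lemma infinite_omega_not_convergent:
  assumes "infinite (omega_limit f x)"
  shows "\<not> (\<lambda>n. (f ^^ n) x) \<longlonglongrightarrow> l"
proof
  assume l: "(\<lambda>n. (f ^^ n) x) \<longlonglongrightarrow> l"
  have "w = l" if w: "w \<in> omega_limit f x" for w
  proof (rule ccontr)
    assume "w \<noteq> l"
    then have e: "\<bar>w - l\<bar> / 2 > 0" by simp
    then obtain N where N: "\<And>n. n \<ge> N \<Longrightarrow> \<bar>(f ^^ n) x - l\<bar> < \<bar>w - l\<bar> / 2"
      using LIMSEQ_D[OF l e] by auto
    obtain n where n: "n \<ge> N" "\<bar>(f ^^ n) x - w\<bar> < \<bar>w - l\<bar> / 2" using w e unfolding omega_limit_iff by blast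
    have "\<bar>(f ^^ n) x - w\<bar> + \<bar>(f ^^ n) x - l\<bar> < \<bar>w - l\<bar>"
      using add_strict_mono[OF n(2) N[OF n(1)]] by simp
    then show False by arith
  qed
  then have "omega_limit f x \<subseteq> {l}" by blast
  then show False using assms finite_subset by blast
qed

lemma bounded_orbit:
  fixes f :: "'a::metric_space \<Rightarrow> 'a"
  assumes "bounded (range f)"
  shows "bounded (range (\<lambda>n. (f ^^ n) x))"
proof -
  have "(f ^^ n) x \<in> insert x (range f)" for n by (cases n) auto
  then have "range (\<lambda>n. (f ^^ n) x) \<subseteq> insert x (range f)" by (rule image_subsetI)
  then show ?thesis by (rule bounded_subset[rotated]) (simp add: assms)
qed

lemma infinite_omega_not_eventually_monotone:
  fixes f :: "real \<Rightarrow> real"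
  assumes b: "bounded (range f)" and inf: "infinite (omega_limit f x)"
  shows "\<exists>n\<ge>N. (f ^^ Suc n) x < (f ^^ n) x" "\<exists>n\<ge>N. (f ^^ n) x < (f ^^ Suc n) x"
proof -
  let ?X = "\<lambda>n. (f ^^ (n + N)) x"
  have bX: "Bseq ?X" using bounded_orbit[OF b, of x]
    unfolding Bseq_eq_bounded by (rule bounded_subset) auto
  have "\<not> monoseq ?X"
    using Bseq_monoseq_convergent[OF bX] LIMSEQ_offset[of "\<lambda>n. (f ^^ n) x" N]
      infinite_omega_not_convergent[OF inf] unfolding convergent_def by blast
  then have 1: "\<exists>n. ?X (Suc n) < ?X n" and 2: "\<exists>n. ?X n < ?X (Suc n)"
    unfolding monoseq_Suc by (auto simp: not_le)
  from 1 show "\<exists>n\<ge>N. (f ^^ Suc n) x < (f ^^ n) x" by (metis add_Suc le_add2)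
  from 2 show "\<exists>n\<ge>N. (f ^^ n) x < (f ^^ Suc n) x" by (metis add_Suc le_add2)
qed

text \<open>Each orbit point moves towards the side of \<open>z\<close>, possibly beyond it. This is
  weaker than alternation: the orbit may still stay on one side for several steps.\<close>

definition centered :: "(real \<Rightarrow> real) \<Rightarrow> real \<Rightarrow> real \<Rightarrow> bool" where
  "centered f x z \<longleftrightarrow> f z = z \<and> (\<forall>n. (f ^^ n) x < z \<and> (f ^^ n) x < (f ^^ Suc n) x \<or>
      z < (f ^^ n) x \<and> (f ^^ Suc n) x < (f ^^ n) x)"

lemma centered_shift: "centered f x z \<Longrightarrow> centered f ((f ^^ m) x) z"
proof -
  have "(f ^^ n) ((f ^^ m) x) = (f ^^ (n + m)) x" for n by (simp add: funpow_add)
  then show "centered f x z \<Longrightarrow> centered f ((f ^^ m) x) z"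
    unfolding centered_def by (metis add_Suc)
qed

text \<open>Rising orbit points all lie below falling ones, since the other order is one of the two
  forbidden patterns. By continuity \<open>f t - t\<close> is nonnegative at \<open>Sup U\<close>
  and nonpositive at \<open>Inf D\<close>, so a fixed point lies between the two sets.\<close>

lemma infinite_omega_centered:
  assumes f: "horseshoe_free f" and inf: "infinite (omega_limit f x)"
  shows "\<exists>z. centered f x z"
proof -
  define X where "X n = (f ^^ n) x" for n
  have cont: "continuous_on UNIV f" and b: "bounded (range f)" using horseshoe_freeD[OF f] by auto
  have XS: "f (X n) = X (Suc n)" for n unfolding X_def by simp
  have Xadd: "(f ^^ k) (X n) = X (n + k)" for k n unfolding X_def by (simp add: funpow_add add.commute)
  have ne: "X (Suc n) \<noteq> X n" for n
    using infinite_omega_inj[OF inf] unfolding X_def inj_def by (metis n_not_Suc_n)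
  define U where "U = {X n | n. X n < X (Suc n)}"
  define D where "D = {X n | n. X (Suc n) < X n}"
  have U: "U \<noteq> {}" and D: "D \<noteq> {}"
    using infinite_omega_not_eventually_monotone[OF b inf, of 0] unfolding U_def D_def X_def by auto
  have UD: "u < d" if ud: "u \<in> U" "d \<in> D" for u d
  proof -
    obtain m n where m: "u = X m" "X m < X (Suc m)" and n: "d = X n" "X (Suc n) < X n"
      using ud unfolding U_def D_def by blast
    show ?thesis
    proof (rule ccontr)
      assume "\<not> u < d"
      then have du: "X n < X m" using m n by (cases "X n = X m") (auto, metis XS less_asym)
      show False
      proof (cases "m \<le> n")
        case True
        then show False using no_up_then_down[OF f, of "X m" "n - m"] m n du by (simp add: XS Xadd)
      next
        case False
        then show False using no_down_then_up[OF f, of "X n" "m - n"] m n du by (simp add: XS Xadd)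
      qed
    qed
  qed
  have bU: "bdd_above U" and bD: "bdd_below D" using UD U D by (meson bdd_aboveI bdd_belowI ex_in_conv less_imp_le)+
  have SI: "Sup U \<le> Inf D" using UD U D by (meson cInf_greatest cSup_least less_imp_le)
  have "closed {t. t \<le> f t}" "closed {t. f t \<le> t}"
    by (auto intro!: closed_Collect_le cont continuous_intros)
  moreover have "U \<subseteq> {t. t \<le> f t}" "D \<subseteq> {t. f t \<le> t}" unfolding U_def D_def by (auto simp: XS)
  ultimately have "Sup U \<le> f (Sup U)" "f (Inf D) \<le> Inf D"
    using closure_contains_Sup[OF U bU] closure_contains_Inf[OF D bD] closure_minimal by blast+
  then obtain z where z: "z \<in> {Sup U..Inf D}" "f z = z"
    using fixpoint_between[OF cont, of "Inf D" "Sup U" "Inf D" "Sup U"] SI by auto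
  have "X n \<noteq> z" for n using ne[of n] z XS by metis
  moreover have "X n < X (Suc n) \<Longrightarrow> X n \<le> z" for n
    using cSup_upper[OF _ bU, of "X n"] z(1) unfolding U_def by fastforce
  moreover have "X (Suc n) < X n \<Longrightarrow> z \<le> X n" for n
    using cInf_lower[OF _ bD, of "X n"] z(1) unfolding D_def by fastforce
  ultimately have "X n < z \<and> X n < X (Suc n) \<or> z < X n \<and> X (Suc n) < X n" for n
    using ne[of n] by (metis less_le linorder_neqE_linordered_idom)
  then show ?thesis using z(2) unfolding centered_def X_def by blast
qed

lemma image_funpow_increasing:
  assumes "K \<subseteq> f ` K" "i \<le> j"
  shows "(f ^^ i) ` K \<subseteq> (f ^^ j) ` K"
  using assms(2)
proof (induction rule: dec_induct)
  case (step n)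
  have "(f ^^ Suc n) ` K = (f ^^ n) ` (f ` K)" unfolding funpow_Suc_right by (simp add: image_comp)
  then show ?case using step.IH assms(1) by (metis image_mono order_trans)
qed simp

text \<open>With \<open>a\<close> and \<open>b\<close> the orbit points nearest to \<open>z\<close> on both sides, \<open>{a..b}\<close> covers itself and
  eventually the whole orbit segment; an odd return forces two consecutive points on the same
  side, and the interval from such a point to \<open>a\<close> (or \<open>b\<close>) is the second half of a horseshoe.\<close>

lemma no_odd_return_initial:
  assumes f: "horseshoe_free f" and inj: "inj (\<lambda>n. (f ^^ n) x)" and z: "centered f x z"
    and x: "x < z" and n: "odd n" "(f ^^ n) x \<le> x"
  shows False
proof -
  define X where "X n = (f ^^ n) x" for n
  have X0: "X 0 = x" and XS: "f (X i) = X (Suc i)" for i unfolding X_def by simp_all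
  have cont: "continuous_on UNIV f" by (rule horseshoe_freeD[OF f])
  have Xadd: "(f ^^ k) (X i) = X (k + i)" for k i unfolding X_def by (simp add: funpow_add)
  have fz: "f z = z" and c: "\<And>i. X i < z \<and> X i < X (Suc i) \<or> z < X i \<and> X (Suc i) < X i"
    using z unfolding centered_def X_def by blast+
  have n0: "n > 0" using n(1) by (cases n) auto
  have Xn: "X n \<le> X 0" "X n < z" using n x unfolding X_def by auto
  define L where "L = X ` {i. i < n \<and> X i < z}"
  define R where "R = X ` {i. i < n \<and> z < X i}"
  have fin: "finite L" "finite R" unfolding L_def R_def by auto
  have x0L: "X 0 \<in> L" unfolding L_def using n0 x X0 by auto
  have "R \<noteq> {}"
  proof
    assume "R = {}"
    then have lt: "X i < X (Suc i)" if "i < n" for i using c[of i] that unfolding R_def by auto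
    have gt: "X 0 < X i" if "0 < i" "i \<le> n" for i
      using that
    proof (induction i)
      case (Suc i)
      then show ?case using lt[of i] by (cases "i = 0") auto
    qed simp
    show False using gt[OF n0 order_refl] Xn(1) by simp
  qed
  define a where "a = Max L"
  define b where "b = Min R"
  have a: "a \<in> L" "\<And>t. t \<in> L \<Longrightarrow> t \<le> a" unfolding a_def using fin x0L by (auto intro: Max_in)
  have b: "b \<in> R" "\<And>t. t \<in> R \<Longrightarrow> b \<le> t" unfolding b_def using fin \<open>R \<noteq> {}\<close> by (auto intro: Min_in)
  obtain ia where ia: "a = X ia" "ia < n" "X ia < z" using a(1) unfolding L_def by blast
  obtain ib where ib: "b = X ib" "ib < n" "z < X ib" using b(1) unfolding R_def by blast
  have ab: "a < z" "z < b" using ia ib by auto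
  \<comment> \<open>The index \<open>n\<close> is included although \<open>L\<close> stops before
    it: \<open>X n\<close> is at most \<open>X 0\<close>, which belongs to \<open>L\<close>.\<close>
  have le_a: "X i \<le> a" if "i \<le> n" "X i < z" for i
  proof (cases "i = n")
    case True
    then show ?thesis using Xn(1) a(2)[OF x0L] by simp
  next
    case False
    then show ?thesis using that a(2) unfolding L_def by auto
  qed
  have ge_b: "b \<le> X i" if "i \<le> n" "z < X i" for i
  proof -
    have "i \<noteq> n" using that Xn by auto
    then show ?thesis using that b(2) unfolding R_def by auto
  qed
  have fa: "b \<le> f a"
  proof -
    have "a < X (Suc ia)" using c[of ia] ia by auto
    then have "\<not> X (Suc ia) < z" using le_a[of "Suc ia"] ia(2) by auto
    then show ?thesis using ge_b[of "Suc ia"] c[of "Suc ia"] ia(1,2) XS[of ia] by auto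
  qed
  have fb: "f b \<le> a"
  proof -
    have "X (Suc ib) < b" using c[of ib] ib by auto
    then have "\<not> z < X (Suc ib)" using ge_b[of "Suc ib"] ib(2) by auto
    then show ?thesis using le_a[of "Suc ib"] c[of "Suc ib"] ib(1,2) XS[of ib] by auto
  qed
  define K where "K = {a..b}"
  have K: "K \<subseteq> f ` K" unfolding K_def
    by (rule connected_image_covers[OF cont, of _ b a]) (use fa fb ab in auto)
  note inc = image_funpow_increasing[OF K]
  have fzj: "(f ^^ j) z = z" for j using fz by (induction j) auto
  have zK: "z \<in> (f ^^ j) ` K" for j
    by (rule image_eqI[of _ _ z]) (use fzj ab K_def in auto)
  have conn: "connected ((f ^^ j) ` K)" for j
    unfolding K_def by (intro connected_continuous_image horseshoe_freeD(3)[OF f]) simp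
  \<comment> \<open>Here the return enters: an image of \<open>K\<close> contains \<open>X n\<close>
    and \<open>z\<close>, hence \<open>X 0\<close> between them, and from \<open>X 0\<close> the
    entire orbit segment is reached.\<close>
  have "X n \<in> (f ^^ (n - ia)) ` K"
    using ia ab Xadd[of "n - ia" ia] by (intro image_eqI[of _ _ a]) (auto simp: K_def)
  then have "{X n..z} \<subseteq> (f ^^ (n - ia)) ` K" using zK conn by (intro connected_contains_Icc) auto
  then have X0K: "X 0 \<in> (f ^^ (n - ia)) ` K" using Xn x X0 by auto
  have XK: "X i \<in> (f ^^ (2 * n)) ` K" if "i \<le> n" for i
  proof -
    have "X i \<in> (f ^^ i) ` ((f ^^ (n - ia)) ` K)"
      using imageI[OF X0K, of "f ^^ i"] Xadd[of i 0] by simp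
    then have "X i \<in> (f ^^ (i + (n - ia))) ` K" by (simp add: image_comp funpow_add)
    moreover have "i + (n - ia) \<le> 2 * n" using that by simp
    ultimately show ?thesis using inc by blast
  qed
  \<comment> \<open>In \<open>2 * n\<close> steps \<open>K\<close> covers the hull of the segment;
    the additional step is the one in which \<open>{c..a}\<close> or \<open>{b..c}\<close> covers
    \<open>K\<close>.\<close>
  define N where "N = Suc (2 * n)"
  have hull: "{min c a..max c b} \<subseteq> (f ^^ (2 * n)) ` K" if c: "c = X i" "i \<le> n" for c i
  proof (rule connected_contains_Icc[OF conn])
    have "a \<in> (f ^^ (2 * n)) ` K" "b \<in> (f ^^ (2 * n)) ` K"
      using XK ia ib by auto
    then show "min c a \<in> (f ^^ (2 * n)) ` K" "max c b \<in> (f ^^ (2 * n)) ` K"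
      using XK[OF c(2)] c(1) unfolding min_def max_def by auto
  qed
  have NK: "(f ^^ (2 * n)) ` K \<subseteq> (f ^^ N) ` K" unfolding N_def by (rule inc) simp
  have NA: "(f ^^ (2 * n)) ` K \<subseteq> (f ^^ N) ` A" if "K \<subseteq> f ` A" for A
  proof -
    have "(f ^^ N) ` A = (f ^^ (2 * n)) ` (f ` A)" unfolding N_def funpow_Suc_right by (simp add: image_comp)
    then show ?thesis using that by (metis image_mono)
  qed
  have not_per: "(f ^^ N) (X i) \<noteq> X i" for i
    using inj Xadd[of N i] unfolding inj_def X_def N_def by (metis add_Suc less_add_Suc2 less_irrefl)
  \<comment> \<open>Strict alternation up to the odd time \<open>n\<close> would put
    \<open>X n\<close> on the right of \<open>z\<close>.\<close>
  have "\<exists>i<n. (X i < z \<and> X (Suc i) < z) \<or> (z < X i \<and> z < X (Suc i))"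
  proof (rule ccontr)
    assume no: "\<not> ?thesis"
    have "i \<le> n \<Longrightarrow> (if even i then X i < z else z < X i)" for i
    proof (induction i)
      case 0
      then show ?case using x X0 by simp
    next
      case (Suc i)
      then have "i < n" by simp
      then show ?case using Suc no c[of i] c[of "Suc i"] by (auto split: if_splits)
    qed
    from this[of n] show False using n(1) Xn(2) by auto
  qed
  then obtain i where i: "i < n" and "(X i < z \<and> X (Suc i) < z) \<or> (z < X i \<and> z < X (Suc i))" by blast
  then consider "X i < z" "X (Suc i) < z" | "z < X i" "z < X (Suc i)" by blast
  then show False
  proof cases
    case 1
    define c where "c = X i"
    have fc: "f c \<le> a" using le_a[of "Suc i"] 1 i unfolding c_def XS by auto
    have ca: "c < a"
    proof -
      have "c \<noteq> a" using fc fa ab by auto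
      then show ?thesis using le_a[of i] 1 i unfolding c_def by auto
    qed
    have Kc: "K \<subseteq> f ` {c..a}" unfolding K_def
      by (rule connected_image_covers[OF cont, of _ c a]) (use fc fa ca in auto)
    have sub: "{c..a} \<union> K \<subseteq> (f ^^ (2 * n)) ` K"
      using hull[OF c_def] i ca ab unfolding K_def by (auto simp: min_def max_def)
    show False
    proof (rule no_touching_horseshoe[OF f, of N "{c..a}" K a])
      show "{c..a} \<union> K \<subseteq> (f ^^ N) ` {c..a}" "{c..a} \<union> K \<subseteq> (f ^^ N) ` K"
        using sub NA[OF Kc] NK by (meson order_trans)+
    qed (use ca not_per[of ia] ia(1) in \<open>auto simp: K_def N_def simp del: funpow.simps\<close>)
  next
    case 2
    define c where "c = X i"
    have fc: "b \<le> f c" using ge_b[of "Suc i"] 2 i unfolding c_def XS by auto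
    have bc: "b < c"
    proof -
      have "c \<noteq> b" using fc fb ab by auto
      then show ?thesis using ge_b[of i] 2 i unfolding c_def by auto
    qed
    have Kc: "K \<subseteq> f ` {b..c}" unfolding K_def
      by (rule connected_image_covers[OF cont, of _ b c]) (use fc fb bc in auto)
    have sub: "{b..c} \<union> K \<subseteq> (f ^^ (2 * n)) ` K"
      using hull[OF c_def] i bc ab unfolding K_def by (auto simp: min_def max_def)
    show False
    proof (rule no_touching_horseshoe[OF f, of N "{b..c}" K b])
      show "{b..c} \<union> K \<subseteq> (f ^^ N) ` {b..c}" "{b..c} \<union> K \<subseteq> (f ^^ N) ` K"
        using sub NA[OF Kc] NK by (meson order_trans)+
    qed (use bc not_per[of ib] ib(1) in \<open>auto simp: K_def N_def simp del: funpow.simps\<close>)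
  qed
qed

lemma no_odd_return:
  assumes f: "horseshoe_free f" and inj: "inj (\<lambda>n. (f ^^ n) x)" and z: "centered f x z"
    and x: "(f ^^ m) x < z" and n: "m \<le> n" "odd (n - m)" "(f ^^ n) x \<le> (f ^^ m) x"
  shows False
proof (rule no_odd_return_initial[OF f _ centered_shift[OF z] x n(2)])
  have e: "(f ^^ k) ((f ^^ m) x) = (f ^^ (k + m)) x" for k by (simp add: funpow_add)
  show "inj (\<lambda>n. (f ^^ n) ((f ^^ m) x))"
    unfolding e using inj unfolding inj_def by (metis add_right_imp_eq)
  show "(f ^^ (n - m)) ((f ^^ m) x) \<le> (f ^^ m) x" unfolding e using n by simp
qed

text \<open>After a time \<open>n\<close> in \<open>T\<close> every later point lies above
  \<open>X n\<close>: apply \<open>no_odd_return\<close> at \<open>n\<close> or at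
  \<open>Suc n\<close>, according to parity. So along \<open>T\<close> the orbit approaches
  \<open>p\<close> strictly from below, and the whole orbit eventually exceeds each number below
  \<open>p\<close>. Every position of \<open>p\<close> relative to \<open>z\<close> and
  \<open>f p\<close> is contradictory.\<close>

lemma finite_left_left:
  assumes f: "horseshoe_free f" and inf: "infinite (omega_limit f x)" and z: "centered f x z"
  shows "finite {n. (f ^^ n) x < z \<and> (f ^^ Suc n) x < z}"
proof (rule ccontr)
  define X where "X n = (f ^^ n) x" for n
  define T where "T = {n. X n < z \<and> X (Suc n) < z}"
  assume "\<not> ?thesis"
  then have T: "infinite T" unfolding T_def X_def .
  have XS: "f (X i) = X (Suc i)" for i unfolding X_def by simp
  have Xadd: "(f ^^ k) (X i) = X (k + i)" for k i unfolding X_def by (simp add: funpow_add)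
  have cont: "continuous_on UNIV f" by (rule horseshoe_freeD[OF f])
  have fz: "f z = z" and c: "\<And>i. X i < z \<and> X i < X (Suc i) \<or> z < X i \<and> X (Suc i) < X i"
    using z unfolding centered_def X_def by blast+
  have odd: "\<not> X n \<le> X m" if "X m < z" "m \<le> n" "odd (n - m)" for m n
    using no_odd_return[OF f infinite_omega_inj[OF inf] z, of m n] that unfolding X_def by blast
  have later: "X n < X m" if n: "n \<in> T" "n < m" for m n
  proof (cases "odd (m - n)")
    case True
    then show ?thesis using odd[of n m] n unfolding T_def by auto
  next
    case False
    then have "odd (m - Suc n)" using n by auto
    then have "X (Suc n) < X m" using odd[of "Suc n" m] n unfolding T_def by auto
    then show ?thesis using c[of n] n unfolding T_def by auto
  qed
  have Tex: "\<exists>n\<in>T. n \<ge> N" for N using T by (meson infinite_nat_iff_unbounded_le)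
  define p where "p = Sup (X ` T)"
  have bT: "bdd_above (X ` T)" unfolding T_def by (auto intro!: bdd_aboveI[of _ z])
  have neT: "T \<noteq> {}" using T by auto
  have Tp: "X n < p" if n: "n \<in> T" for n
  proof -
    obtain m where m: "m \<in> T" "m \<ge> Suc n" using Tex by blast
    then have "X m \<le> p" unfolding p_def using bT by (intro cSup_upper) auto
    then show ?thesis using later[OF n, of m] m by simp
  qed
  have pz: "p \<le> z" unfolding p_def using neT by (intro cSup_least) (auto simp: T_def)
  have ev: "\<exists>N. \<forall>m\<ge>N. p - e < X m" if e: "e > 0" for e
  proof -
    have "\<exists>y\<in>X ` T. p - e < y"
      using less_cSup_iff[of "X ` T" "p - e"] neT bT e unfolding p_def by auto
    then obtain n where n: "n \<in> T" "p - e < X n" by blast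
    have "p - e < X m" if "m \<ge> Suc n" for m using later[OF n(1), of m] n(2) that by simp
    then show ?thesis by blast
  qed
  have fcont: "\<exists>d>0. \<forall>y. \<bar>y - t\<bar> < d \<longrightarrow> \<bar>f y - f t\<bar> < e" if "e > 0" for t e
  proof -
    have "isCont f t" using cont by (simp add: continuous_on_eq_continuous_at)
    then show ?thesis using that unfolding continuous_at_eps_delta dist_real_def by blast
  qed
  consider "p = z" | "p < z" "f p < p" | "p < z" "p < f p" | "p < z" "f p = p" using pz by linarith
  then show False
  proof cases
    \<comment> \<open>Points just left of \<open>z\<close> map close to \<open>z\<close>, and points
      right of \<open>z\<close> move down. With the lower bound \<open>ev\<close> the orbit would
      converge.\<close>
    case 1
    have "X \<longlonglongrightarrow> z"
    proof (rule LIMSEQ_I)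
      fix e :: real assume e: "e > 0"
      obtain d where d: "d > 0" "\<forall>y. \<bar>y - z\<bar> < d \<longrightarrow> \<bar>f y - f z\<bar> < e" using fcont[OF e] by blast
      obtain N where N: "\<forall>m\<ge>N. z - min d e < X m" using ev[of "min d e"] d(1) e 1 by auto
      obtain N' where N': "N' \<in> T" "N' \<ge> N" using Tex by blast
      have up: "X m < z + e" if "m \<ge> N'" for m
        using that
      proof (induction rule: dec_induct)
        case base
        then show ?case using N'(1) e unfolding T_def by auto
      next
        case (step m)
        show ?case
        proof (cases "X m < z")
          case True
          then have "\<bar>X m - z\<bar> < d" using N[rule_format, of m] step N' by auto
          then have "\<bar>f (X m) - f z\<bar> < e" using d(2) by blast
          then show ?thesis using fz by (simp add: XS abs_less_iff)
        next
          case False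
          then show ?thesis using c[of m] step.IH by auto
        qed
      qed
      show "\<exists>no. \<forall>n\<ge>no. norm (X n - z) < e"
      proof (intro exI[of _ N'] allI impI)
        fix m assume m: "m \<ge> N'"
        then have "z - min d e < X m" using N N' by simp
        then show "norm (X m - z) < e" using up[OF m] by auto
      qed
    qed
    then show False using infinite_omega_not_convergent[OF inf] unfolding X_def by blast
  next
    \<comment> \<open>Points of \<open>T\<close> close to \<open>p\<close> would move down, although
      they lie left of \<open>z\<close> and must move up.\<close>
    case 2
    then obtain d where d: "d > 0" "\<forall>y. \<bar>y - p\<bar> < d \<longrightarrow> \<bar>f y - f p\<bar> < (p - f p) / 2"
      using fcont[of "(p - f p) / 2" p] by auto
    obtain N where N: "\<forall>m\<ge>N. p - min d ((p - f p) / 2) < X m" using ev[of "min d ((p - f p) / 2)"] d(1) 2 by auto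
    obtain n where n: "n \<in> T" "n \<ge> N" using Tex by blast
    have 1: "p - d < X n" "p - (p - f p) / 2 < X n" using N n by auto
    then have "\<bar>X n - p\<bar> < d" using Tp[OF n(1)] by auto
    then have "\<bar>f (X n) - f p\<bar> < (p - f p) / 2" using d(2) by blast
    then have "X (Suc n) < f p + (p - f p) / 2" unfolding XS abs_less_iff by linarith
    also have "\<dots> = p - (p - f p) / 2" by (simp add: field_simps)
    finally have "X (Suc n) < X n" using 1 by simp
    then show False using c[of n] n(1) unfolding T_def by auto
  next
    \<comment> \<open>Points of \<open>T\<close> close to \<open>p\<close> jump above
      \<open>p\<close>. An even distance between two such times would be an odd return from the
      point after the jump, so all distances are odd, which is impossible for three times.\<close>
    case 3
    then obtain d where d: "d > 0" "\<forall>y. \<bar>y - p\<bar> < d \<longrightarrow> \<bar>f y - f p\<bar> < f p - p"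
      using fcont[of "f p - p" p] by auto
    obtain N where N: "\<forall>m\<ge>N. p - d < X m" using ev[OF d(1)] by auto
    have jump: "p < X (Suc n)" if n: "n \<in> T" "n \<ge> N" for n
    proof -
      have "\<bar>X n - p\<bar> < d" using N n Tp[OF n(1)] by auto
      then have "\<bar>f (X n) - f p\<bar> < f p - p" using d(2) by blast
      then show ?thesis by (simp add: XS abs_less_iff)
    qed
    have par: "odd (m - n)" if "n \<in> T" "n \<ge> N" "m \<in> T" "n < m" for m n
    proof (rule ccontr)
      assume "\<not> odd (m - n)"
      then have "odd (m - Suc n)" using that by auto
      moreover have "X m \<le> X (Suc n)" using jump[of n] that Tp[of m] by auto
      ultimately show False using odd[of "Suc n" m] that unfolding T_def by auto
    qed
    obtain n1 where n1: "n1 \<in> T" "n1 \<ge> N" using Tex by blast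
    obtain n2 where n2: "n2 \<in> T" "n2 \<ge> Suc n1" using Tex by blast
    obtain n3 where n3: "n3 \<in> T" "n3 \<ge> Suc n2" using Tex by blast
    have "n3 - n1 = (n3 - n2) + (n2 - n1)" using n1 n2 n3 by simp
    then show False using par[of n1 n2] par[of n2 n3] par[of n1 n3] n1 n2 n3 by auto
  next
    \<comment> \<open>When the orbit first climbs above the fixed point \<open>p\<close>, it does so
      from close to \<open>p\<close>, hence lands at some \<open>y\<close> below \<open>z\<close>.
      Points between \<open>p\<close> and \<open>y\<close> keep rising, yet \<open>T\<close> brings
      the orbit below \<open>p\<close> again: an escape across \<open>p\<close>.\<close>
    case 4
    then obtain d where d: "d > 0" "\<forall>y. \<bar>y - p\<bar> < d \<longrightarrow> \<bar>f y - f p\<bar> < z - p"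
      using fcont[of "z - p" p] by auto
    obtain N where N: "\<forall>m\<ge>N. p - d < X m" using ev[OF d(1)] by auto
    obtain n where n: "n \<in> T" "n \<ge> N" using Tex by blast
    obtain m0 where m0: "m0 \<ge> n" "X (Suc m0) < X m0"
      using infinite_omega_not_eventually_monotone(1)[OF horseshoe_freeD(2)[OF f] inf, of n] unfolding X_def by blast
    have P: "p < X (n + (m0 - n))" using m0 c[of m0] 4 by auto
    define j where "j = (LEAST j. p < X (n + j))"
    have j: "p < X (n + j)" "\<And>i. i < j \<Longrightarrow> X (n + i) \<le> p"
      unfolding j_def using LeastI[of "\<lambda>j. p < X (n + j)", OF P] not_less_Least[of _ "\<lambda>j. p < X (n + j)"]
      by (auto simp: not_less)
    obtain j' where j': "j = Suc j'" using j Tp[OF n(1)] by (cases j) auto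
    define y where "y = X (n + j)"
    have "X (n + j') \<le> p" "p - d < X (n + j')" using j(2)[of j'] j' N n by auto
    then have "\<bar>X (n + j') - p\<bar> < d" using d(1) by auto
    then have "\<bar>f (X (n + j')) - f p\<bar> < z - p" using d(2) by blast
    then have yz: "y < z" using 4 j' unfolding y_def by (simp add: XS abs_less_iff)
    obtain m where m: "m \<in> T" "m \<ge> n + j" using Tex by blast
    have yk: "(f ^^ k) y = X (n + j + k)" for k unfolding y_def Xadd by (simp add: add.commute)
    show False
    proof (rule no_escape_across_fixpoint[OF f 4(2), of y "m - (n + j)"])
      show "p < y" using j(1) unfolding y_def .
      show "(f ^^ (m - (n + j))) y \<le> p" unfolding yk using m Tp[of m] by simp
      fix i assume i: "p < (f ^^ i) y" "(f ^^ i) y \<le> y"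
      then show "p < (f ^^ Suc i) y" using c[of "n + j + i"] yz unfolding yk by auto
    qed
  qed
qed

lemma omega_limit_reflect: "omega_limit (reflect f) (- x) = uminus ` omega_limit f x"
proof -
  have "w \<in> omega_limit (reflect f) (- x) \<longleftrightarrow> - w \<in> omega_limit f x" for w
  proof -
    have "\<bar>- (f ^^ n) x - w\<bar> = \<bar>(f ^^ n) x - (- w)\<bar>" for n by arith
    then show ?thesis unfolding omega_limit_iff reflect_funpow by simp
  qed
  moreover have "w \<in> uminus ` S \<longleftrightarrow> - w \<in> S" for w and S :: "real set" by force
  ultimately show ?thesis by (intro set_eqI) simp
qed

lemma centered_reflect: "centered f x z \<Longrightarrow> centered (reflect f) (- x) (- z)"
  unfolding centered_def reflect_funpow by (auto simp: reflect_def)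

theorem infinite_omega_alternating:
  assumes f: "horseshoe_free f" and inf: "infinite (omega_limit f x)"
  shows "\<exists>z N. f z = z \<and> (\<forall>n\<ge>N. (f ^^ n) x < z \<and> z < (f ^^ Suc n) x \<or> z < (f ^^ n) x \<and> (f ^^ Suc n) x < z)"
proof -
  obtain z where z: "centered f x z" using infinite_omega_centered[OF f inf] by blast
  have "finite {n. (f ^^ n) x < z \<and> (f ^^ Suc n) x < z}" by (rule finite_left_left[OF f inf z])
  moreover have "finite {n. z < (f ^^ n) x \<and> z < (f ^^ Suc n) x}"
  proof -
    have "infinite (omega_limit (reflect f) (- x))"
      unfolding omega_limit_reflect using inf by (simp add: finite_image_iff inj_on_def)
    from finite_left_left[OF horseshoe_free_reflect[OF f] this centered_reflect[OF z]]
    show ?thesis unfolding reflect_funpow by simp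
  qed
  ultimately have "finite ({n. (f ^^ n) x < z \<and> (f ^^ Suc n) x < z} \<union> {n. z < (f ^^ n) x \<and> z < (f ^^ Suc n) x})"
    by simp
  then obtain N where N: "\<forall>n\<in>{n. (f ^^ n) x < z \<and> (f ^^ Suc n) x < z} \<union> {n. z < (f ^^ n) x \<and> z < (f ^^ Suc n) x}. n < N"
    using finite_nat_set_iff_bounded by blast
  have "(f ^^ n) x < z \<and> z < (f ^^ Suc n) x \<or> z < (f ^^ n) x \<and> (f ^^ Suc n) x < z" if "n \<ge> N" for n
  proof -
    have "(f ^^ n) x < z \<or> z < (f ^^ n) x" "(f ^^ Suc n) x < z \<or> z < (f ^^ Suc n) x"
      using z unfolding centered_def by blast+
    moreover have "n \<notin> {n. (f ^^ n) x < z \<and> (f ^^ Suc n) x < z} \<union> {n. z < (f ^^ n) x \<and> z < (f ^^ Suc n) x}"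
      using bspec[OF N, of n] that by linarith
    ultimately show ?thesis by blast
  qed
  then show ?thesis using z unfolding centered_def by blast
qed

subsection \<open>Limit sets along residue classes\<close>

text \<open>The congruence is taken in the integers, so that no subtraction is truncated and
  \<open>i\<close> need not be reduced modulo \<open>m\<close>; indices such as \<open>i + t\<close>
  can be used directly.\<close>

definition residue_limit :: "(nat \<Rightarrow> real) \<Rightarrow> nat \<Rightarrow> nat \<Rightarrow> real set" where
  "residue_limit X m i =
     {w. \<forall>e>0. \<forall>N. \<exists>n\<ge>N. int m dvd int n - int i \<and> \<bar>X n - w\<bar> < e}"

lemma omega_limit_funpow_eq:
  assumes m: "m \<ge> 1"
  shows "omega_limit (f ^^ m) ((f ^^ i) x) = residue_limit (\<lambda>n. (f ^^ n) x) m i"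
proof -
  have e: "((f ^^ m) ^^ n) ((f ^^ i) x) = (f ^^ (m * n + i)) x" for n
    by (simp add: funpow_mult funpow_add)
  have "\<exists>n\<ge>N. \<bar>(f ^^ (m * n + i)) x - w\<bar> < \<epsilon>"
    if ex: "\<exists>n\<ge>m * N + i. int m dvd int n - int i \<and> \<bar>(f ^^ n) x - w\<bar> < \<epsilon>" for N w \<epsilon>
  proof -
    obtain n where n: "n \<ge> m * N + i" "int m dvd int n - int i" "\<bar>(f ^^ n) x - w\<bar> < \<epsilon>"
      using ex by blast
    then have "m dvd n - i" by (simp add: of_nat_diff[symmetric] del: of_nat_diff)
    then obtain k where k: "n - i = m * k" by (elim dvdE)
    then have nk: "n = m * k + i" using n(1) by simp
    then have "m * N \<le> m * k" using n(1) by simp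
    then have "N \<le> k" using m by simp
    then show "\<exists>n\<ge>N. \<bar>(f ^^ (m * n + i)) x - w\<bar> < \<epsilon>" using n(3) nk by blast
  qed
  moreover have "(\<exists>n\<ge>N. int m dvd int n - int i \<and> \<bar>(f ^^ n) x - w\<bar> < \<epsilon>)"
    if ex: "\<exists>n\<ge>N. \<bar>(f ^^ (m * n + i)) x - w\<bar> < \<epsilon>" for N w \<epsilon>
  proof -
    obtain n where n: "n \<ge> N" "\<bar>(f ^^ (m * n + i)) x - w\<bar> < \<epsilon>" using ex by blast
    have "n \<le> m * n" using m by (cases m) auto
    then have "N \<le> m * n + i" using n(1) by linarith
    then show ?thesis using n(2) by (intro exI[of _ "m * n + i"]) simp
  qed
  ultimately show ?thesis
    unfolding residue_limit_def set_eq_iff omega_limit_iff e mem_Collect_eq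
    by meson
qed

lemma residue_limit_subseqI:
  assumes r: "strict_mono r" and lim: "(\<lambda>k. X (r k)) \<longlonglongrightarrow> w"
    and inf: "infinite {k. int m dvd int (r k) - int i}"
  shows "w \<in> residue_limit X m i"
  unfolding residue_limit_def
proof (intro CollectI allI impI)
  fix e :: real and N assume "e > 0"
  then obtain K where K: "\<And>k. k \<ge> K \<Longrightarrow> \<bar>X (r k) - w\<bar> < e" using LIMSEQ_D[OF lim] by auto
  obtain k where k: "k \<ge> max K N" "int m dvd int (r k) - int i"
    using inf unfolding infinite_nat_iff_unbounded_le by blast
  have "r k \<ge> N" using strict_mono_imp_increasing[OF r, of k] k by simp
  then show "\<exists>n\<ge>N. int m dvd int n - int i \<and> \<bar>X n - w\<bar> < e" using k K[of k] by auto
qed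

lemma residue_limit_subseqE:
  assumes "w \<in> residue_limit X m i"
  obtains r where "strict_mono r" "\<And>k. int m dvd int (r k) - int i" "(\<lambda>k. X (r k)) \<longlonglongrightarrow> w"
proof -
  have ex: "\<exists>n\<ge>N. int m dvd int n - int i \<and> \<bar>X n - w\<bar> < inverse (real (Suc k))" for N k
    using assms unfolding residue_limit_def by simp
  have "\<exists>r. \<forall>k. (int m dvd int (r k) - int i \<and> \<bar>X (r k) - w\<bar> < inverse (real (Suc k))) \<and> r k < r (Suc k)"
  proof (rule dependent_nat_choice)
    show "\<exists>n. int m dvd int n - int i \<and> \<bar>X n - w\<bar> < inverse (real (Suc 0))" using ex[of 0 0] by blast
    fix n k assume "int m dvd int n - int i \<and> \<bar>X n - w\<bar> < inverse (real (Suc k))"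
    show "\<exists>n'. (int m dvd int n' - int i \<and> \<bar>X n' - w\<bar> < inverse (real (Suc (Suc k)))) \<and> n < n'"
      using ex[of "Suc n" "Suc k"] by (auto simp: Suc_le_eq)
  qed
  then obtain r where r: "\<And>k. int m dvd int (r k) - int i" "\<And>k. \<bar>X (r k) - w\<bar> < inverse (real (Suc k))"
    "\<And>k. r k < r (Suc k)" by blast
  have "(\<lambda>k. X (r k) - w) \<longlonglongrightarrow> 0"
    by (rule Lim_null_comparison[OF _ LIMSEQ_inverse_real_of_nat], rule always_eventually)
      (use r(2) in \<open>simp add: less_imp_le del: of_nat_Suc\<close>)
  then have "(\<lambda>k. X (r k)) \<longlonglongrightarrow> w" by (simp add: LIM_zero_iff)
  then show thesis using that r strict_mono_Suc_iff by blast
qed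

lemma bounded_convergent_subsequence_in:
  fixes Z :: "nat \<Rightarrow> 'a::heine_borel"
  assumes "bounded (range Z)" "infinite T"
  obtains r w where "strict_mono r" "\<And>k. r k \<in> T" "(\<lambda>k. Z (r k)) \<longlonglongrightarrow> w"
proof -
  let ?e = "enumerate T"
  have e: "strict_mono ?e" by (rule strict_mono_enumerate[OF assms(2)])
  have "bounded (range (\<lambda>k. Z (?e k)))" by (rule bounded_subset[OF assms(1)]) auto
  then obtain w s where s: "strict_mono s" "((\<lambda>k. Z (?e k)) \<circ> s) \<longlonglongrightarrow> w"
    using bounded_imp_convergent_subsequence by blast
  show thesis
  proof (rule that[of "?e \<circ> s" w])
    show "strict_mono (?e \<circ> s)" using e s(1) by (rule strict_mono_o)
    show "(?e \<circ> s) k \<in> T" for k using enumerate_in_set[OF assms(2)] by simp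
    show "(\<lambda>k. Z ((?e \<circ> s) k)) \<longlonglongrightarrow> w" using s(2) by (simp add: o_def)
  qed
qed

lemma residue_limit_along:
  assumes "bounded (range X)" "infinite T" "\<And>n. n \<in> T \<Longrightarrow> int m dvd int n - int i"
  obtains r w where "strict_mono r" "\<And>k. r k \<in> T" "(\<lambda>k. X (r k)) \<longlonglongrightarrow> w" "w \<in> residue_limit X m i"
proof -
  obtain r w where r: "strict_mono r" "\<And>k. r k \<in> T" "(\<lambda>k. X (r k)) \<longlonglongrightarrow> w"
    using bounded_convergent_subsequence_in[OF assms(1,2)] by blast
  have "{k. int m dvd int (r k) - int i} = UNIV" using assms(3) r(2) by simp
  then have "w \<in> residue_limit X m i" by (intro residue_limit_subseqI[OF r(1,3)]) simp
  then show thesis using that r by blast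
qed

lemma infinite_residue_class:
  assumes "m \<ge> 1"
  shows "infinite {n. int m dvd int n - int i}"
proof -
  have "inj (\<lambda>k. m * k + i)" using assms by (auto intro!: injI)
  then have "infinite (range (\<lambda>k. m * k + i))" by (rule range_inj_infinite)
  moreover have "range (\<lambda>k. m * k + i) \<subseteq> {n. int m dvd int n - int i}" by auto
  ultimately show ?thesis using finite_subset by blast
qed

lemma residue_limit_nonempty:
  assumes "bounded (range X)" "m \<ge> 1"
  shows "residue_limit X m i \<noteq> {}"
  using residue_limit_along[OF assms(1) infinite_residue_class[OF assms(2), of i], of m i] by auto

lemma closed_residue_limit: "closed (residue_limit X m i)"
  unfolding closed_sequential_limits
proof (intro allI impI, elim conjE)
  fix s l assume s: "\<forall>n. s n \<in> residue_limit X m i" and l: "s \<longlonglongrightarrow> l"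
  show "l \<in> residue_limit X m i"
    unfolding residue_limit_def
  proof (intro CollectI allI impI)
    fix e :: real and N assume "e > 0"
    then have e: "e / 2 > 0" by simp
    then obtain k where k: "\<bar>s k - l\<bar> < e / 2" using LIMSEQ_D[OF l e] by auto
    obtain n where n: "n \<ge> N" "int m dvd int n - int i" "\<bar>X n - s k\<bar> < e / 2"
      using s e unfolding residue_limit_def by blast
    have "\<bar>X n - l\<bar> \<le> \<bar>X n - s k\<bar> + \<bar>s k - l\<bar>" by arith
    also have "\<dots> < e" using add_strict_mono[OF n(3) k] by simp
    finally show "\<exists>n\<ge>N. int m dvd int n - int i \<and> \<bar>X n - l\<bar> < e" using n by blast
  qed
qed

lemma residue_limit_subset_closed:
  assumes C: "closed C" and ev: "\<And>n. n \<ge> N \<Longrightarrow> int m dvd int n - int i \<Longrightarrow> X n \<in> C"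
  shows "residue_limit X m i \<subseteq> C"
proof
  fix w assume "w \<in> residue_limit X m i"
  then obtain r where r: "strict_mono r" "\<And>k. int m dvd int (r k) - int i" "(\<lambda>k. X (r k)) \<longlonglongrightarrow> w"
    using residue_limit_subseqE by blast
  have "X (r (k + N)) \<in> C" for k
    using ev[of "r (k + N)"] r(2) strict_mono_imp_increasing[OF r(1), of "k + N"] by simp
  then show "w \<in> C" using closed_sequentially[OF C, of "\<lambda>k. X (r (k + N))" w] LIMSEQ_ignore_initial_segment[OF r(3), of N] by simp
qed

lemma compact_residue_limit:
  assumes "bounded (range X)"
  shows "compact (residue_limit X m i)"
proof -
  have "residue_limit X m i \<subseteq> closure (range X)"
    by (rule residue_limit_subset_closed[of _ 0]) (auto intro: closure_subset[THEN subsetD])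
  then show ?thesis
    using bounded_subset[OF bounded_closure[OF assms]] closed_residue_limit compact_eq_bounded_closed by blast
qed

lemma residue_limit_cong:
  assumes "int m dvd int i - int j"
  shows "residue_limit X m i = residue_limit X m j"
proof -
  have "int m dvd int n - int i \<longleftrightarrow> int m dvd int n - int j" for n
    using assms dvd_add_right_iff[OF assms, of "int n - int i"] by simp
  then show ?thesis unfolding residue_limit_def by simp
qed

lemma residue_limit_antimono:
  assumes "m dvd m'"
  shows "residue_limit X m' i \<subseteq> residue_limit X m i"
proof -
  have "int m dvd int m'" using assms by simp
  then have "int m' dvd t \<Longrightarrow> int m dvd t" for t by (rule dvd_trans)
  then show ?thesis unfolding residue_limit_def by blast
qed

lemma residue_limit_Union:
  assumes "m \<ge> 1" "w \<in> residue_limit X 1 0"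
  shows "\<exists>i<m. w \<in> residue_limit X m i"
proof -
  obtain r where r: "strict_mono r" "(\<lambda>k. X (r k)) \<longlonglongrightarrow> w"
    using residue_limit_subseqE[OF assms(2)] by blast
  have "finite ((\<lambda>k. r k mod m) ` UNIV)"
    by (rule finite_subset[of _ "{..<m}"]) (use assms in auto)
  then obtain k0 where k0: "infinite {k \<in> UNIV. r k mod m = r k0 mod m}"
    using pigeonhole_infinite[of UNIV "\<lambda>k. r k mod m"] by auto
  have "int m dvd int (r k) - int (r k0 mod m)" if "r k mod m = r k0 mod m" for k
    unfolding that[symmetric] by (simp add: zmod_int minus_mod_eq_mult_div)
  then have "infinite {k. int m dvd int (r k) - int (r k0 mod m)}"
    using k0 by (elim contrapos_nn) (erule finite_subset[rotated], auto)
  then show ?thesis using residue_limit_subseqI[OF r] assms by (intro exI[of _ "r k0 mod m"]) auto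
qed

section \<open>The action of the map on limit sets of residue classes\<close>

locale orbit =
  fixes f :: "real \<Rightarrow> real" and X :: "nat \<Rightarrow> real"
  assumes cont: "continuous_on UNIV f" and bdd: "bounded (range X)" and step: "\<And>n. X (Suc n) = f (X n)"
begin

lemma funpow_orbit: "(f ^^ t) (X n) = X (n + t)"
  by (induction t) (simp_all add: step)

lemma funpow_orbit_0: "(\<lambda>n. (f ^^ n) (X 0)) = X"
  by (simp add: funpow_orbit)

lemma omega_limit_funpow_orbit: "m \<ge> 1 \<Longrightarrow> omega_limit (f ^^ m) ((f ^^ i) (X 0)) = residue_limit X m i"
  using omega_limit_funpow_eq[of m f i "X 0"] unfolding funpow_orbit_0 .

lemma omega_limit_orbit: "omega_limit f (X 0) = residue_limit X 1 0"
  using omega_limit_funpow_orbit[of 1 0] by simp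

lemma tendsto_funpow: "(s \<longlongrightarrow> w) F \<Longrightarrow> ((\<lambda>k. (f ^^ t) (s k)) \<longlongrightarrow> (f ^^ t) w) F"
  using continuous_on_funpow[OF cont, of t]
  by (auto simp: continuous_on_eq_continuous_at intro: isCont_tendsto_compose)

lemma funpow_residue_limit:
  assumes "w \<in> residue_limit X m i"
  shows "(f ^^ t) w \<in> residue_limit X m (i + t)"
proof -
  obtain r where r: "strict_mono r" "\<And>k. int m dvd int (r k) - int i" "(\<lambda>k. X (r k)) \<longlonglongrightarrow> w"
    using residue_limit_subseqE[OF assms] by blast
  show ?thesis
  proof (rule residue_limit_subseqI[of "\<lambda>k. r k + t"])
    show "strict_mono (\<lambda>k. r k + t)" using r(1) by (simp add: strict_mono_def)
    show "(\<lambda>k. X (r k + t)) \<longlonglongrightarrow> (f ^^ t) w"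
      using tendsto_funpow[OF r(3), of t] by (simp add: funpow_orbit)
    show "infinite {k. int m dvd int (r k + t) - int (i + t)}" using r(2) by simp
  qed
qed

text \<open>Shift the approximating times back by \<open>t\<close> and extract a convergent
  subsequence. Together with \<open>funpow_residue_limit\<close>, \<open>f ^^ t\<close> maps the
  limit set of class \<open>i\<close> onto that of class \<open>i + t\<close>.\<close>

lemma residue_limit_preimage:
  assumes "w \<in> residue_limit X m (i + t)"
  obtains v where "v \<in> residue_limit X m i" "(f ^^ t) v = w"
proof -
  obtain r where r: "strict_mono r" "\<And>k. int m dvd int (r k) - int (i + t)" "(\<lambda>k. X (r k)) \<longlonglongrightarrow> w"
    using residue_limit_subseqE[OF assms] by blast
  have ge: "k + t \<le> r (k + t)" for k by (rule strict_mono_imp_increasing[OF r(1)])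
  \<comment> \<open>The argument \<open>k + t\<close> guarantees \<open>r (k + t) \<ge> t\<close>,
    so that the subtraction is exact.\<close>
  define T where "T = range (\<lambda>k. r (k + t) - t)"
  have "inj (\<lambda>k. r (k + t) - t)"
  proof (rule injI)
    fix a b assume "r (a + t) - t = r (b + t) - t"
    then have "r (a + t) = r (b + t)" using ge[of a] ge[of b] by simp
    then show "a = b" using strict_mono_eq[OF r(1)] by simp
  qed
  then have T: "infinite T" unfolding T_def by (rule range_inj_infinite)
  have Tm: "int m dvd int n - int i" if nT: "n \<in> T" for n
  proof -
    obtain k where k: "n = r (k + t) - t" using nT unfolding T_def by blast
    then have "int n - int i = int (r (k + t)) - int (i + t)" using ge[of k] by simp
    then show ?thesis by (simp only: r(2))
  qed
  obtain s v where s: "strict_mono s" "\<And>k. s k \<in> T" "(\<lambda>k. X (s k)) \<longlonglongrightarrow> v" "v \<in> residue_limit X m i"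
    using residue_limit_along[OF bdd T Tm] by blast
  have "(\<lambda>k. X (s k + t)) \<longlonglongrightarrow> (f ^^ t) v" using tendsto_funpow[OF s(3), of t] by (simp add: funpow_orbit)
  moreover have "(\<lambda>k. X (s k + t)) \<longlonglongrightarrow> w"
  proof (rule LIMSEQ_I)
    fix e :: real assume "e > 0"
    then obtain K where K: "\<And>k. k \<ge> K \<Longrightarrow> \<bar>X (r k) - w\<bar> < e" using LIMSEQ_D[OF r(3)] by auto
    have "\<bar>X (s k + t) - w\<bar> < e" if k: "k \<ge> r K" for k
    proof -
      obtain j where j: "s k = r (j + t) - t" using s(2)[of k] unfolding T_def by blast
      then have e: "s k + t = r (j + t)" using ge[of j] by simp
      have "r K \<le> r (j + t)" using strict_mono_imp_increasing[OF s(1), of k] k e by simp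
      then have "K \<le> j + t" using strict_mono_less_eq[OF r(1)] by simp
      then show ?thesis using K e by simp
    qed
    then show "\<exists>no. \<forall>n\<ge>no. norm (X (s n + t) - w) < e" by auto
  qed
  ultimately show thesis using that[OF s(4)] LIMSEQ_unique by blast
qed

text \<open>The limit sets of the classes are images of one another, so one finite class would make
  all of them, and their union, finite.\<close>

lemma infinite_residue_limit:
  assumes "m \<ge> 1" "infinite (residue_limit X 1 0)"
  shows "infinite (residue_limit X m i)"
proof
  assume fin: "finite (residue_limit X m i)"
  have "finite (residue_limit X m j)" for j
  proof -
    \<comment> \<open>A natural number congruent to \<open>j - i\<close> modulo \<open>m\<close>;
      the term \<open>m * i\<close> keeps the subtraction from truncating.\<close>
    define t where "t = j + m * i - i"
    have "i \<le> m * i" using assms(1) by (cases m) auto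
    then have t: "i + t = j + m * i" unfolding t_def by linarith
    have "residue_limit X m j = residue_limit X m (i + t)"
      unfolding t by (rule residue_limit_cong) simp
    also have "\<dots> \<subseteq> (f ^^ t) ` residue_limit X m i"
      by (auto elim!: residue_limit_preimage)
    finally show ?thesis using fin finite_subset by blast
  qed
  then have "finite (\<Union>i<m. residue_limit X m i)" by simp
  moreover have "residue_limit X 1 0 \<subseteq> (\<Union>i<m. residue_limit X m i)"
    using residue_limit_Union[OF assms(1)] by fastforce
  ultimately show False using assms(2) finite_subset by blast
qed

text \<open>Infinitely many terms outside the open set would, by boundedness, accumulate at a limit
  outside it.\<close>

lemma residue_limit_eventually:
  assumes "open O'" "residue_limit X m i \<subseteq> O'"
  shows "\<exists>N. \<forall>n\<ge>N. int m dvd int n - int i \<longrightarrow> X n \<in> O'"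
proof (rule ccontr)
  assume "\<not> ?thesis"
  then have "infinite {n. int m dvd int n - int i \<and> X n \<notin> O'}"
    unfolding infinite_nat_iff_unbounded_le by blast
  then obtain r w where r: "\<And>k. r k \<in> {n. int m dvd int n - int i \<and> X n \<notin> O'}"
    "(\<lambda>k. X (r k)) \<longlonglongrightarrow> w" "w \<in> residue_limit X m i"
    using residue_limit_along[OF bdd, of "{n. int m dvd int n - int i \<and> X n \<notin> O'}" m i] by blast
  have "X (r k) \<in> - O'" for k using r(1)[of k] by simp
  then have "w \<in> - O'" using closed_sequentially[of "- O'" "\<lambda>k. X (r k)" w] assms(1) r(2) by auto
  then show False using r(3) assms(2) by blast
qed

end

lemma horseshoe_free_orbit:
  assumes "horseshoe_free f"
  shows "orbit f (\<lambda>n. (f ^^ n) x)"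
  by unfold_locales (use horseshoe_freeD[OF assms] bounded_orbit in auto)

section \<open>Centers of alternation and the exclusion of periodic points\<close>

definition alternates :: "(real \<Rightarrow> real) \<Rightarrow> real \<Rightarrow> real \<Rightarrow> nat \<Rightarrow> bool" where
  "alternates f x z N \<longleftrightarrow> (\<forall>n\<ge>N. (f ^^ n) x < z \<and> z < (f ^^ Suc n) x \<or> z < (f ^^ n) x \<and> (f ^^ Suc n) x < z)"

lemma alternates_parity:
  assumes "alternates f x z N"
  shows "(\<forall>n\<ge>N. (even n \<longrightarrow> (f ^^ n) x < z) \<and> (odd n \<longrightarrow> z < (f ^^ n) x)) \<or>
         (\<forall>n\<ge>N. (even n \<longrightarrow> z < (f ^^ n) x) \<and> (odd n \<longrightarrow> (f ^^ n) x < z))"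
proof -
  define X where "X n = (f ^^ n) x" for n
  have alt: "X n < z \<and> z < X (Suc n) \<or> z < X n \<and> X (Suc n) < z" if "n \<ge> N" for n
    using assms that unfolding alternates_def X_def by blast
  have side: "(X n < z \<longleftrightarrow> X N < z) \<longleftrightarrow> even (n - N)" if "n \<ge> N" for n
    using that
  proof (induction rule: dec_induct)
    case (step n)
    then have "even (Suc n - N) \<longleftrightarrow> odd (n - N)" by (simp add: Suc_diff_le)
    then show ?case using step alt[of n] by auto
  qed simp
  have "(even n \<longrightarrow> X n < z) \<and> (odd n \<longrightarrow> z < X n)" if "n \<ge> N" "X N < z \<longleftrightarrow> even N" for n
    using side[OF that(1)] that alt[OF that(1)] by auto
  moreover have "(even n \<longrightarrow> z < X n) \<and> (odd n \<longrightarrow> X n < z)" if "n \<ge> N" "\<not> (X N < z \<longleftrightarrow> even N)" for n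
    using side[OF that(1)] that alt[OF that(1)] by auto
  ultimately show ?thesis unfolding X_def by blast
qed

text \<open>Along a subsequence both the orbit points and their successors converge to the fixed
  point \<open>w\<close>. If \<open>w\<close> were not \<open>z\<close>, both would end up on the
  same side of \<open>z\<close>.\<close>

lemma fixpoint_in_omega_eq_center:
  assumes f: "horseshoe_free f" and alt: "alternates f x z N" and w: "w \<in> omega_limit f x" "f w = w"
  shows "w = z"
proof (rule ccontr)
  assume "w \<noteq> z"
  define X where "X n = (f ^^ n) x" for n
  have X0: "X 0 = x" unfolding X_def by simp
  interpret orbit f X unfolding X_def by (rule horseshoe_free_orbit[OF f])
  obtain r where r: "strict_mono r" "(\<lambda>k. X (r k)) \<longlonglongrightarrow> w"
    using residue_limit_subseqE[OF w(1)[folded X0, unfolded omega_limit_orbit]] by blast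
  have "(\<lambda>k. (f ^^ 1) (X (r k))) \<longlonglongrightarrow> (f ^^ 1) w" by (rule tendsto_funpow[OF r(2)])
  then have r': "(\<lambda>k. X (Suc (r k))) \<longlonglongrightarrow> w" using w(2) by (simp add: step)
  have "\<forall>\<^sub>F k in sequentially. r k \<ge> N"
    using eventually_ge_at_top[of N] by (rule eventually_mono) (rule order_trans[OF _ strict_mono_imp_increasing[OF r(1)]])
  then have ev: "\<forall>\<^sub>F k in sequentially. X (r k) < z \<and> z < X (Suc (r k)) \<or> z < X (r k) \<and> X (Suc (r k)) < z"
    by eventually_elim (use alt in \<open>auto simp: alternates_def X_def\<close>)
  show False
  proof (cases "w < z")
    case True
    have "\<forall>\<^sub>F k in sequentially. False"
      using ev order_tendstoD(2)[OF r(2) True] order_tendstoD(2)[OF r' True] by eventually_elim auto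
    then show False by simp
  next
    case False
    then have zw: "z < w" using \<open>w \<noteq> z\<close> by simp
    have "\<forall>\<^sub>F k in sequentially. False"
      using ev order_tendstoD(1)[OF r(2) zw] order_tendstoD(1)[OF r' zw] by eventually_elim auto
    then show False by simp
  qed
qed

text \<open>The fixed point would be the center for \<open>f\<close> and, within the parity class
  that approaches it, also the center for \<open>f ^^ 2\<close>. Then points an even number of steps
  apart would lie on opposite sides for the second alternation and on the same side for the
  first.\<close>

lemma no_fixpoint_in_infinite_omega:
  assumes f: "horseshoe_free f" and inf: "infinite (omega_limit f x)"
    and w: "w \<in> omega_limit f x" "f w = w"
  shows False
proof -
  define X where "X n = (f ^^ n) x" for n
  have X0: "X 0 = x" unfolding X_def by simp
  interpret orbit f X unfolding X_def by (rule horseshoe_free_orbit[OF f])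
  obtain z N where alt: "alternates f x z N"
    using infinite_omega_alternating[OF f inf] unfolding alternates_def by blast
  have wz: "w = z" by (rule fixpoint_in_omega_eq_center[OF f alt w])
  obtain i where i: "w \<in> residue_limit X 2 i"
    using residue_limit_Union[of 2, OF _ w(1)[folded X0, unfolded omega_limit_orbit]] by auto
  have om: "omega_limit (f ^^ 2) ((f ^^ i) x) = residue_limit X 2 i"
    unfolding X0[symmetric] by (rule omega_limit_funpow_orbit) simp
  have f2: "horseshoe_free (f ^^ 2)" by (rule horseshoe_free_funpow[OF f]) simp
  have inf2: "infinite (omega_limit (f ^^ 2) ((f ^^ i) x))"
    unfolding om by (rule infinite_residue_limit) (simp_all only: inf[folded X0, unfolded omega_limit_orbit], simp)
  obtain z' N' where alt': "alternates (f ^^ 2) ((f ^^ i) x) z' N'"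
    using infinite_omega_alternating[OF f2 inf2] unfolding alternates_def by blast
  have "w = z'"
    by (rule fixpoint_in_omega_eq_center[OF f2 alt']) (use om i w(2) in \<open>auto simp: numeral_2_eq_2\<close>)
  moreover have e: "((f ^^ 2) ^^ n) ((f ^^ i) x) = X (2 * n + i)" for n
    unfolding X_def by (simp only: funpow_mult funpow_add o_apply)
  define n where "n = N + N'"
  have "X (2 * n + i) < z \<and> z < X (2 * Suc n + i) \<or> z < X (2 * n + i) \<and> X (2 * Suc n + i) < z"
    using alt' wz \<open>w = z'\<close> unfolding alternates_def e n_def by (metis le_add2)
  moreover have "even (2 * n + i) \<longleftrightarrow> even (2 * Suc n + i)" "2 * n + i \<ge> N" "2 * Suc n + i \<ge> N"
    unfolding n_def by auto
  ultimately show False using alternates_parity[OF alt] unfolding X_def by (metis less_asym)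
qed

theorem no_periodic_point_in_infinite_omega:
  assumes f: "horseshoe_free f" and inf: "infinite (omega_limit f x)"
    and w: "w \<in> omega_limit f x" "(f ^^ p) w = w" "p \<ge> 1"
  shows False
proof -
  define X where "X n = (f ^^ n) x" for n
  have X0: "X 0 = x" unfolding X_def by simp
  interpret orbit f X unfolding X_def by (rule horseshoe_free_orbit[OF f])
  obtain i where i: "w \<in> residue_limit X p i"
    using residue_limit_Union[OF w(3) w(1)[folded X0, unfolded omega_limit_orbit]] by auto
  have om: "omega_limit (f ^^ p) ((f ^^ i) x) = residue_limit X p i"
    unfolding X0[symmetric] by (rule omega_limit_funpow_orbit[OF w(3)])
  show False
  proof (rule no_fixpoint_in_infinite_omega[OF horseshoe_free_funpow[OF f w(3)], of "(f ^^ i) x" w])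
    show "infinite (omega_limit (f ^^ p) ((f ^^ i) x))"
      unfolding om by (rule infinite_residue_limit[OF w(3) inf[folded X0, unfolded omega_limit_orbit]])
  qed (use om i w in auto)
qed

section \<open>Order separation of the limit sets of different residue classes\<close>

definition separated :: "real set \<Rightarrow> real set \<Rightarrow> bool" where
  "separated A B \<longleftrightarrow> (\<exists>z. (\<forall>a\<in>A. a < z) \<and> (\<forall>b\<in>B. z < b) \<or> (\<forall>a\<in>A. z < a) \<and> (\<forall>b\<in>B. b < z))"

lemma separated_mono: "separated A B \<Longrightarrow> A' \<subseteq> A \<Longrightarrow> B' \<subseteq> B \<Longrightarrow> separated A' B'"
  unfolding separated_def by blast

locale solenoid = orbit f X for f X +
  assumes hf: "horseshoe_free f" and inf: "infinite (residue_limit X 1 0)"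
begin

text \<open>The orbit under \<open>f ^^ (2 ^ k)\<close> alternates around a fixed point
  \<open>z\<close> of that iterate, so the two classes modulo \<open>2 ^ Suc k\<close> accumulate on
  opposite closed sides of \<open>z\<close>. As \<open>z\<close> is periodic for \<open>f\<close>,
  it belongs to neither limit set, which makes the separation strict.\<close>

lemma separated_siblings: "separated (residue_limit X (2 ^ Suc k) i) (residue_limit X (2 ^ Suc k) (i + 2 ^ k))"
proof -
  define g where "g = f ^^ (2 ^ k)"
  define y where "y = (f ^^ i) (X 0)"
  have g: "horseshoe_free g" unfolding g_def by (rule horseshoe_free_funpow[OF hf]) simp
  have om: "omega_limit g y = residue_limit X (2 ^ k) i"
    unfolding g_def y_def by (rule omega_limit_funpow_orbit) simp
  have "infinite (omega_limit g y)" unfolding om by (rule infinite_residue_limit[OF _ inf]) simp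
  then obtain z N where z: "g z = z" and alt: "alternates g y z N"
    using infinite_omega_alternating[OF g] unfolding alternates_def by blast
  have gy: "(g ^^ n) y = X (i + 2 ^ k * n)" for n
    unfolding g_def y_def by (simp add: funpow_mult funpow_orbit)
  have not_z: "z \<notin> residue_limit X m j" for m j
  proof
    assume "z \<in> residue_limit X m j"
    then have "z \<in> residue_limit X 1 j" using residue_limit_antimono[of 1 m X j] by auto
    then have "z \<in> omega_limit f (X 0)"
      using residue_limit_cong[of 1 j 0 X] unfolding omega_limit_orbit by simp
    then show False
      using no_periodic_point_in_infinite_omega[OF hf _ _ z[unfolded g_def], of "X 0"] inf
      unfolding omega_limit_orbit by simp
  qed
  \<comment> \<open>Times of the class \<open>i + 2 ^ k * e\<close> modulo \<open>2 ^ Suc k\<close>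
    are exactly the times of \<open>g\<close> with the parity of \<open>e\<close>; it is used for
    \<open>e = 0\<close> and \<open>e = 1\<close>.\<close>
  have ge: "residue_limit X (2 ^ Suc k) (i + 2 ^ k * e) \<subseteq> C"
    if C: "closed C" and e: "\<And>n. n \<ge> N \<Longrightarrow> even (n + e) \<Longrightarrow> (g ^^ n) y \<in> C" for C e
  proof (rule residue_limit_subset_closed[of C "i + 2 ^ k * N"])
    fix n assume n: "n \<ge> i + 2 ^ k * N" "int (2 ^ Suc k) dvd int n - int (i + 2 ^ k * e)"
    have "(2::int) ^ k dvd int n - int (i + 2 ^ k * e)"
      using n(2) by (metis dvd_trans le_imp_power_dvd lessI less_imp_le of_nat_numeral of_nat_power)
    then have "(2::int) ^ k dvd int n - int (i + 2 ^ k * e) + 2 ^ k * int e" by (rule dvd_add) simp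
    then have "(2::int) ^ k dvd int (n - i)" using n(1) by (simp add: of_nat_diff)
    then have "2 ^ k dvd n - i" by (metis of_nat_dvd_iff of_nat_numeral of_nat_power)
    then obtain j where j: "n - i = 2 ^ k * j" by (elim dvdE)
    then have nj: "n = i + 2 ^ k * j" using n(1) by simp
    then have "j \<ge> N" using n(1) by simp
    have "int n - int (i + 2 ^ k * e) = 2 ^ k * (int j - int e)" unfolding nj by (simp add: algebra_simps)
    then have "2 ^ k * 2 dvd 2 ^ k * (int j - int e)" using n(2) by (simp add: mult.commute)
    then have "2 dvd int j - int e" by simp
    then have "even (j + e)" by presburger
    then show "X n \<in> C" using e[OF \<open>j \<ge> N\<close>] unfolding gy nj by simp
  qed (rule C)
  have e0: "residue_limit X (2 ^ Suc k) i \<subseteq> C"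
    if "closed C" "\<And>n. n \<ge> N \<Longrightarrow> even n \<Longrightarrow> (g ^^ n) y \<in> C" for C
    using ge[of C 0] that by simp
  have e1: "residue_limit X (2 ^ Suc k) (i + 2 ^ k) \<subseteq> C"
    if "closed C" "\<And>n. n \<ge> N \<Longrightarrow> odd n \<Longrightarrow> (g ^^ n) y \<in> C" for C
    using ge[of C 1] that by simp
  from alternates_parity[OF alt] show ?thesis
  proof
    assume a: "\<forall>n\<ge>N. (even n \<longrightarrow> (g ^^ n) y < z) \<and> (odd n \<longrightarrow> z < (g ^^ n) y)"
    have "residue_limit X (2 ^ Suc k) i \<subseteq> {..z}" by (rule e0) (use a less_imp_le in auto)
    moreover have "residue_limit X (2 ^ Suc k) (i + 2 ^ k) \<subseteq> {z..}" by (rule e1) (use a less_imp_le in auto)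
    ultimately show ?thesis using not_z unfolding separated_def by (intro exI[of _ z] disjI1) (force simp: less_le)
  next
    assume a: "\<forall>n\<ge>N. (even n \<longrightarrow> z < (g ^^ n) y) \<and> (odd n \<longrightarrow> (g ^^ n) y < z)"
    have "residue_limit X (2 ^ Suc k) i \<subseteq> {z..}" by (rule e0) (use a less_imp_le in auto)
    moreover have "residue_limit X (2 ^ Suc k) (i + 2 ^ k) \<subseteq> {..z}" by (rule e1) (use a less_imp_le in auto)
    ultimately show ?thesis using not_z unfolding separated_def by (intro exI[of _ z] disjI2) (force simp: less_le)
  qed
qed

text \<open>Two classes that differ modulo \<open>2 ^ Suc k\<close> either differ already modulo
  \<open>2 ^ k\<close>, or their indices differ by an odd multiple of \<open>2 ^ k\<close>, which
  makes them siblings.\<close>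

theorem separated_residue_limits:
  assumes "\<not> 2 ^ k dvd int i - int j"
  shows "separated (residue_limit X (2 ^ k) i) (residue_limit X (2 ^ k) j)"
  using assms
proof (induction k)
  case (Suc k)
  show ?case
  proof (cases "2 ^ k dvd int i - int j")
    case False
    show ?thesis
      by (rule separated_mono[OF Suc.IH[OF False]]) (rule residue_limit_antimono; simp)+
  next
    case True
    then obtain q where q: "int i - int j = 2 ^ k * q" by (elim dvdE)
    have "odd q"
    proof
      assume "even q"
      then have "2 ^ k * 2 dvd 2 ^ k * q" by (rule mult_dvd_mono[OF dvd_refl])
      then show False using Suc.prems q by (simp add: mult.commute)
    qed
    then have "even (q + 1)" by simp
    then have "2 ^ k * 2 dvd 2 ^ k * (q + 1)" by (rule mult_dvd_mono[OF dvd_refl])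
    moreover have "int (i + 2 ^ k) - int j = 2 ^ k * (q + 1)" using q by (simp add: algebra_simps)
    ultimately have "int (2 ^ Suc k) dvd int (i + 2 ^ k) - int j" by (simp add: mult.commute)
    then have "residue_limit X (2 ^ Suc k) (i + 2 ^ k) = residue_limit X (2 ^ Suc k) j" by (rule residue_limit_cong)
    then show ?thesis using separated_siblings[of k i] by simp
  qed
qed simp

end

subsection \<open>Scrambled pairs\<close>

definition real_hull :: "real set \<Rightarrow> real set" where
  "real_hull S = {Inf S..Sup S}"

lemma real_hull_mono:
  assumes "S \<noteq> {}" "S \<subseteq> T" "bounded T"
  shows "real_hull S \<subseteq> real_hull T"
proof -
  have "Inf T \<le> Inf S" "Sup S \<le> Sup T"
    using assms by (auto intro!: cInf_superset_mono cSup_subset_mono bounded_imp_bdd_above bounded_imp_bdd_below)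
  then show ?thesis unfolding real_hull_def by auto
qed

lemma subset_real_hull: "bounded S \<Longrightarrow> S \<subseteq> real_hull S"
  unfolding real_hull_def
  by (auto intro!: cInf_lower cSup_upper bounded_imp_bdd_above bounded_imp_bdd_below)

lemma real_hull_subset:
  assumes C: "closed C" "connected C" and S: "S \<noteq> {}" "S \<subseteq> C" "bounded S"
  shows "real_hull S \<subseteq> C"
proof -
  have "Inf S \<in> closure S" "Sup S \<in> closure S"
    using S by (auto intro!: closure_contains_Inf closure_contains_Sup bounded_imp_bdd_above bounded_imp_bdd_below)
  moreover have "closure S \<subseteq> C" by (rule closure_minimal[OF S(2) C(1)])
  ultimately show ?thesis unfolding real_hull_def using connected_contains_Icc[OF C(2)] by blast
qed

lemma nested_Icc_limits:
  fixes a b :: "nat \<Rightarrow> real"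
  assumes "\<And>k. a k \<le> a (Suc k)" "\<And>k. b (Suc k) \<le> b k" "\<And>k. a k \<le> b k"
  obtains u v where "u \<le> v" "a \<longlonglongrightarrow> u" "b \<longlonglongrightarrow> v" "(\<Inter>k\<in>{1..}. {a k..b k}) = {u..v}"
    "\<And>k. a k \<le> u" "\<And>k. v \<le> b k"
proof -
  have a: "incseq a" and b: "decseq b" using assms by (simp_all add: incseq_SucI decseq_SucI)
  have ab: "a j \<le> b k" for j k
  proof -
    have "a j \<le> a (max j k)" using a by (simp add: incseq_def)
    also have "\<dots> \<le> b (max j k)" by (rule assms)
    also have "\<dots> \<le> b k" using b by (simp add: decseq_def)
    finally show ?thesis .
  qed
  obtain u where u: "a \<longlonglongrightarrow> u" "\<And>k. a k \<le> u"
    using incseq_convergent[OF a, of "b 0"] ab by blast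
  obtain v where v: "b \<longlonglongrightarrow> v" "\<And>k. v \<le> b k"
    using decseq_convergent[OF b, of "a 0"] ab by blast
  have "u \<le> v" by (rule LIMSEQ_le[OF u(1) v(1)]) (auto intro: assms)
  moreover have "(\<Inter>k\<in>{1..}. {a k..b k}) = {u..v}"
  proof
    show "{u..v} \<subseteq> (\<Inter>k\<in>{1..}. {a k..b k})"
    proof (intro INT_greatest subsetI)
      fix k t assume "t \<in> {u..v}"
      then show "t \<in> {a k..b k}" using u(2)[of k] v(2)[of k] by simp
    qed
    show "(\<Inter>k\<in>{1..}. {a k..b k}) \<subseteq> {u..v}"
    proof
      fix t assume t: "t \<in> (\<Inter>k\<in>{1..}. {a k..b k})"
      have "u \<le> t" by (rule LIMSEQ_le_const2[OF u(1)]) (use t in \<open>auto intro: exI[of _ 1]\<close>)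
      moreover have "t \<le> v" by (rule LIMSEQ_le_const[OF v(1)]) (use t in \<open>auto intro: exI[of _ 1]\<close>)
      ultimately show "t \<in> {u..v}" by simp
    qed
  qed
  ultimately show thesis using that u v by blast
qed

lemma periodic_portion_eq: "periodic_portion f x k i = real_hull (residue_limit (\<lambda>n. (f ^^ n) x) (2 ^ k) i)"
  unfolding periodic_portion_def real_hull_def by (simp add: omega_limit_funpow_eq)

section \<open>Proximal orbits\<close>

locale proximal_orbits = X: orbit f X + Y: orbit f Y for f X Y +
  assumes prox: "\<And>e N. e > 0 \<Longrightarrow> \<exists>n\<ge>N. \<bar>X n - Y n\<bar> < e"
begin

lemma swap: "proximal_orbits f Y X"
  by unfold_locales (use prox in \<open>simp add: abs_minus_commute\<close>)

text \<open>Proximality says that 0 is a limit of the distances. By pigeonhole it is a limit along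
  one class modulo \<open>m\<close>; a subsequence on which \<open>X\<close> converges then takes
  \<open>Y\<close> to the same limit.\<close>

lemma common_limit:
  assumes m: "m \<ge> 1"
  obtains r w i where "strict_mono r" "(\<lambda>k. X (r k)) \<longlonglongrightarrow> w" "(\<lambda>k. Y (r k)) \<longlonglongrightarrow> w"
    "w \<in> residue_limit X m i" "w \<in> residue_limit Y m i"
proof -
  let ?D = "\<lambda>n. \<bar>X n - Y n\<bar>"
  have "0 \<in> residue_limit ?D 1 0" unfolding residue_limit_def using prox by simp
  then obtain i where "0 \<in> residue_limit ?D m i" using residue_limit_Union[OF m] by blast
  then obtain r where r: "strict_mono r" "\<And>k. int m dvd int (r k) - int i" "(\<lambda>k. ?D (r k)) \<longlonglongrightarrow> 0"
    by (rule residue_limit_subseqE) blast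
  have "bounded (range (\<lambda>k. X (r k)))" by (rule bounded_subset[OF X.bdd]) auto
  then obtain s w where s: "strict_mono s" "((\<lambda>k. X (r k)) \<circ> s) \<longlonglongrightarrow> w"
    using bounded_imp_convergent_subsequence by blast
  have rs: "strict_mono (\<lambda>k. r (s k))" using strict_mono_o[OF r(1) s(1)] by (simp add: o_def)
  have Xw: "(\<lambda>k. X (r (s k))) \<longlonglongrightarrow> w" using s(2) by (simp add: o_def)
  have "(\<lambda>k. ?D (r (s k))) \<longlonglongrightarrow> 0" using LIMSEQ_subseq_LIMSEQ[OF r(3) s(1)] by (simp add: o_def)
  then have "(\<lambda>k. X (r (s k)) - Y (r (s k))) \<longlonglongrightarrow> 0" by (simp add: tendsto_rabs_zero_iff)
  from tendsto_diff[OF Xw this] have Yw: "(\<lambda>k. Y (r (s k))) \<longlonglongrightarrow> w" by simp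
  have "infinite {k. int m dvd int (r (s k)) - int i}" using r(2) by simp
  then show thesis
    using that[OF rs Xw Yw residue_limit_subseqI[OF rs Xw] residue_limit_subseqI[OF rs Yw]] by blast
qed

text \<open>A common point of one class, pushed forward by iterates, gives a common point of every
  class.\<close>

lemma residue_limits_meet:
  assumes m: "m \<ge> 1"
  shows "\<exists>w. w \<in> residue_limit X m j \<and> w \<in> residue_limit Y m j"
proof -
  obtain w i where w: "w \<in> residue_limit X m i" "w \<in> residue_limit Y m i"
    using common_limit[OF m] by blast
  define t where "t = j + m * i - i"
  have "i \<le> m * i" using m by (cases m) auto
  then have "i + t = j + m * i" unfolding t_def by linarith
  then have "int m dvd int (i + t) - int j" by simp
  then show ?thesis
    using X.funpow_residue_limit[OF w(1), of t] Y.funpow_residue_limit[OF w(2), of t]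
      residue_limit_cong[of m "i + t" j] by auto
qed

text \<open>Both orbits end up near the finite set \<open>P\<close>, which \<open>f\<close> maps
  into itself. Once they are close to the same point of \<open>P\<close> at the same time, both
  shadow its orbit forever, and proximality supplies such a time.\<close>

lemma finite_limits_asymptotic:
  assumes fin: "finite (residue_limit X 1 0)" "finite (residue_limit Y 1 0)"
  shows "(\<lambda>n. \<bar>X n - Y n\<bar>) \<longlonglongrightarrow> 0"
proof (rule LIMSEQ_I)
  fix e :: real assume e: "e > 0"
  define P where "P = residue_limit X 1 0 \<union> residue_limit Y 1 0"
  have P: "finite P" using fin unfolding P_def by simp
  have fP: "f a \<in> P" if "a \<in> P" for a
    using that X.funpow_residue_limit[of a 1 0 1] Y.funpow_residue_limit[of a 1 0 1]
      residue_limit_cong[of 1 1 0] unfolding P_def by auto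
  obtain d where d: "d > 0" "\<And>a b. a \<in> P \<Longrightarrow> b \<in> P \<Longrightarrow> a \<noteq> b \<Longrightarrow> d \<le> \<bar>a - b\<bar>"
  proof -
    \<comment> \<open>The element 1 makes \<open>Min\<close> meaningful also when \<open>P\<close>
      has a single point.\<close>
    define S where "S = insert 1 ((\<lambda>(a, b). \<bar>a - b\<bar>) ` {(a, b). (a, b) \<in> P \<times> P \<and> a \<noteq> b})"
    have "finite S" unfolding S_def
      by (intro finite.insertI finite_imageI finite_subset[OF _ finite_cartesian_product[OF P P]]) auto
    moreover have "S \<noteq> {}" unfolding S_def by simp
    moreover have "\<forall>s\<in>S. s > 0" unfolding S_def by auto
    ultimately have 1: "Min S > 0" by simp
    have 2: "Min S \<le> \<bar>a - b\<bar>" if "a \<in> P" "b \<in> P" "a \<noteq> b" for a b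
      by (rule Min_le[OF \<open>finite S\<close>]) (use that in \<open>auto simp: S_def image_iff intro!: bexI[of _ "(a, b)"]\<close>)
    show thesis by (rule that[OF 1 2])
  qed
  have "\<forall>\<^sub>F \<eta> in at_right 0. \<forall>t. \<bar>t - a\<bar> < \<eta> \<longrightarrow> \<bar>f t - f a\<bar> < d / 3" for a
  proof -
    have "isCont f a" using X.cont by (simp add: continuous_on_eq_continuous_at)
    moreover have "d / 3 > 0" using d by simp
    ultimately obtain h where "h > 0" "\<forall>t. \<bar>t - a\<bar> < h \<longrightarrow> \<bar>f t - f a\<bar> < d / 3"
      unfolding continuous_at_eps_delta dist_real_def by blast
    then show ?thesis unfolding eventually_at_right_field by (intro exI[of _ h]) auto
  qed
  then have "\<forall>\<^sub>F \<eta> in at_right 0. \<forall>a\<in>P. \<forall>t. \<bar>t - a\<bar> < \<eta> \<longrightarrow> \<bar>f t - f a\<bar> < d / 3"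
    by (intro eventually_ball_finite[OF P]) simp
  moreover have "\<forall>\<^sub>F \<eta> in at_right 0. \<eta> < min (e / 2) (d / 3)"
    using e d by (intro order_tendstoD(2)[OF tendsto_ident_at]) simp
  moreover have "\<forall>\<^sub>F \<eta> in at_right (0::real). \<eta> > 0" by (simp add: eventually_at_right_less)
  ultimately have "\<forall>\<^sub>F \<eta> in at_right 0. \<eta> > 0 \<and> \<eta> < min (e / 2) (d / 3) \<and>
      (\<forall>a\<in>P. \<forall>t. \<bar>t - a\<bar> < \<eta> \<longrightarrow> \<bar>f t - f a\<bar> < d / 3)"
    by eventually_elim simp
  then have "\<exists>\<eta>. \<eta> > 0 \<and> \<eta> < min (e / 2) (d / 3) \<and>
      (\<forall>a\<in>P. \<forall>t. \<bar>t - a\<bar> < \<eta> \<longrightarrow> \<bar>f t - f a\<bar> < d / 3)"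
    by (rule eventually_happens'[rotated]) simp
  then obtain \<eta> where \<eta>': "\<eta> > 0" "\<eta> < min (e / 2) (d / 3)"
    and fc': "\<forall>a\<in>P. \<forall>t. \<bar>t - a\<bar> < \<eta> \<longrightarrow> \<bar>f t - f a\<bar> < d / 3"
    by (elim exE conjE)
  have \<eta>: "\<eta> > 0" "\<eta> < e / 2" "\<eta> < d / 3" using \<eta>' by auto
  have fc: "\<bar>f t - f a\<bar> < d / 3" if "a \<in> P" "\<bar>t - a\<bar> < \<eta>" for a t using fc' that by blast
  have near: "\<exists>N. \<forall>n\<ge>N. \<exists>a\<in>P. \<bar>Z n - a\<bar> < \<eta>"
    if Z: "orbit f Z" "residue_limit Z 1 0 \<subseteq> P" for Z
  proof -
    have "residue_limit Z 1 0 \<subseteq> (\<Union>a\<in>P. ball a \<eta>)" using Z(2) \<eta>(1) by fastforce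
    from orbit.residue_limit_eventually[OF Z(1) _ this] show ?thesis
      by (auto simp: dist_real_def abs_minus_commute)
  qed
  obtain N1 where N1: "\<forall>n\<ge>N1. \<exists>a\<in>P. \<bar>X n - a\<bar> < \<eta>"
    using near[OF X.orbit_axioms] unfolding P_def by blast
  obtain N2 where N2: "\<forall>n\<ge>N2. \<exists>a\<in>P. \<bar>Y n - a\<bar> < \<eta>"
    using near[OF Y.orbit_axioms] unfolding P_def by blast
  obtain r w i where r: "strict_mono r" "(\<lambda>k. X (r k)) \<longlonglongrightarrow> w" "(\<lambda>k. Y (r k)) \<longlonglongrightarrow> w"
    and w: "w \<in> residue_limit X 1 i"
    using common_limit[of 1] by blast
  have wP: "w \<in> P" using w residue_limit_cong[of 1 i 0 X] unfolding P_def by simp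
  obtain k1 where k1: "\<And>k. k \<ge> k1 \<Longrightarrow> \<bar>X (r k) - w\<bar> < \<eta>" using LIMSEQ_D[OF r(2) \<eta>(1)] by auto
  obtain k2 where k2: "\<And>k. k \<ge> k2 \<Longrightarrow> \<bar>Y (r k) - w\<bar> < \<eta>" using LIMSEQ_D[OF r(3) \<eta>(1)] by auto
  define k where "k = Max {k1, k2, N1, N2}"
  define n0 where "n0 = r k"
  have "k \<le> n0" unfolding n0_def by (rule strict_mono_imp_increasing[OF r(1)])
  moreover have kk: "k1 \<le> k" "k2 \<le> k" "N1 \<le> k" "N2 \<le> k" unfolding k_def by auto
  ultimately have n0: "N1 \<le> n0" "N2 \<le> n0" by linarith+
  \<comment> \<open>\<open>f z\<close> is close both to \<open>f a\<close> and to \<open>b\<close>.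
    Distinct points of \<open>P\<close> are at least \<open>d\<close> apart, so
    \<open>f a = b\<close>.\<close>
  have follow: "\<bar>f z - f a\<bar> < \<eta>" if a: "a \<in> P" "\<bar>z - a\<bar> < \<eta>" and b: "b \<in> P" "\<bar>f z - b\<bar> < \<eta>" for a b z
  proof -
    have 1: "\<bar>f z - f a\<bar> < d / 3" by (rule fc[OF a])
    have "\<bar>f a - b\<bar> \<le> \<bar>f z - f a\<bar> + \<bar>f z - b\<bar>" by arith
    also have "\<dots> < d" using 1 b(2) \<eta>(3) d(1) by linarith
    finally have "f a = b" using d(2)[OF fP[OF a(1)] b(1)] by linarith
    then show ?thesis using b(2) by simp
  qed
  have "\<exists>a\<in>P. \<bar>X n - a\<bar> < \<eta> \<and> \<bar>Y n - a\<bar> < \<eta>" if "n \<ge> n0" for n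
    using that
  proof (induction rule: dec_induct)
    case base
    then show ?case using k1[OF kk(1)] k2[OF kk(2)] wP unfolding n0_def by blast
  next
    case (step n)
    then obtain a where a: "a \<in> P" "\<bar>X n - a\<bar> < \<eta>" "\<bar>Y n - a\<bar> < \<eta>" by blast
    have "Suc n \<ge> N1" "Suc n \<ge> N2" using step(1) n0 by linarith+
    then obtain b c where b: "b \<in> P" "\<bar>X (Suc n) - b\<bar> < \<eta>" and c: "c \<in> P" "\<bar>Y (Suc n) - c\<bar> < \<eta>"
      using N1 N2 by blast
    have "\<bar>X (Suc n) - f a\<bar> < \<eta>" "\<bar>Y (Suc n) - f a\<bar> < \<eta>"
      using follow[OF a(1,2) b(1)] b(2) follow[OF a(1,3) c(1)] c(2) by (simp_all add: X.step Y.step)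
    then show ?case using fP[OF a(1)] by blast
  qed
  then have "\<bar>X n - Y n\<bar> < e" if "n \<ge> n0" for n using that \<eta>(2) by fastforce
  then show "\<exists>no. \<forall>n\<ge>no. norm (\<bar>X n - Y n\<bar> - 0) < e" by auto
qed

text \<open>If the limit set of \<open>Y\<close> were finite, a common limit point would run into a
  cycle under \<open>f\<close>. That cycle would lie in the infinite limit set of \<open>X\<close>,
  where there are no periodic points.\<close>

lemma infinite_limit_both:
  assumes hf: "horseshoe_free f" and X: "infinite (residue_limit X 1 0)"
  shows "infinite (residue_limit Y 1 0)"
proof
  assume fin: "finite (residue_limit Y 1 0)"
  obtain w where w: "w \<in> residue_limit X 1 0" "w \<in> residue_limit Y 1 0"
    using residue_limits_meet[of 1 0] by auto
  have inX: "(f ^^ t) w \<in> residue_limit X 1 0" and inY: "(f ^^ t) w \<in> residue_limit Y 1 0" for t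
    using X.funpow_residue_limit[OF w(1), of t] Y.funpow_residue_limit[OF w(2), of t]
      residue_limit_cong[of 1 t 0] by auto
  have "finite (range (\<lambda>t. (f ^^ t) w))" by (rule finite_subset[OF _ fin]) (use inY in auto)
  then have "\<not> inj (\<lambda>t. (f ^^ t) w)" using finite_imageD by fastforce
  then obtain a b where ab: "a < b" "(f ^^ a) w = (f ^^ b) w"
    unfolding inj_def by (metis linorder_neqE_nat)
  have "(f ^^ (b - a)) ((f ^^ a) w) = (f ^^ ((b - a) + a)) w" by (simp only: funpow_add o_apply)
  then have "(f ^^ (b - a)) ((f ^^ a) w) = (f ^^ a) w" using ab by simp
  moreover have "b - a \<ge> 1" using ab(1) by simp
  ultimately show False
    using no_periodic_point_in_infinite_omega[OF hf, of "X 0" "(f ^^ a) w" "b - a"] X inX[of a]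
    unfolding X.omega_limit_orbit by blast
qed

end

text \<open>A choice as in Koenig's lemma: of the two refinements of a class that contains
  infinitely many times of \<open>T\<close>, at least one still does.\<close>

lemma nested_address:
  assumes T: "infinite (T :: nat set)"
  obtains ik where "\<And>k. ik k < 2 ^ k" "\<And>k. infinite {n \<in> T. 2 ^ k dvd int n - int (ik k)}"
    "\<And>k. 2 ^ k dvd int (ik (Suc k)) - int (ik k)"
proof -
  let ?P = "\<lambda>k i. i < 2 ^ k \<and> infinite {n \<in> T. 2 ^ k dvd int n - int i}"
  have "\<exists>ik. \<forall>k. ?P k (ik k) \<and> 2 ^ k dvd int (ik (Suc k)) - int (ik k)"
  proof (rule dependent_nat_choice)
    show "\<exists>i. ?P 0 i" using T by (intro exI[of _ 0]) simp
    fix i k assume i: "?P k i"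
    have "{n \<in> T. 2 ^ k dvd int n - int i} \<subseteq>
        {n \<in> T. 2 ^ Suc k dvd int n - int i} \<union> {n \<in> T. 2 ^ Suc k dvd int n - int (i + 2 ^ k)}"
    proof
      fix n assume "n \<in> {n \<in> T. 2 ^ k dvd int n - int i}"
      then obtain q where q: "int n - int i = 2 ^ k * q" "n \<in> T" by (auto elim: dvdE)
      then have "int n - int (i + 2 ^ k) = 2 ^ k * (q - 1)" by (simp add: algebra_simps)
      moreover have "even q \<or> even (q - 1)" by simp
      ultimately have "2 ^ k * 2 dvd int n - int i \<or> 2 ^ k * 2 dvd int n - int (i + 2 ^ k)"
        using q(1) mult_dvd_mono[OF dvd_refl, of 2 _ "2 ^ k"] by metis
      then show "n \<in> {n \<in> T. 2 ^ Suc k dvd int n - int i} \<union> {n \<in> T. 2 ^ Suc k dvd int n - int (i + 2 ^ k)}"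
        using q(2) by (simp add: mult.commute)
    qed
    then have "infinite {n \<in> T. 2 ^ Suc k dvd int n - int i} \<or> infinite {n \<in> T. 2 ^ Suc k dvd int n - int (i + 2 ^ k)}"
      using i by (auto dest: finite_subset)
    then show "\<exists>i'. ?P (Suc k) i' \<and> 2 ^ k dvd int i' - int i"
    proof
      assume "infinite {n \<in> T. 2 ^ Suc k dvd int n - int i}"
      then show ?thesis using i by (intro exI[of _ i]) simp
    next
      assume "infinite {n \<in> T. 2 ^ Suc k dvd int n - int (i + 2 ^ k)}"
      then show ?thesis using i by (intro exI[of _ "i + 2 ^ k"]) simp
    qed
  qed
  then show thesis using that by blast
qed

lemma (in orbit) real_hull_residue_limit_nested:
  assumes "2 ^ k dvd int j - int i"
  shows "real_hull (residue_limit X (2 ^ Suc k) j) \<subseteq> real_hull (residue_limit X (2 ^ k) i)"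
proof (rule real_hull_mono)
  have "residue_limit X (2 ^ k) j = residue_limit X (2 ^ k) i" using assms by (intro residue_limit_cong) simp
  then show "residue_limit X (2 ^ Suc k) j \<subseteq> residue_limit X (2 ^ k) i"
    using residue_limit_antimono[of "2 ^ k" "2 ^ Suc k" X j] by simp
  show "residue_limit X (2 ^ Suc k) j \<noteq> {}" by (rule residue_limit_nonempty[OF bdd]) simp
  show "bounded (residue_limit X (2 ^ k) i)" by (rule compact_imp_bounded[OF compact_residue_limit[OF bdd]])
qed

theorem scrambled_imp_nonseparable:
  assumes hf: "horseshoe_free f" and xy: "x \<in> unitI" "y \<in> unitI"
    and prox: "\<And>e N. e > 0 \<Longrightarrow> \<exists>n\<ge>N. \<bar>(f ^^ n) x - (f ^^ n) y\<bar> < e"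
    and asym: "\<not> asymptotic f x y"
  shows "\<exists>u v. nonseparable_pair f u v"
proof -
  define X where "X n = (f ^^ n) x" for n
  define Y where "Y n = (f ^^ n) y" for n
  have X0: "X 0 = x" and Y0: "Y 0 = y" unfolding X_def Y_def by simp_all
  interpret X: orbit f X unfolding X_def by (rule horseshoe_free_orbit[OF hf])
  interpret Y: orbit f Y unfolding Y_def by (rule horseshoe_free_orbit[OF hf])
  interpret proximal_orbits f X Y by unfold_locales (use prox in \<open>simp add: X_def Y_def\<close>)
  have "infinite (residue_limit X 1 0) \<or> infinite (residue_limit Y 1 0)"
    using finite_limits_asymptotic asym unfolding asymptotic_def X_def Y_def by blast
  then have infX: "infinite (residue_limit X 1 0)" and infY: "infinite (residue_limit Y 1 0)"
    using infinite_limit_both[OF hf] proximal_orbits.infinite_limit_both[OF swap hf] by blast+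
  obtain d where d: "d > 0" "\<And>N. \<exists>n\<ge>N. d \<le> \<bar>X n - Y n\<bar>"
    using asym unfolding asymptotic_def LIMSEQ_iff X_def Y_def by (auto simp: not_less)
  have "infinite {n. d \<le> \<bar>X n - Y n\<bar>}" unfolding infinite_nat_iff_unbounded_le using d(2) by blast
  then obtain ik where ik: "\<And>k. ik k < 2 ^ k"
    "\<And>k. infinite {n \<in> {n. d \<le> \<bar>X n - Y n\<bar>}. 2 ^ k dvd int n - int (ik k)}"
    "\<And>k. 2 ^ k dvd int (ik (Suc k)) - int (ik k)"
    by (rule nested_address) blast
  have bR: "bounded (residue_limit X m i)" "bounded (residue_limit Y m i)" for m i
    using X.bdd Y.bdd by (auto intro: compact_imp_bounded compact_residue_limit)
  have neR: "residue_limit X (2 ^ k) i \<noteq> {}" "residue_limit Y (2 ^ k) i \<noteq> {}" for k i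
    by (rule residue_limit_nonempty[OF X.bdd], simp, rule residue_limit_nonempty[OF Y.bdd], simp)
  define JX where "JX k = residue_limit X (2 ^ k) (ik k)" for k
  define JY where "JY k = residue_limit Y (2 ^ k) (ik k)" for k
  have far: "\<exists>a\<in>JX k. \<exists>b\<in>JY k. d \<le> \<bar>a - b\<bar>" for k
  proof -
    have "bounded (range (\<lambda>n. (X n, Y n)))"
      by (rule bounded_subset[OF bounded_Times[OF X.bdd Y.bdd]]) auto
    then obtain r w where r: "strict_mono r"
      "\<And>j. r j \<in> {n \<in> {n. d \<le> \<bar>X n - Y n\<bar>}. 2 ^ k dvd int n - int (ik k)}" "(\<lambda>j. (X (r j), Y (r j))) \<longlonglongrightarrow> w"
      using bounded_convergent_subsequence_in[OF _ ik(2)[of k], of "\<lambda>n. (X n, Y n)"] by blast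
    have lim: "(\<lambda>j. X (r j)) \<longlonglongrightarrow> fst w" "(\<lambda>j. Y (r j)) \<longlonglongrightarrow> snd w"
      using tendsto_fst[OF r(3)] tendsto_snd[OF r(3)] by simp_all
    have "infinite {j. int (2 ^ k) dvd int (r j) - int (ik k)}" using r(2) by simp
    then have "fst w \<in> JX k" "snd w \<in> JY k"
      unfolding JX_def JY_def using residue_limit_subseqI[OF r(1) lim(1)] residue_limit_subseqI[OF r(1) lim(2)] by blast+
    moreover have "d \<le> \<bar>fst w - snd w\<bar>"
    proof (rule LIMSEQ_le_const)
      show "(\<lambda>j. \<bar>X (r j) - Y (r j)\<bar>) \<longlonglongrightarrow> \<bar>fst w - snd w\<bar>" by (intro tendsto_intros lim)
      show "\<exists>N. \<forall>n\<ge>N. d \<le> \<bar>X (r n) - Y (r n)\<bar>" using r(2) by blast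
    qed
    ultimately show ?thesis by blast
  qed
  have nestX: "real_hull (JX (Suc k)) \<subseteq> real_hull (JX k)" and nestY: "real_hull (JY (Suc k)) \<subseteq> real_hull (JY k)" for k
    unfolding JX_def JY_def using X.real_hull_residue_limit_nested Y.real_hull_residue_limit_nested ik(3) by blast+
  have le: "Inf (JX k) \<le> Sup (JX k)" "Inf (JY k) \<le> Sup (JY k)" for k
    unfolding JX_def JY_def using neR bR
    by (auto intro!: cInf_le_cSup bounded_imp_bdd_above bounded_imp_bdd_below)
  have ends: "Inf A \<le> Inf B \<and> Sup B \<le> Sup A" if "real_hull B \<subseteq> real_hull A" "Inf B \<le> Sup B" for A B
    using that unfolding real_hull_def by simp
  obtain u v where X1: "u \<le> v" "(\<lambda>k. Inf (JX k)) \<longlonglongrightarrow> u" "(\<lambda>k. Sup (JX k)) \<longlonglongrightarrow> v"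
    "(\<Inter>k\<in>{1..}. {Inf (JX k)..Sup (JX k)}) = {u..v}"
    by (rule nested_Icc_limits[of "\<lambda>k. Inf (JX k)" "\<lambda>k. Sup (JX k)"]) (use ends[OF nestX le(1)] le in auto)
  obtain u' v' where Y1: "u' \<le> v'" "(\<lambda>k. Inf (JY k)) \<longlonglongrightarrow> u'" "(\<lambda>k. Sup (JY k)) \<longlonglongrightarrow> v'"
    "(\<Inter>k\<in>{1..}. {Inf (JY k)..Sup (JY k)}) = {u'..v'}"
    by (rule nested_Icc_limits[of "\<lambda>k. Inf (JY k)" "\<lambda>k. Sup (JY k)"]) (use ends[OF nestY le(2)] le in auto)
  \<comment> \<open>The two hulls share the point \<open>w\<close> and contain points at distance
    \<open>d\<close>, so their lengths add up to at least \<open>d\<close>; this bound survives the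
    limit over \<open>k\<close>.\<close>
  have "d \<le> (Sup (JX k) - Inf (JX k)) + (Sup (JY k) - Inf (JY k))" for k
  proof -
    obtain a b where ab: "a \<in> JX k" "b \<in> JY k" "d \<le> \<bar>a - b\<bar>" using far[of k] by blast
    obtain w where w: "w \<in> JX k" "w \<in> JY k" unfolding JX_def JY_def using residue_limits_meet[of "2 ^ k" "ik k"] by auto
    have "{a, w} \<subseteq> real_hull (JX k)" "{b, w} \<subseteq> real_hull (JY k)"
      using ab w subset_real_hull[OF bR(1), of "2 ^ k" "ik k"] subset_real_hull[OF bR(2), of "2 ^ k" "ik k"]
      unfolding JX_def JY_def by blast+
    then show ?thesis using ab(3) unfolding real_hull_def by auto
  qed
  then have "d \<le> (v - u) + (v' - u')"
    by (intro LIMSEQ_le_const[OF tendsto_add[OF tendsto_diff[OF X1(3,2)] tendsto_diff[OF Y1(3,2)]]]) auto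
  then have "u < v \<or> u' < v'" using d(1) X1(1) Y1(1) by linarith
  then show ?thesis
  proof
    assume "u < v"
    moreover have pp: "periodic_portion f x k (ik k) = real_hull (JX k)" for k
      unfolding periodic_portion_eq JX_def X_def ..
    moreover have "nested_sequence f x ik" unfolding nested_sequence_def pp using ik(1) nestX by blast
    moreover have "infinite (omega_limit f x)" using infX X.omega_limit_orbit X0 by simp
    moreover have "(\<Inter>k\<in>{1..}. periodic_portion f x k (ik k)) = {min u v..max u v}"
      unfolding pp real_hull_def using X1(1,4) by (simp add: min_absorb1 max_absorb2)
    ultimately have "nonseparable_pair f u v"
      unfolding nonseparable_pair_def using xy(1) by blast
    then show ?thesis by blast
  next
    assume "u' < v'"
    moreover have pp: "periodic_portion f y k (ik k) = real_hull (JY k)" for k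
      unfolding periodic_portion_eq JY_def Y_def ..
    moreover have "nested_sequence f y ik" unfolding nested_sequence_def pp using ik(1) nestY by blast
    moreover have "infinite (omega_limit f y)" using infY Y.omega_limit_orbit Y0 by simp
    moreover have "(\<Inter>k\<in>{1..}. periodic_portion f y k (ik k)) = {min u' v'..max u' v'}"
      unfolding pp real_hull_def using Y1(1,4) by (simp add: min_absorb1 max_absorb2)
    ultimately have "nonseparable_pair f u' v'"
      unfolding nonseparable_pair_def using xy(2) by blast
    then show ?thesis by blast
  qed
qed

subsection \<open>Covering relations around a nonseparable pair\<close>

lemma real_hull_uminus: "real_hull (uminus ` S) = uminus ` real_hull S"
proof -
  have "Inf (uminus ` S) = - Sup S" unfolding Inf_real_def by (simp add: image_image)
  moreover have "Sup (uminus ` S) = - Inf S" unfolding Inf_real_def by simp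
  ultimately show ?thesis unfolding real_hull_def by simp
qed

lemma residue_limit_uminus: "residue_limit (\<lambda>n. - X n) m i = uminus ` residue_limit X m i"
proof -
  have "w \<in> residue_limit (\<lambda>n. - X n) m i \<longleftrightarrow> - w \<in> residue_limit X m i" for w
  proof -
    have "\<bar>- X n - w\<bar> = \<bar>X n - (- w)\<bar>" for n by arith
    then show ?thesis unfolding residue_limit_def by simp
  qed
  moreover have "w \<in> uminus ` S \<longleftrightarrow> - w \<in> S" for w and S :: "real set" by force
  ultimately show ?thesis by (intro set_eqI) simp
qed

lemma nat_two_power_odd:
  assumes "j > (0::nat)"
  obtains r q where "j = 2 ^ r * q" "odd q"
  using assms
proof (induction j arbitrary: thesis rule: less_induct)
  case (less j)
  show ?case
  proof (cases "even j")
    case True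
    then obtain i where i: "j = 2 * i" by (elim evenE)
    then obtain r q where "i = 2 ^ r * q" "odd q" using less.IH[of i] less.prems(2) by auto
    then show ?thesis using i less.prems(1)[of "Suc r" q] by simp
  next
    case False
    then show ?thesis using less.prems(1)[of 0 j] by simp
  qed
qed

context orbit
begin

text \<open>The hull of orbit points, not of their limits, so that late points of the class are
  themselves available as elements of an interval.\<close>

definition tail_hull :: "nat \<Rightarrow> nat \<Rightarrow> nat \<Rightarrow> real set" where
  "tail_hull k i m = real_hull (X ` {n. 2 ^ k dvd int n - int i \<and> n \<ge> m})"

lemma tail_nonempty: "X ` {n. 2 ^ k dvd int n - int i \<and> n \<ge> m} \<noteq> {}"
proof -
  have "i + 2 ^ k * m \<in> {n. 2 ^ k dvd int n - int i \<and> n \<ge> m}"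
    using mult_le_mono1[of 1 "2 ^ k" m] by (simp add: trans_le_add2)
  then show ?thesis by blast
qed

lemma tail_bounded: "bounded (X ` T)"
  by (rule bounded_subset[OF bdd]) auto

lemma tail_hull_compact_connected: "compact (tail_hull k i m)" "connected (tail_hull k i m)" "closed (tail_hull k i m)"
  unfolding tail_hull_def real_hull_def by simp_all

lemma tail_hull_least:
  assumes "closed C" "connected C" "\<And>n. 2 ^ k dvd int n - int i \<Longrightarrow> n \<ge> m \<Longrightarrow> X n \<in> C"
  shows "tail_hull k i m \<subseteq> C"
  unfolding tail_hull_def using assms by (intro real_hull_subset tail_nonempty tail_bounded) auto

lemma in_tail_hull: "2 ^ k dvd int n - int i \<Longrightarrow> n \<ge> m \<Longrightarrow> X n \<in> tail_hull k i m"
  unfolding tail_hull_def by (rule subset_real_hull[OF tail_bounded, THEN subsetD]) blast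

lemma tail_hull_cong: "2 ^ k dvd int i - int j \<Longrightarrow> tail_hull k i m = tail_hull k j m"
proof -
  assume a: "2 ^ k dvd int i - int j"
  have "2 ^ k dvd int n - int i \<longleftrightarrow> 2 ^ k dvd int n - int j" for n
    using dvd_add_right_iff[OF a, of "int n - int i"] by simp
  then show ?thesis unfolding tail_hull_def by simp
qed

lemma tail_hull_antimono: "k \<le> k' \<Longrightarrow> m \<le> m' \<Longrightarrow> tail_hull k' i m' \<subseteq> tail_hull k i m"
  by (rule tail_hull_least[OF tail_hull_compact_connected(3,2)], rule in_tail_hull)
    (auto intro: dvd_trans[OF le_imp_power_dvd])

lemma residue_limit_subset_tail_hull: "residue_limit X (2 ^ k) i \<subseteq> tail_hull k i m"
  by (rule residue_limit_subset_closed[OF tail_hull_compact_connected(3), of m]) (simp add: in_tail_hull)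

text \<open>The image of \<open>C\<close> is a closed interval containing all points of the shifted
  class from time \<open>m + t\<close> on. Coverings of tail hulls are obtained from this shift of
  residues.\<close>

lemma funpow_tail_hull:
  assumes C: "compact C" "connected C" "tail_hull k i m \<subseteq> C"
  shows "tail_hull k (i + t) (m + t) \<subseteq> (f ^^ t) ` C"
proof (rule tail_hull_least)
  have ct: "continuous_on C (f ^^ t)" by (rule continuous_on_subset[OF continuous_on_funpow[OF cont]]) simp
  show "closed ((f ^^ t) ` C)" by (rule compact_imp_closed[OF compact_continuous_image[OF ct C(1)]])
  show "connected ((f ^^ t) ` C)" by (rule connected_continuous_image[OF ct C(2)])
  fix n assume n: "2 ^ k dvd int n - int (i + t)" "n \<ge> m + t"
  have "int (n - t) - int i = int n - int (i + t)" using n(2) by simp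
  then have "2 ^ k dvd int (n - t) - int i" using n(1) by (simp only:)
  then have "X (n - t) \<in> C" using in_tail_hull[of k "n - t" i m] n(2) C(3) by auto
  then show "X n \<in> (f ^^ t) ` C" using n(2) by (intro image_eqI[of _ _ "X (n - t)"]) (auto simp: funpow_orbit)
qed

lemma tail_hull_eventually:
  assumes "residue_limit X (2 ^ k) i \<subseteq> {p<..<q}"
  shows "\<exists>m. tail_hull k i m \<subseteq> {p..q}"
proof -
  obtain m where m: "\<forall>n\<ge>m. int (2 ^ k) dvd int n - int i \<longrightarrow> X n \<in> {p<..<q}"
    using residue_limit_eventually[OF _ assms] by auto
  have "tail_hull k i m \<subseteq> {p..q}" by (rule tail_hull_least) (use m in \<open>auto simp: less_imp_le\<close>)
  then show ?thesis by blast
qed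

end

section \<open>A nested sequence with nondegenerate intersection\<close>

locale addressed = solenoid f X for f X +
  fixes a :: "nat \<Rightarrow> nat" and u v :: real
  assumes addr: "\<And>k. 2 ^ k dvd int (a (Suc k)) - int (a k)"
    and uv: "u < v"
    and inter: "(\<Inter>k\<in>{1..}. real_hull (residue_limit X (2 ^ k) (a k))) = {u..v}"
begin

definition W :: "nat \<Rightarrow> real set" where "W k = residue_limit X (2 ^ k) (a k)"

text \<open>The sibling of \<open>W (Suc k)\<close>: the other half of the residue class that
  belongs to \<open>W k\<close>.\<close>

definition S :: "nat \<Rightarrow> real set" where "S k = residue_limit X (2 ^ Suc k) (a (Suc k) + 2 ^ k)"

definition H :: "nat \<Rightarrow> nat \<Rightarrow> real set" where "H k m = tail_hull k (a k) m"

text \<open>With a third of the length, the parts \<open>A\<close> and \<open>B\<close> below are at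
  distance at least \<open>gap\<close>, which becomes the scrambling constant.\<close>

definition gap :: real where "gap = (v - u) / 3"

definition A :: "nat \<Rightarrow> nat \<Rightarrow> real set" where "A k m = H k m \<inter> {..u + gap}"

definition B :: "nat \<Rightarrow> nat \<Rightarrow> real set" where "B k m = H k m \<inter> {v - gap..}"

lemma gap: "gap > 0" "u + gap < v - gap" "v - gap - (u + gap) = gap"
  using uv unfolding gap_def by (simp_all add: field_simps)

lemma addr_le: "k \<le> k' \<Longrightarrow> 2 ^ k dvd int (a k') - int (a k)"
proof (induction rule: dec_induct)
  case (step n)
  have "(2::int) ^ k dvd 2 ^ n" using step by (simp add: le_imp_power_dvd)
  then have "2 ^ k dvd int (a (Suc n)) - int (a n)" using addr dvd_trans by blast
  from dvd_add[OF this step.IH] show ?case by simp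
qed simp

lemma W_nonempty: "W k \<noteq> {}" and W_bounded: "bounded (W k)" and W_closed: "closed (W k)"
  unfolding W_def
  by (rule residue_limit_nonempty[OF bdd], simp, rule compact_imp_bounded[OF compact_residue_limit[OF bdd]],
      rule closed_residue_limit)

lemma W_antimono: "k \<le> k' \<Longrightarrow> W k' \<subseteq> W k"
proof -
  assume k: "k \<le> k'"
  have "residue_limit X (2 ^ k) (a k') = W k" unfolding W_def by (rule residue_limit_cong) (simp add: addr_le[OF k])
  then show ?thesis unfolding W_def using residue_limit_antimono[of "2 ^ k" "2 ^ k'" X "a k'"] k by (simp add: le_imp_power_dvd)
qed

text \<open>The extreme points of \<open>W j\<close> converge to \<open>u\<close> and
  \<open>v\<close>, and for \<open>j \<ge> k\<close> they belong to the closed set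
  \<open>W k\<close>.\<close>

lemma endpoints_in_W: "u \<in> W k" "v \<in> W k"
proof -
  have h: "real_hull (W (Suc k)) \<subseteq> real_hull (W k)" for k
    by (rule real_hull_mono[OF W_nonempty W_antimono W_bounded]) simp
  have le: "Inf (W k) \<le> Sup (W k)" for k
    using W_nonempty W_bounded by (auto intro!: cInf_le_cSup bounded_imp_bdd_above bounded_imp_bdd_below)
  obtain u' v' where u': "u' \<le> v'" "(\<lambda>k. Inf (W k)) \<longlonglongrightarrow> u'" "(\<lambda>k. Sup (W k)) \<longlonglongrightarrow> v'"
    "(\<Inter>k\<in>{1..}. {Inf (W k)..Sup (W k)}) = {u'..v'}"
    by (rule nested_Icc_limits[of "\<lambda>k. Inf (W k)" "\<lambda>k. Sup (W k)"]) (use h le in \<open>auto simp: real_hull_def\<close>)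
  have "{u'..v'} = {u..v}" using u'(4) inter unfolding W_def real_hull_def by simp
  then have e: "u' = u" "v' = v" using u'(1) uv by (auto simp: Icc_eq_Icc)
  have ends: "Inf (W (j + k)) \<in> W k" "Sup (W (j + k)) \<in> W k" for j
    using closed_contains_Inf[OF W_nonempty _ W_closed, of "j + k"] closed_contains_Sup[OF W_nonempty _ W_closed, of "j + k"]
      W_antimono[of k "j + k"] bounded_imp_bdd_above[OF W_bounded] bounded_imp_bdd_below[OF W_bounded] by auto
  show "u \<in> W k" "v \<in> W k"
    using closed_sequentially[OF W_closed, of "\<lambda>j. Inf (W (j + k))" k u] LIMSEQ_ignore_initial_segment[OF u'(2), of k]
      closed_sequentially[OF W_closed, of "\<lambda>j. Sup (W (j + k))" k v] LIMSEQ_ignore_initial_segment[OF u'(3), of k] ends e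
    by auto
qed

lemma H_interval: "compact (H k m)" "connected (H k m)" "closed (H k m)"
  unfolding H_def by (rule tail_hull_compact_connected)+

lemma A_B_interval: "compact (A k m)" "connected (A k m)" "compact (B k m)" "connected (B k m)"
proof -
  have "{x..y} \<inter> {..c} = {x..min y c}" "{x..y} \<inter> {c..} = {max x c..y}" for x y c :: real by auto
  then show "compact (A k m)" "connected (A k m)" "compact (B k m)" "connected (B k m)"
    unfolding A_def B_def H_def tail_hull_def real_hull_def by simp_all
qed

lemma W_subset_H: "W k \<subseteq> H k m"
  unfolding W_def H_def by (rule residue_limit_subset_tail_hull)

lemma H_antimono: "k \<le> k' \<Longrightarrow> m \<le> m' \<Longrightarrow> H k' m' \<subseteq> H k m"
  unfolding H_def using tail_hull_antimono[of k k' m m' "a k'"] tail_hull_cong[OF addr_le[of k k'], of m] by simp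

lemma in_H: "2 ^ k dvd int n - int (a k) \<Longrightarrow> n \<ge> m \<Longrightarrow> X n \<in> H k m"
  unfolding H_def by (rule in_tail_hull)

lemma sibling_good: "k \<le> p \<Longrightarrow> 2 ^ Suc p dvd int n - int (a (Suc p) + 2 ^ p) \<Longrightarrow> 2 ^ k dvd int n - int (a k)"
proof -
  assume k: "k \<le> p" and n: "2 ^ Suc p dvd int n - int (a (Suc p) + 2 ^ p)"
  have "2 ^ k dvd int n - int (a (Suc p) + 2 ^ p)" using dvd_trans[OF le_imp_power_dvd[of k "Suc p"] n] k by simp
  moreover have "(2::int) ^ k dvd 2 ^ p" using k by (simp add: le_imp_power_dvd)
  moreover have "2 ^ k dvd int (a (Suc p)) - int (a k)" using addr_le[of k "Suc p"] k by simp
  ultimately have "2 ^ k dvd (int n - int (a (Suc p) + 2 ^ p)) + 2 ^ p + (int (a (Suc p)) - int (a k))"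
    by (intro dvd_add)
  then show ?thesis by (simp add: algebra_simps)
qed

definition left_at :: "nat \<Rightarrow> bool" where
  "left_at p \<longleftrightarrow> (\<exists>z. (\<forall>s\<in>S p. s < z) \<and> (\<forall>w\<in>W (Suc p). z < w))"

definition right_at :: "nat \<Rightarrow> bool" where
  "right_at p \<longleftrightarrow> (\<exists>z. (\<forall>s\<in>S p. z < s) \<and> (\<forall>w\<in>W (Suc p). w < z))"

lemma left_or_right: "left_at p \<or> right_at p"
proof -
  have "separated (W (Suc p)) (S p)"
    unfolding W_def S_def by (rule separated_siblings)
  then show ?thesis unfolding separated_def left_at_def right_at_def by blast
qed

text \<open>A left sibling lies below \<open>u\<close>, because \<open>u\<close> is in
  \<open>W (Suc p)\<close>. So late orbit points of its class lie below \<open>u + gap\<close>, and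
  they belong to the class of every level up to \<open>p\<close>.\<close>

lemma left_sibling_in_A:
  assumes "left_at p" "k \<le> p"
  shows "\<exists>m'. tail_hull (Suc p) (a (Suc p) + 2 ^ p) m' \<subseteq> A k m"
proof -
  obtain z where z: "\<forall>s\<in>S p. s < z" "\<forall>w\<in>W (Suc p). z < w" using assms(1) unfolding left_at_def by blast
  have zu: "z < u" using z(2) endpoints_in_W(1) by blast
  have "residue_limit X (2 ^ Suc p) (a (Suc p) + 2 ^ p) \<subseteq> {..<z}" using z(1) unfolding S_def by blast
  then obtain m1 where m1: "\<forall>n\<ge>m1. int (2 ^ Suc p) dvd int n - int (a (Suc p) + 2 ^ p) \<longrightarrow> X n \<in> {..<z}"
    using residue_limit_eventually[OF open_lessThan] by blast
  have "tail_hull (Suc p) (a (Suc p) + 2 ^ p) (max m m1) \<subseteq> A k m"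
  proof (rule tail_hull_least[OF compact_imp_closed[OF A_B_interval(1)] A_B_interval(2)])
    fix n assume n: "2 ^ Suc p dvd int n - int (a (Suc p) + 2 ^ p)" "n \<ge> max m m1"
    then have "X n < z" using m1 by auto
    moreover have "X n \<in> H k m" using n by (intro in_H sibling_good[OF assms(2)]) auto
    ultimately show "X n \<in> A k m" unfolding A_def using zu gap(1) by auto
  qed
  then show ?thesis by blast
qed

text \<open>Adding an odd multiple of \<open>2 ^ p\<close> turns the residue of the sibling into
  that of the address modulo \<open>2 ^ Suc p\<close>.\<close>

lemma left_A_covers:
  assumes "left_at p" "k \<le> p" "odd q" "N = 2 ^ p * q"
  shows "\<exists>m'. H (Suc p) m' \<subseteq> (f ^^ N) ` A k m"
proof -
  obtain m1 where m1: "tail_hull (Suc p) (a (Suc p) + 2 ^ p) m1 \<subseteq> A k m"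
    using left_sibling_in_A[OF assms(1,2)] by blast
  have "tail_hull (Suc p) (a (Suc p) + 2 ^ p + N) (m1 + N) \<subseteq> (f ^^ N) ` A k m"
    by (rule funpow_tail_hull[OF A_B_interval(1,2) m1])
  moreover have "tail_hull (Suc p) (a (Suc p) + 2 ^ p + N) (m1 + N) = H (Suc p) (m1 + N)"
    unfolding H_def
  proof (rule tail_hull_cong)
    have "int (a (Suc p) + 2 ^ p + N) - int (a (Suc p)) = 2 ^ p * (1 + int q)"
      unfolding assms(4) by (simp add: algebra_simps)
    moreover have "2 ^ p * 2 dvd (2 ^ p * (1 + int q))" using assms(3) by (intro mult_dvd_mono) auto
    ultimately show "2 ^ Suc p dvd int (a (Suc p) + 2 ^ p + N) - int (a (Suc p))" by (simp add: mult.commute)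
  qed
  ultimately show ?thesis by blast
qed

lemma funpow_W_sibling:
  assumes "w \<in> W (Suc r)" "odd q" "j = 2 ^ r * q"
  shows "(f ^^ j) w \<in> S r"
proof -
  have "(f ^^ j) w \<in> residue_limit X (2 ^ Suc r) (a (Suc r) + j)"
    using assms(1) unfolding W_def by (rule funpow_residue_limit)
  moreover have "residue_limit X (2 ^ Suc r) (a (Suc r) + j) = S r"
    unfolding S_def
  proof (rule residue_limit_cong)
    have "int (a (Suc r) + j) - int (a (Suc r) + 2 ^ r) = 2 ^ r * (int q - 1)"
      unfolding assms(3) by (simp add: algebra_simps)
    moreover have "2 ^ r * 2 dvd (2 ^ r * (int q - 1))" using assms(2) by (intro mult_dvd_mono) auto
    ultimately show "int (2 ^ Suc r) dvd int (a (Suc r) + j) - int (a (Suc r) + 2 ^ r)" by (simp add: mult.commute)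
  qed
  ultimately show ?thesis by simp
qed

text \<open>In the mirror image \<open>A\<close> and \<open>B\<close>, and left and right siblings,
  change places.\<close>

lemma reflected: "addressed (reflect f) (\<lambda>n. - X n) a (- v) (- u)"
proof unfold_locales
  show "continuous_on UNIV (reflect f)" by (rule horseshoe_freeD(1)[OF horseshoe_free_reflect[OF hf]])
  have "range (\<lambda>n. - X n) = uminus ` range X" by auto
  then show "bounded (range (\<lambda>n. - X n))" using bdd by (simp add: bounded_uminus)
  show "- X (Suc n) = reflect f (- X n)" for n by (simp add: reflect_def step)
  show "horseshoe_free (reflect f)" by (rule horseshoe_free_reflect[OF hf])
  show "infinite (residue_limit (\<lambda>n. - X n) 1 0)"
    unfolding residue_limit_uminus using inf by (simp add: finite_image_iff inj_on_def)
  show "2 ^ k dvd int (a (Suc k)) - int (a k)" for k by (rule addr)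
  show "- v < - u" using uv by simp
  have "real_hull (residue_limit (\<lambda>n. - X n) (2 ^ k) (a k)) = uminus ` real_hull (W k)" for k
    unfolding residue_limit_uminus W_def[symmetric] by (rule real_hull_uminus)
  then have "(\<Inter>k\<in>{1..}. real_hull (residue_limit (\<lambda>n. - X n) (2 ^ k) (a k))) = (\<Inter>k\<in>{1..}. uminus ` real_hull (W k))"
    by simp
  also have "\<dots> = uminus ` (\<Inter>k\<in>{1..}. real_hull (W k))"
    by (subst image_INT[of uminus UNIV]) (auto simp: inj_on_def)
  also have "\<dots> = {- v..- u}" using inter unfolding W_def by simp
  finally show "(\<Inter>k\<in>{1..}. real_hull (residue_limit (\<lambda>n. - X n) (2 ^ k) (a k))) = {- v..- u}" .
qed

end

context addressed
begin

text \<open>After \<open>2 ^ q\<close> steps the sibling inside \<open>B\<close> has moved to the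
  class of the address. For \<open>A\<close> the same time is a multiple of
  \<open>2 ^ Suc p\<close>: it keeps \<open>S p\<close> in place, left of \<open>W (Suc q)\<close>,
  while it sends \<open>u\<close> into \<open>S q\<close>, right of it. The image of
  \<open>A\<close> therefore straddles \<open>W (Suc q)\<close>.\<close>

lemma covers_if_both_sides:
  assumes p: "left_at p" "k \<le> p" and q: "right_at q" "p < q"
    and B: "tail_hull (Suc q) (a (Suc q) + 2 ^ q) m2 \<subseteq> B k m"
  shows "\<exists>k' m'. H k' m' \<subseteq> (f ^^ (2 ^ q)) ` A k m \<and> H k' m' \<subseteq> (f ^^ (2 ^ q)) ` B k m"
proof -
  let ?N = "2 ^ q :: nat"
  have "tail_hull (Suc q) (a (Suc q) + 2 ^ q + ?N) (m2 + ?N) \<subseteq> (f ^^ ?N) ` B k m"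
    by (rule funpow_tail_hull[OF A_B_interval(3,4) B])
  moreover have "tail_hull (Suc q) (a (Suc q) + 2 ^ q + ?N) (m2 + ?N) = H (Suc q) (m2 + ?N)"
    unfolding H_def by (rule tail_hull_cong) simp
  ultimately have HB: "H (Suc q) (m2 + ?N) \<subseteq> (f ^^ ?N) ` B k m" by simp
  obtain z where z: "\<forall>s\<in>S p. s < z" "\<forall>w\<in>W (Suc p). z < w" using p(1) unfolding left_at_def by blast
  obtain z' where z': "\<forall>s\<in>S q. z' < s" "\<forall>w\<in>W (Suc q). w < z'" using q(1) unfolding right_at_def by blast
  have conn: "connected ((f ^^ ?N) ` A k m)"
    by (intro connected_continuous_image A_B_interval horseshoe_freeD(3)[OF hf])
  obtain s where s: "s \<in> S p"
    unfolding S_def using residue_limit_nonempty[OF bdd, of "2 ^ Suc p"] by fastforce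
  obtain m1 where "tail_hull (Suc p) (a (Suc p) + 2 ^ p) m1 \<subseteq> A k m"
    using left_sibling_in_A[OF p] by blast
  then have "S p \<subseteq> A k m" unfolding S_def using residue_limit_subset_tail_hull by blast
  then have "(f ^^ ?N) s \<in> (f ^^ ?N) ` A k m" using s by blast
  moreover have "(f ^^ ?N) s \<in> S p"
  proof -
    have "(f ^^ ?N) s \<in> residue_limit X (2 ^ Suc p) (a (Suc p) + 2 ^ p + ?N)"
      using s unfolding S_def by (rule funpow_residue_limit)
    moreover have "residue_limit X (2 ^ Suc p) (a (Suc p) + 2 ^ p + ?N) = S p"
      unfolding S_def by (rule residue_limit_cong) (use q(2) in \<open>simp add: le_imp_power_dvd del: power_Suc\<close>)
    ultimately show ?thesis by simp
  qed
  ultimately obtain c0 where c0: "c0 \<in> (f ^^ ?N) ` A k m" "c0 < z" using z(1) by blast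
  have "u \<in> A k m" unfolding A_def using endpoints_in_W(1) W_subset_H gap(1) by auto
  moreover have "(f ^^ ?N) u \<in> S q" by (rule funpow_W_sibling[OF endpoints_in_W(1), of 1]) auto
  ultimately obtain c1 where c1: "c1 \<in> (f ^^ ?N) ` A k m" "z' < c1" using z'(1) by blast
  have "W (Suc q) \<subseteq> {z<..<z'}" using z(2) z'(2) W_antimono[of "Suc p" "Suc q"] q(2) by auto
  then obtain m3 where "H (Suc q) m3 \<subseteq> {z..z'}"
    unfolding W_def H_def using tail_hull_eventually by blast
  then have "H (Suc q) m3 \<subseteq> {c0..c1}" using c0(2) c1(2) by fastforce
  then have "H (Suc q) m3 \<subseteq> (f ^^ ?N) ` A k m" using connected_contains_Icc[OF conn c0(1) c1(1)] by blast
  then show ?thesis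
    using HB H_antimono[of "Suc q" "Suc q" _ "max m3 (m2 + ?N)"]
    by (meson max.cobounded1 max.cobounded2 order_refl order_trans)
qed

text \<open>No late sibling lies in \<open>B\<close>. Instead take two orbit points near
  \<open>v\<close> at times \<open>n\<close> and \<open>n'\<close> of the same class:
  \<open>f ^^ j\<close> with \<open>j = n' - n\<close> carries the first to the second, but sends
  \<open>v\<close> into a sibling on the left. So the image of \<open>B\<close> stretches over a set
  \<open>A (Suc r) m1\<close>, whose left sibling then covers a deeper hull.\<close>

lemma covers_if_always_left:
  assumes left: "\<And>p. p \<ge> p0 \<Longrightarrow> left_at p"
  shows "\<exists>N\<ge>1. \<exists>k' m'. H k' m' \<subseteq> (f ^^ N) ` A k m \<and> H k' m' \<subseteq> (f ^^ N) ` B k m"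
proof -
  define P where "P = max k p0"
  have near: "\<exists>n\<ge>N. 2 ^ P dvd int n - int (a P) \<and> \<bar>X n - v\<bar> < gap" for N
    using endpoints_in_W(2)[of P] gap(1) unfolding W_def residue_limit_def by auto
  obtain n where n: "n \<ge> m" "2 ^ P dvd int n - int (a P)" "\<bar>X n - v\<bar> < gap" using near by blast
  obtain n' where n': "n' \<ge> Suc n" "2 ^ P dvd int n' - int (a P)" "\<bar>X n' - v\<bar> < gap" using near by blast
  define j where "j = n' - n"
  have j: "j > 0" "n + j = n'" using n'(1) unfolding j_def by auto
  obtain r q where rq: "j = 2 ^ r * q" "odd q" using nat_two_power_odd[OF j(1)] by blast
  have "2 ^ P dvd int j"
    using dvd_diff[OF n'(2) n(2)] unfolding j(2)[symmetric] by simp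
  have "P \<le> r"
  proof (rule ccontr)
    assume "\<not> P \<le> r"
    then have "(2::int) ^ Suc r dvd 2 ^ P" by (intro le_imp_power_dvd) simp
    then have "2 ^ Suc r dvd int j" using \<open>2 ^ P dvd int j\<close> dvd_trans by blast
    then have "2 ^ r * 2 dvd 2 ^ r * int q" unfolding rq(1) by (simp add: mult.commute)
    then have "2 dvd int q" by simp
    then show False using rq(2) by simp
  qed
  then have r: "k \<le> r" "p0 \<le> r" unfolding P_def by auto
  have XB: "X n \<in> B k m"
  proof -
    have "2 ^ k dvd int n - int (a P)" by (rule dvd_trans[OF _ n(2)]) (simp add: P_def le_imp_power_dvd)
    from dvd_add[OF this addr_le[of k P]] have "2 ^ k dvd int n - int (a k)" by (simp add: P_def)
    then show ?thesis unfolding B_def using in_H[of k n m] n(1,3) by (auto simp: abs_less_iff)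
  qed
  have vB: "v \<in> B k m" unfolding B_def using endpoints_in_W(2) W_subset_H gap(1) by auto
  obtain z where z: "\<forall>s\<in>S r. s < z" "\<forall>w\<in>W (Suc r). z < w" using left[OF r(2)] unfolding left_at_def by blast
  have c: "(f ^^ j) v < z" using funpow_W_sibling[OF endpoints_in_W(2) rq(2,1)] z(1) by blast
  have conn: "connected ((f ^^ j) ` B k m)"
    by (intro connected_continuous_image A_B_interval horseshoe_freeD(3)[OF hf])
  have sub: "{(f ^^ j) v..X n'} \<subseteq> (f ^^ j) ` B k m"
    using connected_contains_Icc[OF conn imageI[OF vB] imageI[OF XB]] j(2) by (simp add: funpow_orbit)
  have "W (Suc r) \<subseteq> {z<..<Sup (W (Suc r)) + 1}"
  proof
    fix w assume w: "w \<in> W (Suc r)"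
    then have "w \<le> Sup (W (Suc r))" by (intro cSup_upper bounded_imp_bdd_above W_bounded)
    then show "w \<in> {z<..<Sup (W (Suc r)) + 1}" using w z(2) by auto
  qed
  then obtain m1 where m1: "H (Suc r) m1 \<subseteq> {z..Sup (W (Suc r)) + 1}"
    unfolding W_def H_def using tail_hull_eventually by blast
  have "u + gap < X n'" using n'(3) gap(2) by (auto simp: abs_less_iff)
  then have "A (Suc r) m1 \<subseteq> {(f ^^ j) v..X n'}" using m1 c unfolding A_def by auto
  then have AB: "A (Suc r) m1 \<subseteq> (f ^^ j) ` B k m" using sub by blast
  define N' where "N' = (2::nat) ^ Suc r"
  define N where "N = N' + j"
  have "left_at (Suc r)" using left[of "Suc r"] r(2) by simp
  then obtain m2 where m2: "H (Suc (Suc r)) m2 \<subseteq> (f ^^ N') ` A (Suc r) m1"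
    using left_A_covers[of "Suc r" "Suc r" 1 N' m1] unfolding N'_def by auto
  have "(f ^^ N) ` B k m = (f ^^ N') ` ((f ^^ j) ` B k m)" unfolding N_def funpow_add by (simp add: image_comp)
  then have HB: "H (Suc (Suc r)) m2 \<subseteq> (f ^^ N) ` B k m"
    using order_trans[OF m2 image_mono[OF AB]] by simp
  \<comment> \<open>The total time for \<open>B\<close> is again an odd multiple of
    \<open>2 ^ r\<close>, so \<open>A k m\<close> covers at the same time.\<close>
  have "N = 2 ^ r * (q + 2)" unfolding N_def N'_def rq(1) by (simp add: algebra_simps)
  then obtain m3 where m3: "H (Suc r) m3 \<subseteq> (f ^^ N) ` A k m"
    using left_A_covers[OF left[OF r(2)] r(1), of "q + 2" N m] rq(2) by auto
  have "H (Suc (Suc r)) (max m2 m3) \<subseteq> (f ^^ N) ` A k m" "H (Suc (Suc r)) (max m2 m3) \<subseteq> (f ^^ N) ` B k m"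
    by (rule order_trans[OF H_antimono m3]; simp) (rule order_trans[OF H_antimono HB]; simp)
  moreover have "N \<ge> 1" unfolding N_def using j(1) by simp
  ultimately show ?thesis by blast
qed

theorem common_cover:
  "\<exists>N\<ge>1. \<exists>k' m'. H k' m' \<subseteq> (f ^^ N) ` A k m \<and> H k' m' \<subseteq> (f ^^ N) ` B k m"
proof -
  interpret R: addressed "reflect f" "\<lambda>n. - X n" a "- v" "- u" by (rule reflected)
  have th: "R.tail_hull k i m = uminus ` tail_hull k i m" for k i m
    unfolding R.tail_hull_def tail_hull_def real_hull_uminus[symmetric] image_image ..
  have H: "R.H k m = uminus ` H k m" for k m unfolding R.H_def H_def th ..
  have "R.gap = gap" unfolding R.gap_def gap_def by simp
  then have A: "R.A k m = uminus ` B k m" and B: "R.B k m = uminus ` A k m" for k m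
    unfolding R.A_def R.B_def A_def B_def H by (auto simp: image_iff minus_le_iff)
  have left: "R.left_at p" if "right_at p" for p
  proof -
    obtain z where z: "\<forall>s\<in>S p. z < s" "\<forall>w\<in>W (Suc p). w < z"
      using \<open>right_at p\<close> unfolding right_at_def by blast
    have "R.S p = uminus ` S p" "R.W (Suc p) = uminus ` W (Suc p)"
      unfolding R.S_def S_def R.W_def W_def residue_limit_uminus by simp_all
    then show ?thesis unfolding R.left_at_def using z by (intro exI[of _ "- z"]) auto
  qed
  have um: "uminus ` P \<subseteq> uminus ` Q \<longleftrightarrow> P \<subseteq> Q" for P Q :: "real set"
    by (rule inj_image_subset_iff) (simp add: inj_on_def)
  have im: "(reflect f ^^ N) ` uminus ` P = uminus ` (f ^^ N) ` P" for N P
    unfolding image_image reflect_funpow by simp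
  \<comment> \<open>If right siblings stop occurring, all late ones are left; if no left one occurs
    from \<open>k\<close> on, all of these are right.\<close>
  consider (both) "\<exists>p\<ge>k. left_at p" "\<And>p. \<exists>q>p. right_at q"
    | (left) p0 where "\<And>p. p \<ge> p0 \<Longrightarrow> left_at p"
    | (right) p0 where "\<And>p. p \<ge> p0 \<Longrightarrow> right_at p"
    using left_or_right by (metis less_imp_le less_Suc_eq_le not_le)
  then show ?thesis
  proof cases
    case both
    then obtain p q where p: "left_at p" "k \<le> p" and q: "right_at q" "p < q" by blast
    obtain m2 where "R.tail_hull (Suc q) (a (Suc q) + 2 ^ q) m2 \<subseteq> R.A k m"
      using R.left_sibling_in_A[OF left[OF q(1)], of k m] p q by auto
    then have "tail_hull (Suc q) (a (Suc q) + 2 ^ q) m2 \<subseteq> B k m" unfolding th A um .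
    from covers_if_both_sides[OF p q this] show ?thesis by (intro exI[of _ "2 ^ q"]) simp
  next
    case left
    then show ?thesis by (rule covers_if_always_left)
  next
    case right
    then have "\<exists>N\<ge>1. \<exists>k' m'. R.H k' m' \<subseteq> (reflect f ^^ N) ` R.A k m \<and> R.H k' m' \<subseteq> (reflect f ^^ N) ` R.B k m"
      using R.covers_if_always_left[of p0] left by blast
    then show ?thesis unfolding H A B im um by blast
  qed
qed

text \<open>The \<open>2 ^ K\<close> hulls are pairwise separated inside a bounded interval. If all
  had length at least \<open>h\<close>, their left endpoints would be \<open>h\<close> apart, and
  dividing by \<open>h\<close> and rounding down would inject \<open>2 ^ K\<close> indices into the
  fixed finite set \<open>C\<close>.\<close>

lemma short_residue_hull:
  assumes h: "h > 0"
  shows "\<exists>K\<ge>k. \<exists>i. Sup (residue_limit X (2 ^ K) i) - Inf (residue_limit X (2 ^ K) i) < h"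
proof (rule ccontr)
  assume no: "\<not> ?thesis"
  obtain M where M: "\<And>n. \<bar>X n\<bar> \<le> M" using bdd unfolding bounded_iff by auto
  define C where "C = {\<lfloor>- M / h\<rfloor>..\<lfloor>M / h\<rfloor>}"
  obtain K where K: "K \<ge> k" "card C < 2 ^ K"
  proof (rule that[of "max k (card C)"])
    show "card C < 2 ^ max k (card C)" by (rule less_le_trans[OF less_exp]) simp
  qed simp
  let ?R = "\<lambda>i. residue_limit X (2 ^ K) i"
  have ne: "?R i \<noteq> {}" for i by (rule residue_limit_nonempty[OF bdd]) simp
  have above: "bdd_above (?R i)" and below: "bdd_below (?R i)" for i
    by (rule bounded_imp_bdd_above bounded_imp_bdd_below,
        rule compact_imp_bounded[OF compact_residue_limit[OF bdd]])+
  have long: "Inf (?R i) + h \<le> Sup (?R i)" for i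
    using no K(1) by (auto simp: not_less algebra_simps)
  have sep: "h \<le> \<bar>Inf (?R i) - Inf (?R j)\<bar>" if ij: "i < 2 ^ K" "j < 2 ^ K" "i \<noteq> j" for i j
  proof -
    have ord: "Inf (?R i) + h \<le> Inf (?R j)" if "\<forall>s\<in>?R i. s < z" "\<forall>t\<in>?R j. z < t" for i j z
    proof -
      have "Sup (?R i) \<le> z" using that(1) ne by (intro cSup_least) (auto intro: less_imp_le)
      also have "z \<le> Inf (?R j)" using that(2) ne by (intro cInf_greatest) (auto intro: less_imp_le)
      finally show ?thesis using long[of i] by simp
    qed
    have "\<not> 2 ^ K dvd int i - int j"
    proof
      assume "2 ^ K dvd int i - int j"
      moreover have "int i - int j \<noteq> 0" using ij(3) by simp
      ultimately have "2 ^ K \<le> \<bar>int i - int j\<bar>" using dvd_imp_le_int[of "int i - int j" "2 ^ K"] by simp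
      moreover have "int i < 2 ^ K" "int j < 2 ^ K" using ij(1,2) by (metis of_nat_less_iff of_nat_numeral of_nat_power)+
      ultimately show False by linarith
    qed
    then have "separated (?R i) (?R j)" by (rule separated_residue_limits)
    then obtain z where "(\<forall>s\<in>?R i. s < z) \<and> (\<forall>t\<in>?R j. z < t) \<or> (\<forall>s\<in>?R i. z < s) \<and> (\<forall>t\<in>?R j. t < z)"
      unfolding separated_def by blast
    then have "Inf (?R i) + h \<le> Inf (?R j) \<or> Inf (?R j) + h \<le> Inf (?R i)" using ord by blast
    then show ?thesis by linarith
  qed
  have "card {..<2 ^ K :: nat} \<le> card C"
  proof (rule card_inj_on_le[of "\<lambda>i. \<lfloor>Inf (?R i) / h\<rfloor>"])
    show "inj_on (\<lambda>i. \<lfloor>Inf (?R i) / h\<rfloor>) {..<2 ^ K}"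
    proof (rule inj_onI, rule ccontr)
      fix i j assume ij: "i \<in> {..<2 ^ K}" "j \<in> {..<2 ^ K}" "\<lfloor>Inf (?R i) / h\<rfloor> = \<lfloor>Inf (?R j) / h\<rfloor>" "i \<noteq> j"
      then have "\<bar>Inf (?R i) / h - Inf (?R j) / h\<bar> < 1" by linarith
      then have "\<bar>Inf (?R i) - Inf (?R j)\<bar> < h" using h by (simp add: diff_divide_distrib[symmetric])
      then show False using sep[of i j] ij by simp
    qed
    show "(\<lambda>i. \<lfloor>Inf (?R i) / h\<rfloor>) ` {..<2 ^ K} \<subseteq> C"
    proof clarify
      fix i
      have "?R i \<subseteq> {-M..M}"
        by (rule residue_limit_subset_closed[of _ 0]) (use M in \<open>auto simp: abs_le_iff minus_le_iff\<close>)
      moreover have "Inf (?R i) \<in> ?R i" by (rule closed_contains_Inf[OF ne below closed_residue_limit])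
      ultimately have "- M \<le> Inf (?R i)" "Inf (?R i) \<le> M" by auto
      then have "- M / h \<le> Inf (?R i) / h" "Inf (?R i) / h \<le> M / h" using h by (intro divide_right_mono; simp)+
      then show "\<lfloor>Inf (?R i) / h\<rfloor> \<in> C" unfolding C_def atLeastAtMost_iff by (intro conjI floor_mono)
    qed
    show "finite C" unfolding C_def by simp
  qed
  then show False using K(2) by simp
qed

text \<open>The class of the address can be shifted to a class \<open>i\<close> with short hull, and
  on to its own residue again; \<open>G\<close> is a tail hull of class \<open>i\<close>.\<close>

theorem short_transit:
  assumes \<eta>: "\<eta> > 0"
  shows "\<exists>l t k' m' G. compact G \<and> connected G \<and> G \<subseteq> (f ^^ l) ` H k m \<and>
    (\<forall>p\<in>G. \<forall>q\<in>G. \<bar>p - q\<bar> \<le> \<eta>) \<and> H k' m' \<subseteq> (f ^^ t) ` G"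
proof -
  \<comment> \<open>One third bounds the hull of the limit set; the other two are the margins on
    both sides that catch the tail.\<close>
  have "\<eta> / 3 > 0" using \<eta> by simp
  then obtain K i where K: "K \<ge> k" and
    i: "Sup (residue_limit X (2 ^ K) i) - Inf (residue_limit X (2 ^ K) i) < \<eta> / 3"
    using short_residue_hull by blast
  let ?R = "residue_limit X (2 ^ K) i"
  have R: "bounded ?R" by (rule compact_imp_bounded[OF compact_residue_limit[OF bdd]])
  have "?R \<subseteq> {Inf ?R - \<eta> / 3<..<Sup ?R + \<eta> / 3}"
    using subset_real_hull[OF R] \<eta> unfolding real_hull_def by fastforce
  then obtain m1 where m1: "tail_hull K i m1 \<subseteq> {Inf ?R - \<eta> / 3..Sup ?R + \<eta> / 3}"
    using tail_hull_eventually by blast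
  have le: "c \<le> 2 ^ K * c" for c :: nat by simp
  \<comment> \<open>Chosen so that \<open>a K + l\<close> is congruent to \<open>i\<close> modulo
    \<open>2 ^ K\<close>; then \<open>t\<close> completes \<open>l\<close> to a multiple of
    \<open>2 ^ K\<close>.\<close>
  define l where "l = i + 2 ^ K * a K - a K"
  have l: "a K + l = i + 2 ^ K * a K" unfolding l_def using le[of "a K"] by linarith
  define t where "t = 2 ^ K * l - l"
  have t: "l + t = 2 ^ K * l" unfolding t_def using le[of l] by linarith
  define G where "G = tail_hull K i (max m1 (m + l))"
  have "tail_hull K (a K) m \<subseteq> H k m" using H_antimono[OF K, of m m] unfolding H_def by simp
  then have "tail_hull K (a K + l) (m + l) \<subseteq> (f ^^ l) ` H k m"
    by (rule funpow_tail_hull[OF H_interval(1,2)])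
  moreover have "tail_hull K (a K + l) (m + l) = tail_hull K i (m + l)"
    unfolding l by (rule tail_hull_cong) simp
  moreover have "G \<subseteq> tail_hull K i (m + l)" unfolding G_def by (rule tail_hull_antimono) simp_all
  ultimately have 1: "G \<subseteq> (f ^^ l) ` H k m" by simp
  have "G \<subseteq> tail_hull K i m1" unfolding G_def by (rule tail_hull_antimono) simp_all
  then have "G \<subseteq> {Inf ?R - \<eta> / 3..Sup ?R + \<eta> / 3}" using m1 by blast
  then have 2: "\<bar>p - q\<bar> \<le> \<eta>" if "p \<in> G" "q \<in> G" for p q
  proof -
    have "Inf ?R - \<eta> / 3 \<le> p" "p \<le> Sup ?R + \<eta> / 3" "Inf ?R - \<eta> / 3 \<le> q" "q \<le> Sup ?R + \<eta> / 3"
      using \<open>G \<subseteq> {Inf ?R - \<eta> / 3..Sup ?R + \<eta> / 3}\<close> that by auto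
    then show ?thesis using i by linarith
  qed
  have GI: "compact G" "connected G" unfolding G_def by (rule tail_hull_compact_connected)+
  have "tail_hull K (i + t) (max m1 (m + l) + t) \<subseteq> (f ^^ t) ` G"
    by (rule funpow_tail_hull[OF GI]) (simp add: G_def)
  moreover have "tail_hull K (i + t) (max m1 (m + l) + t) = H K (max m1 (m + l) + t)"
    unfolding H_def
  proof (rule tail_hull_cong)
    have "i + t + 2 ^ K * a K = a K + 2 ^ K * l" using l t by linarith
    from arg_cong[OF this, of int]
    have "int (i + t) - int (a K) = 2 ^ K * (int l - int (a K))" by (simp add: algebra_simps)
    then show "2 ^ K dvd int (i + t) - int (a K)" by simp
  qed
  ultimately have "H K (max m1 (m + l) + t) \<subseteq> (f ^^ t) ` G" by simp
  then show ?thesis using 1 2 GI by (intro exI conjI ballI) assumption+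
qed

end

subsection \<open>Scrambled Cantor sets\<close>

text \<open>Take the first point where \<open>d\<close> is attained and then the last point before
  it where \<open>c\<close> is attained. By the intermediate value theorem no value outside
  \<open>{c..d}\<close> occurs between them.\<close>

lemma subinterval_exact_image_aux:
  fixes g :: "real \<Rightarrow> real"
  assumes g: "continuous_on UNIV g" and pq: "p \<le> q" "g p = c" "g q = d" "c \<le> d"
  shows "\<exists>p' q'. p \<le> p' \<and> p' \<le> q' \<and> q' \<le> q \<and> g ` {p'..q'} = {c..d}"
proof -
  have gS: "continuous_on S g" for S using g by (rule continuous_on_subset) simp
  have level: "closed {s. g s = y}" for y by (rule closed_Collect_eq) (use g in auto)
  have ivt: "\<exists>s\<in>{a..b}. g s = y" if "a \<le> b" "min (g a) (g b) \<le> y" "y \<le> max (g a) (g b)" for a b y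
  proof (cases "g a \<le> g b")
    case True
    then show ?thesis using IVT'[of g a y b] that gS by auto
  next
    case False
    then show ?thesis using IVT2'[of g b y a] that gS by auto
  qed
  define Q where "Q = {p..q} \<inter> {s. g s = d}"
  have "compact Q" unfolding Q_def using level by (intro compact_Int_closed) auto
  moreover have "Q \<noteq> {}" unfolding Q_def using pq by auto
  ultimately obtain q' where "q' \<in> Q" and min: "\<forall>s\<in>Q. q' \<le> s" using compact_attains_inf by blast
  then have q': "q' \<in> {p..q}" "g q' = d" unfolding Q_def by auto
  have q'_min: "q' \<le> s" if "s \<in> {p..q}" "g s = d" for s using min that unfolding Q_def by blast
  define R where "R = {p..q'} \<inter> {s. g s = c}"
  have "compact R" unfolding R_def using level by (intro compact_Int_closed) auto
  moreover have "R \<noteq> {}" unfolding R_def using pq q' by auto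
  ultimately obtain p' where "p' \<in> R" and max: "\<forall>s\<in>R. s \<le> p'" using compact_attains_sup by blast
  then have p': "p' \<in> {p..q'}" "g p' = c" unfolding R_def by auto
  have p'_max: "s \<le> p'" if "s \<in> {p..q'}" "g s = c" for s using max that unfolding R_def by blast
  have "g ` {p'..q'} = {c..d}"
  proof
    show "{c..d} \<subseteq> g ` {p'..q'}"
    proof
      fix y assume "y \<in> {c..d}"
      then show "y \<in> g ` {p'..q'}" using ivt[of p' q' y] p' q' pq by auto
    qed
    show "g ` {p'..q'} \<subseteq> {c..d}"
    proof clarify
      fix s assume s: "s \<in> {p'..q'}"
      have "g s \<le> d"
      proof (rule ccontr)
        assume a: "\<not> g s \<le> d"
        then obtain r where r: "r \<in> {p'..s}" "g r = d" using ivt[of p' s d] s p'(2) pq(4) by auto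
        then have "q' \<le> r" using q'(1) q'_min[of r] s p'(1) by auto
        then have "r = s" using r s by auto
        then show False using r a by simp
      qed
      moreover have "c \<le> g s"
      proof (rule ccontr)
        assume a: "\<not> c \<le> g s"
        then obtain r where r: "r \<in> {s..q'}" "g r = c" using ivt[of s q' c] s q'(2) pq(4) by auto
        then have "r \<le> p'" using p'(1) p'_max[of r] s by auto
        then have "r = s" using r s by auto
        then show False using r a by simp
      qed
      ultimately show "g s \<in> {c..d}" by simp
    qed
  qed
  then show ?thesis using p' q' by (intro exI[of _ p'] exI[of _ q']) auto
qed

lemma compact_connected_real_eq_Icc:
  fixes C :: "real set"
  assumes "compact C" "connected C" "C \<noteq> {}"
  obtains c d where "c \<le> d" "C = {c..d}"
proof -
  have "C = {Inf C..Sup C}" "Inf C \<le> Sup C"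
    using closed_contains_Inf[of C] closed_contains_Sup[of C] connected_contains_Icc[of C "Inf C" "Sup C"] assms
      bounded_imp_bdd_above[of C] bounded_imp_bdd_below[of C] compact_imp_bounded[of C] compact_imp_closed[of C]
    by (auto intro: cInf_lower cSup_upper cInf_le_cSup)
  then show thesis using that by blast
qed

text \<open>Replacing a covering by an equality confines the orbit to the target set, and the
  smaller interval can be restricted again at a later time.\<close>

lemma subinterval_exact_image:
  fixes g :: "real \<Rightarrow> real"
  assumes g: "continuous_on UNIV g" and D: "connected D"
    and C: "compact C" "connected C" "C \<noteq> {}" "C \<subseteq> g ` D"
  obtains D' where "compact D'" "connected D'" "D' \<subseteq> D" "g ` D' = C"
proof -
  obtain c d where cd: "c \<le> d" "C = {c..d}" using compact_connected_real_eq_Icc[OF C(1-3)] by blast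
  have "c \<in> g ` D" "d \<in> g ` D" using cd C(4) by auto
  then obtain p q where pq: "p \<in> D" "q \<in> D" "g p = c" "g q = d" by blast
  show thesis
  proof (cases "p \<le> q")
    case True
    then obtain p' q' where p': "p \<le> p'" "q' \<le> q" "g ` {p'..q'} = {c..d}"
      using subinterval_exact_image_aux[OF g True pq(3,4) cd(1)] by blast
    have "{p'..q'} \<subseteq> D" using connected_contains_Icc[OF D pq(1,2)] p' by auto
    then show thesis using that[of "{p'..q'}"] p' cd(2) by simp
  next
    case False
    have "continuous_on UNIV (\<lambda>s. - g s)" using g by (intro continuous_intros)
    then obtain p' q' where p': "q \<le> p'" "q' \<le> p" "(\<lambda>s. - g s) ` {p'..q'} = {- d..- c}"
      using subinterval_exact_image_aux[of "\<lambda>s. - g s" q p "- d" "- c"] pq cd(1) False by auto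
    have "g ` {p'..q'} = uminus ` (\<lambda>s. - g s) ` {p'..q'}" by (simp add: image_image)
    also have "\<dots> = {c..d}" unfolding p'(3) by simp
    finally have "g ` {p'..q'} = {c..d}" .
    moreover have "{p'..q'} \<subseteq> D" using connected_contains_Icc[OF D pq(2,1)] p' by auto
    ultimately show thesis using that[of "{p'..q'}"] cd(2) by simp
  qed
qed

text \<open>The newest letter comes first, so that prolonging a code is a \<open>Cons\<close> and
  the tree \<open>node\<close> can be defined by primitive recursion.\<close>

fun word :: "(nat \<Rightarrow> bool) \<Rightarrow> nat \<Rightarrow> bool list" where
  "word \<alpha> 0 = []"
| "word \<alpha> (Suc k) = \<alpha> k # word \<alpha> k"

lemma length_word [simp]: "length (word \<alpha> k) = k"
  by (induction k) auto

lemma word_cong: "(\<And>i. i < k \<Longrightarrow> \<alpha> i = \<beta> i) \<Longrightarrow> word \<alpha> k = word \<beta> k"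
  by (induction k) auto

text \<open>Every value is attained infinitely often, so distinct \<open>\<gamma>\<close> yield codes \<open>\<gamma> \<circ> slot\<close> that differ
  infinitely often.\<close>

definition slot :: "nat \<Rightarrow> nat" where
  "slot k = fst (prod_decode k)"

lemma slot_le: "slot k \<le> k"
  unfolding slot_def using le_prod_encode_1[of "fst (prod_decode k)" "snd (prod_decode k)"] by simp

lemma slot_encode [simp]: "slot (prod_encode (j, i)) = j"
  unfolding slot_def by simp

text \<open>Stage \<open>k\<close> starts in \<open>E k\<close>, chooses \<open>A k\<close> or
  \<open>B k\<close>, can pass through the short set \<open>G k\<close> after \<open>n k\<close>
  steps, and from there over the next \<open>E\<close> after \<open>t k\<close> more.\<close>

locale interval_scheme =
  fixes f :: "real \<Rightarrow> real" and E A B G :: "nat \<Rightarrow> real set" and n t :: "nat \<Rightarrow> nat" and \<delta> :: real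
  assumes cont_funpow: "\<And>k. continuous_on UNIV (f ^^ k)"
    and E: "\<And>k. compact (E k)" "\<And>k. connected (E k)" "\<And>k. E k \<noteq> {}"
    and A: "\<And>k. compact (A k)" "\<And>k. connected (A k)" "\<And>k. A k \<subseteq> E k" "\<And>k. G k \<subseteq> (f ^^ n k) ` A k"
    and B: "\<And>k. compact (B k)" "\<And>k. connected (B k)" "\<And>k. B k \<subseteq> E k" "\<And>k. G k \<subseteq> (f ^^ n k) ` B k"
    and G: "\<And>k. compact (G k)" "\<And>k. connected (G k)" "\<And>k. E (Suc k) \<subseteq> (f ^^ t k) ` G k"
    and dist: "\<And>k a b. a \<in> A k \<Longrightarrow> b \<in> B k \<Longrightarrow> \<delta> \<le> \<bar>a - b\<bar>" "\<delta> > 0"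
    and diam: "\<And>k p q. p \<in> G k \<Longrightarrow> q \<in> G k \<Longrightarrow> \<bar>p - q\<bar> \<le> inverse (real (Suc k))"
    and n: "\<And>k. n k \<ge> 1"
begin

text \<open>The time at which stage \<open>k\<close> begins.\<close>

definition M :: "nat \<Rightarrow> nat" where "M k = (\<Sum>j<k. n j + t j)"

lemma M_ge: "k \<le> M k"
proof (induction k)
  case (Suc k)
  then show ?case using n[of k] unfolding M_def by simp
qed simp

definition side :: "bool \<Rightarrow> nat \<Rightarrow> real set" where "side b k = (if b then A k else B k)"

lemma sides_disjoint: "x \<in> side b k \<Longrightarrow> x \<in> side b' k \<Longrightarrow> b = b'"
  using dist unfolding side_def by (fastforce split: if_splits)

text \<open>The two inclusions record the choice of a side and the short passage; the final equality
  lets the next stage start from the smaller interval.\<close>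

definition child :: "real set \<Rightarrow> nat \<Rightarrow> bool \<Rightarrow> real set \<Rightarrow> bool" where
  "child D k b D' \<longleftrightarrow> D' \<subseteq> D \<and> compact D' \<and> connected D' \<and> (f ^^ M k) ` D' \<subseteq> side b k \<and>
     (f ^^ (M k + n k)) ` D' \<subseteq> G k \<and> (f ^^ M (Suc k)) ` D' = E (Suc k)"

text \<open>Three successive exact restrictions, at the times \<open>M k\<close>,
  \<open>M k + n k\<close> and \<open>M (Suc k)\<close>.\<close>

lemma child_exists:
  assumes D: "connected D" "(f ^^ M k) ` D = E k"
  shows "\<exists>D'. child D k b D'"
proof -
  have img: "(f ^^ (i + j)) ` S = (f ^^ j) ` ((f ^^ i) ` S)" for i j S
    unfolding add.commute[of i j] funpow_add by (simp add: image_comp)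
  have C: "compact (side b k)" "connected (side b k)" "side b k \<subseteq> (f ^^ M k) ` D" "G k \<subseteq> (f ^^ n k) ` side b k"
    unfolding side_def D(2) using A B by auto
  have Gne: "G k \<noteq> {}" using G(3)[of k] E(3)[of "Suc k"] by auto
  then have "side b k \<noteq> {}" using C(4) by (metis image_empty subset_empty)
  then obtain D1 where D1: "connected D1" "D1 \<subseteq> D" "(f ^^ M k) ` D1 = side b k"
    by (rule subinterval_exact_image[OF cont_funpow D(1) C(1,2) _ C(3)])
  have "G k \<subseteq> (f ^^ (M k + n k)) ` D1" unfolding img D1(3) by (rule C(4))
  then obtain D2 where D2: "connected D2" "D2 \<subseteq> D1" "(f ^^ (M k + n k)) ` D2 = G k"
    by (rule subinterval_exact_image[OF cont_funpow D1(1) G(1,2) Gne])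
  have MS: "M (Suc k) = M k + n k + t k" unfolding M_def by simp
  have "E (Suc k) \<subseteq> (f ^^ M (Suc k)) ` D2" unfolding MS img[of "M k + n k"] D2(3) by (rule G(3))
  then obtain D3 where D3: "compact D3" "connected D3" "D3 \<subseteq> D2" "(f ^^ M (Suc k)) ` D3 = E (Suc k)"
    by (rule subinterval_exact_image[OF cont_funpow D2(1) E])
  have "(f ^^ (M k + n k)) ` D3 \<subseteq> G k" using image_mono[OF D3(3)] D2(3) by metis
  moreover have "(f ^^ M k) ` D3 \<subseteq> side b k" using image_mono[OF order_trans[OF D3(3) D2(2)]] D1(3) by metis
  moreover have "D3 \<subseteq> D" using D3(3) D2(2) D1(2) by simp
  ultimately show ?thesis unfolding child_def using D3 by blast
qed

primrec node :: "bool list \<Rightarrow> real set" where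
  "node [] = E 0"
| "node (b # s) = (SOME D'. child (node s) (length s) b D')"

text \<open>The \<open>SOME\<close> in \<open>node\<close> finds a child once the parent maps
  exactly onto its \<open>E\<close>, so the properties of nodes and the child relation depend on
  each other.\<close>

lemma node_props: "compact (node s) \<and> connected (node s) \<and> (f ^^ M (length s)) ` node s = E (length s)"
  and node_child: "child (node s) (length s) b (node (b # s))"
proof -
  have *: "child (node s) (length s) b (node (b # s))"
    if "compact (node s) \<and> connected (node s) \<and> (f ^^ M (length s)) ` node s = E (length s)" for s b
    using someI_ex[OF child_exists[of "node s" "length s" b]] that by simp
  show 1: "compact (node s) \<and> connected (node s) \<and> (f ^^ M (length s)) ` node s = E (length s)" for s
  proof (induction s)
    case Nil
    then show ?case using E by (simp add: M_def)
  next
    case (Cons b s)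
    from *[OF this, of b] show ?case unfolding child_def by simp
  qed
  show "child (node s) (length s) b (node (b # s))" by (rule *[OF 1])
qed

lemma node_nonempty: "node s \<noteq> {}"
  using node_props[of s] E(3)[of "length s"] by auto

definition branch :: "(nat \<Rightarrow> bool) \<Rightarrow> real set" where
  "branch \<alpha> = (\<Inter>k. node (word \<alpha> k))"

lemma node_word_antimono: "j \<le> k \<Longrightarrow> node (word \<alpha> k) \<subseteq> node (word \<alpha> j)"
proof (induction rule: dec_induct)
  case (step k)
  then show ?case using node_child[of "word \<alpha> k" "\<alpha> k"] unfolding child_def by auto
qed simp

lemma node_word_visits:
  assumes "x \<in> node (word \<alpha> k)" "i < k"
  shows "(f ^^ M i) x \<in> side (\<alpha> i) i" "(f ^^ (M i + n i)) x \<in> G i"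
proof -
  have "x \<in> node (word \<alpha> (Suc i))" using assms node_word_antimono[of "Suc i" k \<alpha>] by auto
  then show "(f ^^ M i) x \<in> side (\<alpha> i) i" "(f ^^ (M i + n i)) x \<in> G i"
    using node_child[of "word \<alpha> i" "\<alpha> i"] unfolding child_def by auto
qed

lemma branch_visits:
  assumes "x \<in> branch \<alpha>"
  shows "(f ^^ M i) x \<in> side (\<alpha> i) i" "(f ^^ (M i + n i)) x \<in> G i"
proof -
  have "x \<in> node (word \<alpha> (Suc i))" using assms unfolding branch_def by blast
  from node_word_visits[OF this, of i] show "(f ^^ M i) x \<in> side (\<alpha> i) i" "(f ^^ (M i + n i)) x \<in> G i" by simp_all
qed

lemma branch_unique: "x \<in> branch \<alpha> \<Longrightarrow> x \<in> branch \<beta> \<Longrightarrow> \<alpha> = \<beta>"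
  using branch_visits(1) sides_disjoint by blast

lemma branch_nonempty: "branch \<alpha> \<noteq> {}"
  unfolding branch_def
  by (rule compact_nest) (use node_props node_nonempty node_word_antimono in auto)

lemma branch_interval: "compact (branch \<alpha>)" "connected (branch \<alpha>)"
proof -
  show "compact (branch \<alpha>)" unfolding branch_def using node_props by (intro compact_Inter) auto
  have "{x..y} \<subseteq> node (word \<alpha> k)" if "x \<in> branch \<alpha>" "y \<in> branch \<alpha>" for x y k
    using connected_contains_Icc[of "node (word \<alpha> k)" x y] node_props that unfolding branch_def by blast
  then have "{x..y} \<subseteq> branch \<alpha>" if "x \<in> branch \<alpha>" "y \<in> branch \<alpha>" for x y
    using that unfolding branch_def[of \<alpha>] by blast
  then show "connected (branch \<alpha>)" unfolding connected_iff_interval by fastforce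
qed

text \<open>A rational number in each nondegenerate branch determines its code.\<close>

lemma countable_fat_branches: "countable {\<alpha>. \<exists>p\<in>branch \<alpha>. \<exists>q\<in>branch \<alpha>. p < q}"
proof -
  have "\<exists>r\<in>\<rat>. r \<in> branch \<alpha>" if "\<exists>p\<in>branch \<alpha>. \<exists>q\<in>branch \<alpha>. p < q" for \<alpha>
  proof -
    obtain p q where pq: "p \<in> branch \<alpha>" "q \<in> branch \<alpha>" "p < q" using \<open>\<exists>p\<in>branch \<alpha>. \<exists>q\<in>branch \<alpha>. p < q\<close> by blast
    obtain r where "r \<in> \<rat>" "p < r" "r < q" using Rats_dense_in_real[OF pq(3)] by blast
    moreover from this have "r \<in> {p..q}" by simp
    ultimately show ?thesis using connected_contains_Icc[OF branch_interval(2) pq(1,2)] by blast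
  qed
  then obtain r where r: "\<And>\<alpha>. \<exists>p\<in>branch \<alpha>. \<exists>q\<in>branch \<alpha>. p < q \<Longrightarrow> r \<alpha> \<in> \<rat> \<and> r \<alpha> \<in> branch \<alpha>" by metis
  let ?F = "{\<alpha>. \<exists>p\<in>branch \<alpha>. \<exists>q\<in>branch \<alpha>. p < q}"
  have "inj_on r ?F"
  proof (rule inj_onI)
    fix \<alpha> \<beta> assume "\<alpha> \<in> ?F" "\<beta> \<in> ?F" "r \<alpha> = r \<beta>"
    then show "\<alpha> = \<beta>" using r[of \<alpha>] r[of \<beta>] branch_unique by auto
  qed
  moreover have "countable (r ` ?F)" by (rule countable_subset[OF _ countable_rat]) (use r in auto)
  ultimately show ?thesis by (rule countable_image_inj_on[rotated])
qed

theorem scrambled_cantor_set: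
  "\<exists>K\<subseteq>E 0. cantor_set K \<and> (\<forall>x\<in>K. \<forall>y\<in>K. x \<noteq> y \<longrightarrow>
     (\<forall>e>0. \<forall>N. \<exists>k\<ge>N. \<bar>(f ^^ k) x - (f ^^ k) y\<bar> < e) \<and> (\<forall>N. \<exists>k\<ge>N. \<delta> \<le> \<bar>(f ^^ k) x - (f ^^ k) y\<bar>))"
proof -
  define C where "C \<gamma> = branch (\<gamma> \<circ> slot)" for \<gamma>
  define fat where "fat = {\<gamma>. \<exists>p\<in>C \<gamma>. \<exists>q\<in>C \<gamma>. p < q}"
  have inj: "\<gamma> = \<gamma>'" if "\<gamma> \<circ> slot = \<gamma>' \<circ> slot" for \<gamma> \<gamma>' :: "nat \<Rightarrow> bool"
  proof
    fix j
    show "\<gamma> j = \<gamma>' j" using fun_cong[OF that, of "prod_encode (j, 0)"] by simp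
  qed
  have "countable ((\<lambda>\<gamma>. \<gamma> \<circ> slot) ` fat)"
    by (rule countable_subset[OF _ countable_fat_branches]) (auto simp: fat_def C_def)
  moreover have "inj_on (\<lambda>\<gamma>. \<gamma> \<circ> slot) fat" using inj by (intro inj_onI)
  ultimately have "countable fat" by (rule countable_image_inj_on)
  then obtain \<beta> :: "nat \<Rightarrow> nat \<Rightarrow> bool" where \<beta>: "fat \<subseteq> range \<beta>"
    by (metis empty_subsetI order_refl range_from_nat_into)
  \<comment> \<open>The diagonal argument uses the even coordinates only; the odd ones remain free
    and are flipped later to find nearby points of \<open>K\<close>.\<close>
  define P where "P = {\<gamma>. \<forall>j. \<gamma> (2 * j) \<noteq> \<beta> j (2 * j)}"
  have thin: "x = y" if "\<gamma> \<in> P" "x \<in> C \<gamma>" "y \<in> C \<gamma>" for \<gamma> x y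
  proof -
    have "\<gamma> \<notin> range \<beta>" using that(1) unfolding P_def by auto
    then have "\<gamma> \<notin> fat" using \<beta> by blast
    then show ?thesis using that(2,3) unfolding fat_def by (metis (mono_tags, lifting) linorder_neqE_linordered_idom mem_Collect_eq)
  qed
  have C_unique: "\<gamma> = \<gamma>'" if "x \<in> C \<gamma>" "x \<in> C \<gamma>'" for x \<gamma> \<gamma>'
    using that branch_unique inj unfolding C_def by blast
  define K where "K = (\<Union>\<gamma>\<in>P. C \<gamma>)"
  have visit: "(f ^^ M i) x \<in> side (\<gamma> (slot i)) i" "(f ^^ (M i + n i)) x \<in> G i" if "x \<in> C \<gamma>" for x \<gamma> i
    using branch_visits[of x "\<gamma> \<circ> slot" i] that unfolding C_def by auto
  have KE: "K \<subseteq> E 0"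
  proof
    fix x assume "x \<in> K"
    then obtain \<gamma> where "x \<in> branch (\<gamma> \<circ> slot)" unfolding K_def C_def by blast
    then have "x \<in> node (word (\<gamma> \<circ> slot) 0)" unfolding branch_def by blast
    then show "x \<in> E 0" by simp
  qed
  have apart: "\<exists>k. \<gamma> (slot k) \<noteq> \<gamma>' (slot k) \<and> k \<ge> N" if "\<gamma> \<noteq> \<gamma>'" for \<gamma> \<gamma>' :: "nat \<Rightarrow> bool" and N
  proof -
    obtain j where "\<gamma> j \<noteq> \<gamma>' j" using \<open>\<gamma> \<noteq> \<gamma>'\<close> by blast
    then show ?thesis using le_prod_encode_2[of N j] by (intro exI[of _ "prod_encode (j, N)"]) simp
  qed
  have "K \<noteq> {}"
  proof -
    define \<gamma> where "\<gamma> j = (\<not> \<beta> (j div 2) j)" for j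
    have "\<gamma> \<in> P" unfolding P_def \<gamma>_def by simp
    then show ?thesis using branch_nonempty unfolding K_def C_def by blast
  qed
  moreover have "compact K"
  proof -
    \<comment> \<open>At level \<open>k\<close> only finitely many words occur, so
      \<open>L k\<close> is closed, and \<open>K\<close> is obtained as the intersection of the
      levels.\<close>
    define L where "L k = (\<Union>s\<in>(\<lambda>\<gamma>. word (\<gamma> \<circ> slot) k) ` P. node s)" for k
    have "closed (L k)" for k
    proof -
      have "finite ((\<lambda>\<gamma>. word (\<gamma> \<circ> slot) k) ` P)"
        by (rule finite_subset[OF _ finite_lists_length_eq[of UNIV k]]) auto
      then show ?thesis unfolding L_def using node_props by (intro closed_UN) (auto intro: compact_imp_closed)
    qed
    then have "closed (\<Inter>k. L k)" by auto
    moreover have "(\<Inter>k. L k) = K"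
    proof
      show "K \<subseteq> (\<Inter>k. L k)" unfolding K_def C_def branch_def L_def by blast
      show "(\<Inter>k. L k) \<subseteq> K"
      proof
        fix x assume "x \<in> (\<Inter>k. L k)"
        then have "\<forall>k. \<exists>\<gamma>\<in>P. x \<in> node (word (\<gamma> \<circ> slot) k)" unfolding L_def by blast
        then obtain g where g: "\<And>k. g k \<in> P" "\<And>k. x \<in> node (word (g k \<circ> slot) k)" by metis
        \<comment> \<open>The sides that \<open>x\<close> visits determine the code, so the
          sequences \<open>g k\<close> chosen at different levels agree with it as far as level
          \<open>k\<close> reaches.\<close>
        define \<alpha> where "\<alpha> i \<longleftrightarrow> (f ^^ M i) x \<in> side True i" for i
        have ga: "g k (slot i) = \<alpha> i" if "i < k" for i k
          using node_word_visits(1)[OF g(2)[of k] that] sides_disjoint[of "(f ^^ M i) x" True i "g k (slot i)"]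
          unfolding \<alpha>_def by (cases "g k (slot i)") auto
        have "word (g k \<circ> slot) k = word \<alpha> k" for k by (rule word_cong) (simp add: ga)
        then have "x \<in> node (word \<alpha> k)" for k using g(2)[of k] by simp
        then have x: "x \<in> branch \<alpha>" unfolding branch_def by blast
        define \<gamma> where "\<gamma> j = \<alpha> (prod_encode (j, 0))" for j
        have \<gamma>g: "\<gamma> j = g k j" if "prod_encode (j, 0) < k" for j k
          using ga[OF that] unfolding \<gamma>_def by simp
        have "\<gamma> (slot i) = \<alpha> i" for i
        proof -
          define k where "k = Suc (max i (prod_encode (slot i, 0)))"
          show ?thesis using \<gamma>g[of "slot i" k] ga[of i k] unfolding k_def by simp
        qed
        then have "\<gamma> \<circ> slot = \<alpha>" by auto
        moreover have "\<gamma> \<in> P"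
          unfolding P_def
        proof (intro CollectI allI)
          fix j
          show "\<gamma> (2 * j) \<noteq> \<beta> j (2 * j)"
            using \<gamma>g[of "2 * j" "Suc (prod_encode (2 * j, 0))"] g(1)[of "Suc (prod_encode (2 * j, 0))"]
            unfolding P_def by simp
        qed
        ultimately show "x \<in> K" unfolding K_def C_def using x by blast
      qed
    qed
    ultimately have "closed K" by simp
    then show ?thesis using KE E(1) compact_imp_bounded bounded_subset compact_eq_bounded_closed by blast
  qed
  moreover have "x islimpt K" if "x \<in> K" for x
    unfolding islimpt_approachable
  proof (intro allI impI)
    fix e :: real assume e: "e > 0"
    obtain \<gamma> where \<gamma>: "\<gamma> \<in> P" "x \<in> C \<gamma>" using \<open>x \<in> K\<close> unfolding K_def by blast
    let ?w = "\<lambda>k. word (\<gamma> \<circ> slot) k"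
    \<comment> \<open>For codes in \<open>P\<close> the branch is the single point \<open>x\<close>,
      so by compactness its nodes shrink to \<open>x\<close>.\<close>
    have "\<exists>k. node (?w k) \<subseteq> ball x e"
    proof (rule ccontr)
      assume no: "\<not> ?thesis"
      have "(\<Inter>k. node (?w k) - ball x e) \<noteq> {}"
      proof (rule compact_nest)
        show "compact (node (?w k) - ball x e)" for k using node_props by (intro compact_diff) auto
        show "node (?w k) - ball x e \<noteq> {}" for k using no by auto
        show "node (?w k) - ball x e \<subseteq> node (?w j) - ball x e" if "j \<le> k" for j k
          using node_word_antimono[OF that] by blast
      qed
      then obtain y where "y \<in> (\<Inter>k. node (?w k) - ball x e)" by blast
      then have "y \<in> C \<gamma>" "y \<notin> ball x e" unfolding C_def branch_def by blast+
      then show False using thin[OF \<gamma>(1,2)] e by auto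
    qed
    then obtain k where k: "node (?w k) \<subseteq> ball x e" by blast
    \<comment> \<open>An odd coordinate is not constrained by \<open>P\<close>, and
      \<open>slot i \<le> i\<close> keeps it out of the first \<open>k\<close> letters.\<close>
    define \<gamma>' where "\<gamma>' = \<gamma>(2 * k + 1 := \<not> \<gamma> (2 * k + 1))"
    have "\<gamma>' \<in> P" using \<gamma>(1) unfolding P_def \<gamma>'_def by (auto simp: fun_upd_def) presburger+
    obtain y where y: "y \<in> C \<gamma>'" using branch_nonempty unfolding C_def by blast
    have "word (\<gamma>' \<circ> slot) k = ?w k"
    proof (rule word_cong)
      fix i assume "i < k"
      then have "slot i \<noteq> 2 * k + 1" using slot_le[of i] by simp
      then show "(\<gamma>' \<circ> slot) i = (\<gamma> \<circ> slot) i" unfolding \<gamma>'_def by simp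
    qed
    moreover have "y \<in> node (word (\<gamma>' \<circ> slot) k)" using y unfolding C_def branch_def by blast
    ultimately have "y \<in> ball x e" using k by auto
    moreover have "y \<noteq> x"
    proof
      assume "y = x"
      then have "\<gamma>' = \<gamma>" using C_unique y \<gamma>(2) by blast
      from fun_cong[OF this, of "2 * k + 1"] show False unfolding \<gamma>'_def by simp
    qed
    moreover have "y \<in> K" using y \<open>\<gamma>' \<in> P\<close> unfolding K_def by blast
    ultimately show "\<exists>x'\<in>K. x' \<noteq> x \<and> dist x' x < e" by (auto simp: dist_commute)
  qed
  moreover have "\<exists>p. S \<subseteq> {p}" if S: "S \<subseteq> K" "connected S" for S
  proof -
    have "x = y" if xy: "x \<in> S" "y \<in> S" for x y
    proof (rule ccontr)
      assume "x \<noteq> y"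
      obtain \<gamma> \<gamma>' where g: "\<gamma> \<in> P" "x \<in> C \<gamma>" "\<gamma>' \<in> P" "y \<in> C \<gamma>'" using xy S(1) unfolding K_def by blast
      then have "\<gamma> \<noteq> \<gamma>'" using thin \<open>x \<noteq> y\<close> by blast
      then obtain k where k: "\<gamma> (slot k) \<noteq> \<gamma>' (slot k)" using apart by blast
      \<comment> \<open>At a time where the codes differ, the two disjoint closed sides would
        disconnect the image of \<open>S\<close>.\<close>
      have conn: "connected ((f ^^ M k) ` S)"
        by (rule connected_continuous_image[OF continuous_on_subset[OF cont_funpow] S(2)]) simp
      have sub: "(f ^^ M k) ` S \<subseteq> side True k \<union> side False k"
      proof clarify
        fix z assume "z \<in> S" "(f ^^ M k) z \<notin> side False k"
        then obtain \<gamma> where "z \<in> C \<gamma>" using S(1) unfolding K_def by blast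
        from visit(1)[OF this, of k] show "(f ^^ M k) z \<in> side True k"
          using \<open>(f ^^ M k) z \<notin> side False k\<close> by (cases "\<gamma> (slot k)") auto
      qed
      have cl: "closed (side b k)" for b unfolding side_def using A(1) B(1) by (auto intro: compact_imp_closed)
      have "side True k \<inter> side False k = {}" using sides_disjoint[of _ True k False] by blast
      moreover have "side True k \<inter> (f ^^ M k) ` S \<noteq> {} \<and> side False k \<inter> (f ^^ M k) ` S \<noteq> {}"
        using visit(1)[OF g(2), of k] visit(1)[OF g(4), of k] k xy
        by (cases "\<gamma> (slot k)"; cases "\<gamma>' (slot k)") auto
      ultimately show False using connected_closedD[OF conn _ sub cl cl] by blast
    qed
    then show ?thesis by (cases "S = {}") (simp, blast)
  qed
  ultimately have "cantor_set K" unfolding cantor_set_def by blast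
  moreover have "(\<forall>e>0. \<forall>N. \<exists>k\<ge>N. \<bar>(f ^^ k) x - (f ^^ k) y\<bar> < e) \<and> (\<forall>N. \<exists>k\<ge>N. \<delta> \<le> \<bar>(f ^^ k) x - (f ^^ k) y\<bar>)"
    if xy: "x \<in> K" "y \<in> K" "x \<noteq> y" for x y
  proof (intro conjI allI impI)
    obtain \<gamma> \<gamma>' where g: "\<gamma> \<in> P" "x \<in> C \<gamma>" "\<gamma>' \<in> P" "y \<in> C \<gamma>'" using xy unfolding K_def by blast
    then have ne: "\<gamma> \<noteq> \<gamma>'" using thin xy(3) by blast
    show "\<exists>k\<ge>N. \<delta> \<le> \<bar>(f ^^ k) x - (f ^^ k) y\<bar>" for N
    proof -
      obtain k where k: "\<gamma> (slot k) \<noteq> \<gamma>' (slot k)" "k \<ge> N" using apart[OF ne] by blast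
      have "\<delta> \<le> \<bar>(f ^^ M k) x - (f ^^ M k) y\<bar>"
        using visit(1)[OF g(2), of k] visit(1)[OF g(4), of k] k(1)
          dist(1)[of "(f ^^ M k) x" k "(f ^^ M k) y"] dist(1)[of "(f ^^ M k) y" k "(f ^^ M k) x"]
          abs_minus_commute[of "(f ^^ M k) x" "(f ^^ M k) y"]
        by (cases "\<gamma> (slot k)"; cases "\<gamma>' (slot k)") (simp_all add: side_def)
      then show ?thesis using M_ge[of k] k(2) by (meson order_trans)
    qed
    fix e :: real and N assume "e > 0"
    then obtain k0 where k0: "inverse (real (Suc k0)) < e" using reals_Archimedean by blast
    define k where "k = max k0 N"
    \<comment> \<open>At this time both orbits are inside the short set \<open>G k\<close>, whatever
      sides they chose.\<close>
    have "\<bar>(f ^^ (M k + n k)) x - (f ^^ (M k + n k)) y\<bar> \<le> inverse (real (Suc k))"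
      by (rule diam) (use visit(2) g in blast)+
    also have "\<dots> \<le> inverse (real (Suc k0))" unfolding k_def by (intro le_imp_inverse_le) auto
    finally have "\<bar>(f ^^ (M k + n k)) x - (f ^^ (M k + n k)) y\<bar> < e" using k0 by simp
    moreover have "M k + n k \<ge> N" using M_ge[of k] unfolding k_def by simp
    ultimately show "\<exists>k\<ge>N. \<bar>(f ^^ k) x - (f ^^ k) y\<bar> < e" by blast
  qed
  ultimately show ?thesis using KE by blast
qed

end

text \<open>First the common cover of a hull from both parts, then the transit from that hull into a
  short set. The second time is the same for both parts, so simultaneity is preserved.\<close>

lemma (in addressed) scheme_stage:
  assumes "\<eta> > 0"
  shows "\<exists>N t G k' m'. N \<ge> 1 \<and> compact G \<and> connected G \<and> G \<subseteq> (f ^^ N) ` A k m \<and> G \<subseteq> (f ^^ N) ` B k m \<and>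
    (\<forall>p\<in>G. \<forall>q\<in>G. \<bar>p - q\<bar> \<le> \<eta>) \<and> H k' m' \<subseteq> (f ^^ t) ` G"
proof -
  obtain N k1 m1 where N: "N \<ge> 1" "H k1 m1 \<subseteq> (f ^^ N) ` A k m" "H k1 m1 \<subseteq> (f ^^ N) ` B k m"
    using common_cover[of k m] by blast
  obtain l t k' m' G where G: "compact G" "connected G" "G \<subseteq> (f ^^ l) ` H k1 m1"
    "\<forall>p\<in>G. \<forall>q\<in>G. \<bar>p - q\<bar> \<le> \<eta>" "H k' m' \<subseteq> (f ^^ t) ` G"
    using short_transit[OF assms, of k1 m1] by (elim exE conjE)
  have "G \<subseteq> (f ^^ (l + N)) ` C" if "H k1 m1 \<subseteq> (f ^^ N) ` C" for C
    using order_trans[OF G(3) image_mono[OF that]] unfolding funpow_add by (simp add: image_comp)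
  then have "G \<subseteq> (f ^^ (l + N)) ` A k m" "G \<subseteq> (f ^^ (l + N)) ` B k m" using N by simp_all
  moreover have "l + N \<ge> 1" using N(1) by simp
  ultimately show ?thesis using G by (intro exI conjI) assumption+
qed

lemma (in addressed) scrambled_cantor_subset:
  "\<exists>K\<subseteq>H 0 0. cantor_set K \<and> (\<forall>x\<in>K. \<forall>y\<in>K. x \<noteq> y \<longrightarrow>
     (\<forall>e>0. \<forall>N. \<exists>k\<ge>N. \<bar>(f ^^ k) x - (f ^^ k) y\<bar> < e) \<and> (\<forall>N. \<exists>k\<ge>N. gap \<le> \<bar>(f ^^ k) x - (f ^^ k) y\<bar>))"
proof -
  define stage where "stage j s N t G s' \<longleftrightarrow> N \<ge> 1 \<and> compact G \<and> connected G \<and>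
      G \<subseteq> (f ^^ N) ` A (fst s) (snd s) \<and> G \<subseteq> (f ^^ N) ` B (fst s) (snd s) \<and>
      (\<forall>p\<in>G. \<forall>q\<in>G. \<bar>p - q\<bar> \<le> inverse (real (Suc j))) \<and> H (fst s') (snd s') \<subseteq> (f ^^ t) ` G"
    for j :: nat and s N t G s'
  have ex: "\<exists>s' N t G. stage j s N t G s'" for j s
  proof -
    obtain N t G k' m' where "stage j s N t G (k', m')"
      using scheme_stage[of "inverse (real (Suc j))" "fst s" "snd s"] unfolding stage_def by auto
    then show ?thesis by blast
  qed
  \<comment> \<open>The state is the pair of level and starting time of the current hull. It is
    chosen recursively, since each stage begins at the hull that the previous one covers.\<close>
  have "\<exists>st. \<forall>j. (j = 0 \<longrightarrow> st j = (0, 0)) \<and> (\<exists>N t G. stage j (st j) N t G (st (Suc j)))"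
    using ex by (intro dependent_nat_choice) auto
  then obtain st where st0: "st 0 = (0, 0)" and "\<forall>j. \<exists>N t G. stage j (st j) N t G (st (Suc j))" by blast
  then obtain N t G where st: "\<And>j. stage j (st j) (N j) (t j) (G j) (st (Suc j))" by metis
  let ?E = "\<lambda>j. H (fst (st j)) (snd (st j))"
  let ?A = "\<lambda>j. A (fst (st j)) (snd (st j))"
  let ?B = "\<lambda>j. B (fst (st j)) (snd (st j))"
  interpret interval_scheme f ?E ?A ?B G N t gap
  proof
    fix j
    show "continuous_on UNIV (f ^^ j)" by (rule continuous_on_funpow[OF cont])
    show "compact (?E j)" "connected (?E j)" by (rule H_interval)+
    show "?E j \<noteq> {}" using W_subset_H W_nonempty by blast
    show "compact (?A j)" "connected (?A j)" "compact (?B j)" "connected (?B j)" by (rule A_B_interval)+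
    show "?A j \<subseteq> ?E j" "?B j \<subseteq> ?E j" unfolding A_def B_def by auto
    show "G j \<subseteq> (f ^^ N j) ` ?A j" "G j \<subseteq> (f ^^ N j) ` ?B j" "compact (G j)" "connected (G j)"
      "?E (Suc j) \<subseteq> (f ^^ t j) ` G j" "1 \<le> N j"
      using st[of j] unfolding stage_def by simp_all
    show "\<bar>p - q\<bar> \<le> inverse (real (Suc j))" if "p \<in> G j" "q \<in> G j" for p q
      using st[of j] that unfolding stage_def by blast
    show "gap \<le> \<bar>c - d\<bar>" if "c \<in> ?A j" "d \<in> ?B j" for c d
      using that gap unfolding A_def B_def by auto
  qed (rule gap)
  show ?thesis using scrambled_cantor_set unfolding st0 by simp
qed

theorem nonseparable_imp_scrambled_cantor:
  assumes hf: "horseshoe_free f" and I: "range f \<subseteq> unitI" and nons: "nonseparable_pair f u v"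
  shows "\<exists>\<delta>>0. \<exists>K\<subseteq>unitI. cantor_set K \<and> (\<forall>x\<in>K. \<forall>y\<in>K. x \<noteq> y \<longrightarrow>
     (\<forall>e>0. \<forall>N. \<exists>k\<ge>N. \<bar>(f ^^ k) x - (f ^^ k) y\<bar> < e) \<and> (\<forall>N. \<exists>k\<ge>N. \<delta> \<le> \<bar>(f ^^ k) x - (f ^^ k) y\<bar>))"
proof -
  obtain x ik where x: "x \<in> unitI" "infinite (omega_limit f x)" and nest: "nested_sequence f x ik"
    and inter: "(\<Inter>k\<in>{1..}. periodic_portion f x k (ik k)) = {min u v..max u v}" and uv: "u \<noteq> v"
    using nons unfolding nonseparable_pair_def by blast
  define X where "X n = (f ^^ n) x" for n
  have XI: "X n \<in> unitI" for n using x(1) I unfolding X_def by (cases n) auto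
  have X0: "X 0 = x" unfolding X_def by simp
  interpret orbit f X unfolding X_def by (rule horseshoe_free_orbit[OF hf])
  have inf: "infinite (residue_limit X 1 0)" using x(2) X0 omega_limit_orbit by simp
  interpret solenoid f X by unfold_locales (rule hf, rule inf)
  have pp: "periodic_portion f x k i = real_hull (residue_limit X (2 ^ k) i)" for k i
    unfolding periodic_portion_eq X_def ..
  define a where "a k = (if k = 0 then 0 else ik k)" for k
  \<comment> \<open>\<open>nested_sequence\<close> compares hulls only. A limit point of the inner
    class lies in the outer hull, which is impossible if the indices are incongruent modulo
    \<open>2 ^ k\<close>, since their limit sets would be separated.\<close>
  have addr: "2 ^ k dvd int (a (Suc k)) - int (a k)" for k
  proof (cases "k = 0")
    case False
    have sub: "real_hull (residue_limit X (2 ^ Suc k) (ik (Suc k))) \<subseteq> real_hull (residue_limit X (2 ^ k) (ik k))"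
      using nest False unfolding nested_sequence_def pp by simp
    have ne: "residue_limit X (2 ^ j) i \<noteq> {}" for i j by (rule residue_limit_nonempty[OF bdd]) simp
    obtain w where w: "w \<in> residue_limit X (2 ^ Suc k) (ik (Suc k))" using ne by blast
    have w1: "w \<in> residue_limit X (2 ^ k) (ik (Suc k))"
      using w residue_limit_antimono[of "2 ^ k" "2 ^ Suc k" X "ik (Suc k)"] by auto
    have "w \<in> real_hull (residue_limit X (2 ^ k) (ik k))"
      using w sub subset_real_hull[OF compact_imp_bounded[OF compact_residue_limit[OF bdd]]] by blast
    then have w2: "Inf (residue_limit X (2 ^ k) (ik k)) \<le> w" "w \<le> Sup (residue_limit X (2 ^ k) (ik k))"
      unfolding real_hull_def by auto
    have "\<not> separated (residue_limit X (2 ^ k) (ik (Suc k))) (residue_limit X (2 ^ k) (ik k))"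
    proof
      assume "separated (residue_limit X (2 ^ k) (ik (Suc k))) (residue_limit X (2 ^ k) (ik k))"
      then obtain z where "w < z \<and> (\<forall>b\<in>residue_limit X (2 ^ k) (ik k). z < b) \<or>
          z < w \<and> (\<forall>b\<in>residue_limit X (2 ^ k) (ik k). b < z)"
        using w1 unfolding separated_def by blast
      then show False
      proof (elim disjE conjE)
        assume z: "w < z" "\<forall>b\<in>residue_limit X (2 ^ k) (ik k). z < b"
        have "z \<le> Inf (residue_limit X (2 ^ k) (ik k))" by (rule cInf_greatest[OF ne]) (use z(2) less_imp_le in blast)
        then show False using z(1) w2(1) by simp
      next
        assume z: "z < w" "\<forall>b\<in>residue_limit X (2 ^ k) (ik k). b < z"
        have "Sup (residue_limit X (2 ^ k) (ik k)) \<le> z" by (rule cSup_least[OF ne]) (use z(2) less_imp_le in blast)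
        then show False using z(1) w2(2) by simp
      qed
    qed
    then have "2 ^ k dvd int (ik (Suc k)) - int (ik k)" using separated_residue_limits by blast
    then show ?thesis using False unfolding a_def by simp
  qed simp
  interpret addressed f X a "min u v" "max u v"
  proof unfold_locales
    have "(\<Inter>k\<in>{1..}. real_hull (residue_limit X (2 ^ k) (a k))) = (\<Inter>k\<in>{1..}. periodic_portion f x k (ik k))"
      unfolding pp by (rule INF_cong) (auto simp: a_def)
    then show "(\<Inter>k\<in>{1..}. real_hull (residue_limit X (2 ^ k) (a k))) = {min u v..max u v}" using inter by simp
    show "min u v < max u v" using uv by auto
  qed (rule addr)
  have "H 0 0 \<subseteq> unitI" unfolding H_def by (rule tail_hull_least) (use XI in \<open>auto simp: unitI_def\<close>)
  moreover obtain K where K: "K \<subseteq> H 0 0" "cantor_set K"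
    and sc: "\<forall>x\<in>K. \<forall>y\<in>K. x \<noteq> y \<longrightarrow> (\<forall>e>0. \<forall>N. \<exists>k\<ge>N. \<bar>(f ^^ k) x - (f ^^ k) y\<bar> < e) \<and>
      (\<forall>N. \<exists>k\<ge>N. gap \<le> \<bar>(f ^^ k) x - (f ^^ k) y\<bar>)"
    using scrambled_cantor_subset by (elim exE conjE)
  ultimately have "K \<subseteq> unitI" by simp
  with K(2) sc show ?thesis by (intro exI[of _ gap] exI[of _ K] conjI gap(1))
qed

text \<open>The extension of \<open>f\<close> that is constant on both sides of the unit interval;
  orbits starting in the interval are unchanged.\<close>

definition clamped :: "(real \<Rightarrow> real) \<Rightarrow> real \<Rightarrow> real" where
  "clamped f x = f (max 0 (min 1 x))"

lemma range_clamped: "self_map_I f \<Longrightarrow> range (clamped f) \<subseteq> unitI"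
proof clarify
  fix x assume "self_map_I f"
  moreover have "max 0 (min 1 x) \<in> unitI" unfolding unitI_def by auto
  ultimately show "clamped f x \<in> unitI" unfolding self_map_I_def clamped_def by blast
qed

lemma clamped_funpow:
  assumes f: "self_map_I f" and x: "x \<in> unitI"
  shows "(clamped f ^^ n) x = (f ^^ n) x"
proof (induction n)
  case (Suc n)
  have "(f ^^ n) x \<in> unitI" by (rule funpow_unitI[OF f x])
  then show ?case using Suc by (simp add: clamped_def unitI_def)
qed simp

text \<open>The two sets of a horseshoe are covered by images of the extension and hence lie in
  \<open>unitI\<close>, where its iterates are those of \<open>f\<close>.\<close>

lemma zero_entropy_horseshoe_free:
  assumes f: "self_map_I f" and h: "topological_entropy f = 0"
  shows "horseshoe_free (clamped f)"
proof (rule horseshoe_freeI)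
  have "continuous_on UNIV (\<lambda>x::real. max 0 (min 1 x))" by (intro continuous_intros)
  moreover have "continuous_on unitI f" using f unfolding self_map_I_def by simp
  then have "continuous_on (range (\<lambda>x::real. max 0 (min 1 x))) f"
    by (rule continuous_on_subset) (auto simp: unitI_def)
  ultimately have "continuous_on UNIV (f \<circ> (\<lambda>x. max 0 (min 1 x)))" by (rule continuous_on_compose)
  then show "continuous_on UNIV (clamped f)" unfolding clamped_def[abs_def] o_def .
  show "bounded (range (clamped f))"
    by (rule bounded_subset[OF _ range_clamped[OF f]]) (simp add: unitI_def)
  fix n A B
  assume n: "1 \<le> n" and AB: "compact A" "compact B" "A \<noteq> {}" "A \<inter> B = {}"
    and cov: "A \<union> B \<subseteq> (clamped f ^^ n) ` A" "A \<union> B \<subseteq> (clamped f ^^ n) ` B"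
  have "(clamped f ^^ n) ` A \<subseteq> range (clamped f)" using n by (cases n) auto
  then have I: "A \<union> B \<subseteq> unitI" using cov(1) range_clamped[OF f] by blast
  then have "(clamped f ^^ n) ` A = (f ^^ n) ` A" "(clamped f ^^ n) ` B = (f ^^ n) ` B"
    using clamped_funpow[OF f] by (auto intro!: image_cong)
  then show False
    using zero_entropy_no_horseshoe[OF f h n AB(1,3,2,4) I] cov by simp
qed

lemma nonseparable_pair_clamped:
  assumes f: "self_map_I f"
  shows "nonseparable_pair (clamped f) u v \<longleftrightarrow> nonseparable_pair f u v"
proof -
  have pp: "periodic_portion (clamped f) x k i = periodic_portion f x k i" if "x \<in> unitI" for x k i
    unfolding periodic_portion_eq using clamped_funpow[OF f that] by simp
  have om: "omega_limit (clamped f) x = omega_limit f x" if "x \<in> unitI" for x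
    unfolding omega_limit_def using clamped_funpow[OF f that] by simp
  show ?thesis
    unfolding nonseparable_pair_def nested_sequence_def using pp om by (auto cong: bex_cong)
qed

lemma nonseparable_pair_in_unitI:
  assumes f: "self_map_I f" and n: "nonseparable_pair f u v"
  shows "u \<in> unitI" "v \<in> unitI"
proof -
  obtain x ik where x: "x \<in> unitI"
    and inter: "(\<Inter>k\<in>{1..}. periodic_portion f x k (ik k)) = {min u v..max u v}"
    using n unfolding nonseparable_pair_def by blast
  let ?X = "\<lambda>n. (f ^^ n) x"
  let ?R = "residue_limit ?X (2 ^ 1) (ik 1)"
  have XI: "?X n \<in> unitI" for n by (rule funpow_unitI[OF f x])
  have b: "bounded (range ?X)" by (rule bounded_subset[of unitI]) (use XI in \<open>auto simp: unitI_def\<close>)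
  have "?R \<subseteq> unitI" by (rule residue_limit_subset_closed[of _ 0]) (use XI in \<open>auto simp: unitI_def\<close>)
  then have "real_hull ?R \<subseteq> unitI"
    by (intro real_hull_subset residue_limit_nonempty[OF b] compact_imp_bounded[OF compact_residue_limit[OF b]])
      (auto simp: unitI_def)
  moreover have "{min u v..max u v} \<subseteq> periodic_portion f x 1 (ik 1)"
    unfolding inter[symmetric] by (rule INF_lower) simp
  ultimately have "{min u v..max u v} \<subseteq> unitI" unfolding periodic_portion_eq by (rule order_trans[rotated])
  then show "u \<in> unitI" "v \<in> unitI" by (auto simp: min_def max_def split: if_splits)
qed

section \<open>Limits of distances and uncountability of Cantor sets\<close>

lemma liminf_ereal_eq_0_iff:
  fixes D :: "nat \<Rightarrow> real"
  assumes "\<And>n. D n \<ge> 0"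
  shows "liminf (\<lambda>n. ereal (D n)) = 0 \<longleftrightarrow> (\<forall>e>0. \<forall>N. \<exists>n\<ge>N. D n < e)"
proof
  assume L: "liminf (\<lambda>n. ereal (D n)) = 0"
  show "\<forall>e>0. \<forall>N. \<exists>n\<ge>N. D n < e"
  proof (intro allI impI, rule ccontr)
    fix e :: real and N assume e: "e > 0" and no: "\<not> (\<exists>n\<ge>N. D n < e)"
    have "ereal e \<le> liminf (\<lambda>n. ereal (D n))"
      by (intro Liminf_bounded eventually_sequentiallyI[of N]) (use no in \<open>auto simp: not_less\<close>)
    then show False using L e by simp
  qed
next
  assume R: "\<forall>e>0. \<forall>N. \<exists>n\<ge>N. D n < e"
  have "0 \<le> liminf (\<lambda>n. ereal (D n))" by (intro Liminf_bounded always_eventually allI) (simp add: assms)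
  moreover have "\<not> 0 < liminf (\<lambda>n. ereal (D n))"
  proof
    assume "0 < liminf (\<lambda>n. ereal (D n))"
    then obtain e where e: "0 < ereal e" "ereal e < liminf (\<lambda>n. ereal (D n))" using ereal_dense2 by blast
    then obtain N where "\<And>n. n \<ge> N \<Longrightarrow> e < D n"
      using less_LiminfD[OF e(2)] unfolding eventually_sequentially by auto
    moreover obtain n where "n \<ge> N" "D n < e" using R e(1) by auto
    ultimately show False by fastforce
  qed
  ultimately show "liminf (\<lambda>n. ereal (D n)) = 0" by simp
qed

lemma limsup_ereal_geI:
  fixes D :: "nat \<Rightarrow> real"
  assumes "\<And>N. \<exists>n\<ge>N. \<delta> \<le> D n"
  shows "ereal \<delta> \<le> limsup (\<lambda>n. ereal (D n))"
proof (rule ccontr)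
  assume "\<not> ?thesis"
  then have "limsup (\<lambda>n. ereal (D n)) < ereal \<delta>" by simp
  then obtain N where N: "\<And>n. n \<ge> N \<Longrightarrow> D n < \<delta>"
    using Limsup_lessD[of sequentially "\<lambda>n. ereal (D n)" "ereal \<delta>"] unfolding eventually_sequentially by auto
  obtain n where "n \<ge> N" "\<delta> \<le> D n" using assms by blast
  then show False using N[of n] by simp
qed

lemma delta_scrambled_imp_scrambled:
  assumes "delta_scrambled_pair f \<delta> x y" "\<delta> > 0"
  shows "scrambled_pair f x y"
proof -
  have "\<not> asymptotic f x y"
  proof
    assume "asymptotic f x y"
    then have "(\<lambda>n. ereal \<bar>(f ^^ n) x - (f ^^ n) y\<bar>) \<longlonglongrightarrow> ereal 0"
      unfolding asymptotic_def by (simp only: lim_ereal)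
    then have "limsup (\<lambda>n. ereal \<bar>(f ^^ n) x - (f ^^ n) y\<bar>) = ereal 0"
      by (intro lim_imp_Limsup) simp_all
    then show False using assms unfolding delta_scrambled_pair_def by simp
  qed
  then show ?thesis using assms(1) unfolding scrambled_pair_def delta_scrambled_pair_def proximal_def by blast
qed

text \<open>In a perfect set the complement of a point is relatively open and dense. If there were
  countably many points, Baire's theorem would make the intersection of these complements dense, but
  it is empty.\<close>

lemma uncountable_cantor_set:
  assumes "cantor_set K"
  shows "uncountable K"
proof
  assume c: "countable K"
  have K: "K \<noteq> {}" "compact K" "\<And>x. x \<in> K \<Longrightarrow> x islimpt K" using assms unfolding cantor_set_def by auto
  have "K \<subseteq> closure (\<Inter>((\<lambda>x. K - {x}) ` K))"
  proof (rule Baire)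
    show "closed K" by (rule compact_imp_closed[OF K(2)])
    show "countable ((\<lambda>x. K - {x}) ` K)" using c by simp
    fix T assume "T \<in> (\<lambda>x. K - {x}) ` K"
    then obtain x where x: "x \<in> K" "T = K - {x}" by blast
    have "openin (top_of_set K) T" unfolding x(2) by (intro openin_delete) simp
    moreover have "K \<subseteq> closure T"
    proof
      fix y assume "y \<in> K"
      show "y \<in> closure T"
      proof (cases "y = x")
        case True
        have "K = insert x T" using x by blast
        then have "y islimpt T" using K(3)[OF x(1)] True by (simp add: islimpt_insert)
        then show ?thesis unfolding closure_def by simp
      next
        case False
        then have "y \<in> T" using \<open>y \<in> K\<close> x(2) by simp
        then show ?thesis using closure_subset by blast
      qed
    qed
    ultimately show "openin (top_of_set K) T \<and> K \<subseteq> closure T" by blast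
  qed
  moreover have "\<Inter>((\<lambda>x. K - {x}) ` K) = {}" using K(1) by auto
  ultimately show False using K(1) by simp
qed

subsection \<open>Equivalences\<close>

theorem mainTheorem11:
  fixes f :: "real \<Rightarrow> real"
  assumes "self_map_I f"
    and "topological_entropy f = 0"
  shows "(li_yorke_chaotic f \<longleftrightarrow> (\<exists>x\<in>unitI. \<exists>y\<in>unitI. scrambled_pair f x y))
       \<and> ((\<exists>x\<in>unitI. \<exists>y\<in>unitI. scrambled_pair f x y) \<longleftrightarrow>
            (\<exists>\<delta>>0. \<exists>K\<subseteq>unitI. cantor_set K \<and> delta_scrambled_set f \<delta> K))
       \<and> ((\<exists>\<delta>>0. \<exists>K\<subseteq>unitI. cantor_set K \<and> delta_scrambled_set f \<delta> K) \<longleftrightarrow>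
            (\<exists>u\<in>unitI. \<exists>v\<in>unitI. nonseparable_pair f u v))"
proof -
  note f = assms(1)
  have hf: "horseshoe_free (clamped f)" by (rule zero_entropy_horseshoe_free[OF assms])
  let ?LY = "li_yorke_chaotic f"
  let ?SP = "\<exists>x\<in>unitI. \<exists>y\<in>unitI. scrambled_pair f x y"
  let ?CS = "\<exists>\<delta>>0. \<exists>K\<subseteq>unitI. cantor_set K \<and> delta_scrambled_set f \<delta> K"
  let ?NS = "\<exists>u\<in>unitI. \<exists>v\<in>unitI. nonseparable_pair f u v"
  have 31: ?LY if ?CS
  proof -
    obtain \<delta> K where K: "\<delta> > 0" "K \<subseteq> unitI" "cantor_set K" "delta_scrambled_set f \<delta> K"
      using \<open>?CS\<close> by (elim exE conjE)
    have "scrambled_set f K"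
      unfolding scrambled_set_def
    proof (intro ballI impI)
      fix x y assume "x \<in> K" "y \<in> K" "x \<noteq> y"
      then have "delta_scrambled_pair f \<delta> x y" using K(4) unfolding delta_scrambled_set_def by simp
      then show "scrambled_pair f x y" by (rule delta_scrambled_imp_scrambled[OF _ K(1)])
    qed
    then show ?thesis
      unfolding li_yorke_chaotic_def using K(2) uncountable_cantor_set[OF K(3)] by (intro exI[of _ K] conjI)
  qed
  have 12: ?SP if ?LY
  proof -
    obtain C where C: "C \<subseteq> unitI" "uncountable C" "scrambled_set f C"
      using \<open>?LY\<close> unfolding li_yorke_chaotic_def by blast
    obtain x where x: "x \<in> C" using C(2) by fastforce
    have "uncountable (C - {x})" using C(2) by (simp add: uncountable_minus_countable)
    then have "C - {x} \<noteq> {}" by (metis countable_empty)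
    then obtain y where "y \<in> C" "y \<noteq> x" by blast
    moreover from this have "scrambled_pair f x y" using x C(3) unfolding scrambled_set_def by simp
    ultimately show ?thesis using x C(1) by blast
  qed
  have 24: ?NS if ?SP
  proof -
    obtain x y where xy: "x \<in> unitI" "y \<in> unitI" "scrambled_pair f x y" using \<open>?SP\<close> by blast
    have "\<exists>u v. nonseparable_pair (clamped f) u v"
    proof (rule scrambled_imp_nonseparable[OF hf xy(1,2)])
      show "\<not> asymptotic (clamped f) x y"
        using xy unfolding scrambled_pair_def asymptotic_def by (simp add: clamped_funpow[OF f])
      show "\<exists>n\<ge>N. \<bar>(clamped f ^^ n) x - (clamped f ^^ n) y\<bar> < e" if "e > 0" for e N
        using xy that liminf_ereal_eq_0_iff[of "\<lambda>n. \<bar>(f ^^ n) x - (f ^^ n) y\<bar>"]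
        unfolding scrambled_pair_def proximal_def by (simp add: clamped_funpow[OF f])
    qed
    then show ?thesis
      using nonseparable_pair_in_unitI[OF f] unfolding nonseparable_pair_clamped[OF f] by blast
  qed
  have 43: ?CS if ?NS
  proof -
    obtain u v where "nonseparable_pair (clamped f) u v"
      using \<open>?NS\<close> unfolding nonseparable_pair_clamped[OF f] by blast
    from nonseparable_imp_scrambled_cantor[OF hf range_clamped[OF f] this]
    obtain \<delta> K where K: "\<delta> > 0" "K \<subseteq> unitI" "cantor_set K"
      and sc: "\<forall>x\<in>K. \<forall>y\<in>K. x \<noteq> y \<longrightarrow>
        (\<forall>e>0. \<forall>N. \<exists>k\<ge>N. \<bar>(clamped f ^^ k) x - (clamped f ^^ k) y\<bar> < e) \<and>
        (\<forall>N. \<exists>k\<ge>N. \<delta> \<le> \<bar>(clamped f ^^ k) x - (clamped f ^^ k) y\<bar>)"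
      by (elim exE conjE)
    have "delta_scrambled_pair f \<delta> x y" if "x \<in> K" "y \<in> K" "x \<noteq> y" for x y
    proof -
      have "x \<in> unitI" "y \<in> unitI" using that K(2) by auto
      then have "(\<forall>e>0. \<forall>N. \<exists>k\<ge>N. \<bar>(f ^^ k) x - (f ^^ k) y\<bar> < e) \<and> (\<forall>N. \<exists>k\<ge>N. \<delta> \<le> \<bar>(f ^^ k) x - (f ^^ k) y\<bar>)"
        using sc[rule_format, OF that] by (simp add: clamped_funpow[OF f])
      then show ?thesis
        unfolding delta_scrambled_pair_def
        using liminf_ereal_eq_0_iff[of "\<lambda>n. \<bar>(f ^^ n) x - (f ^^ n) y\<bar>"]
          limsup_ereal_geI[of \<delta> "\<lambda>n. \<bar>(f ^^ n) x - (f ^^ n) y\<bar>"] by simp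
    qed
    then have "delta_scrambled_set f \<delta> K" unfolding delta_scrambled_set_def by simp
    with K show ?thesis by (intro exI[of _ \<delta>] exI[of _ K] conjI)
  qed
  show ?thesis using 31 12 24 43 by blast
qed

end
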